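(* Let $f_{X_\nu}(x,t)=\int_0^\infty f_B(x,z)f_{\Gamma_\nu}(z,t)\,dz$ be the density of $X_\nu(t)=B(\Gamma_\nu(t))$ for $\nu\in(0,1)$, and $f_{\overline{X}_\nu}(x,t)=\int_0^\infty f_B(x,z)f_{\overline{\Gamma}_\nu}(z,t)\,dz$ the density of $\overline{X}_\nu(t)=B(\overline{\Gamma}_\nu(t))$ for $\nu>1$, with Gamma parameter $b=1$. Then $f_{X_\nu}$ satisfies $$\frac12\frac{\partial^2}{\partial x^2}f_{X_\nu}=(1-\mathcal{O}^\nu_{-1,t})f_{X_\nu},\qquad x\ge0,\ t>1,\ \nu\in(0,1),$$ while $f_{\overline{X}_\nu}$ satisfies $$\frac12\frac{\partial^2}{\partial x^2}f_{\overline{X}_\nu}=(1-\overline{\mathcal{O}}^\nu_{-1,t})f_{\overline{X}_\nu},\qquad x\ge0,\ t>1,\ \nu>1.$$ The boundary conditions for both equations are $\lim_{|x|\to\infty}f(x,t)=0$ and $\lim_{|x|\to\infty}\frac{\partial}{\partial x}f(x,t)=0$, where $f=f_{X_\nu}$ for $\nu\in(0,1)$ and $f=f_{\overline{X}_\nu}$ for $\nu\in(1,\infty)$.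
   Context: $B$ is a standard Brownian motion with transition density $f_B(x,t)=(2\pi t)^{-1/2}e^{-x^2/(2t)}$. $\Gamma(t)$, $t\ge0$, is the Gamma subordinator with parameter $b=1$, with density $f_\Gamma(x,t)=\frac{1}{\Gamma(t)}x^{t-1}e^{-x}$, $x\ge0$. $\mathcal{A}_\alpha$ ($0<\alpha<1$) is the stable subordinator with $\mathbb{E}e^{-k\mathcal{A}_\alpha(t)}=e^{-k^\alpha t}$, $k>0$, and $\mathcal{L}_\nu(t):=\inf\{z\ge0:\mathcal{A}_\nu(z)>t\}$. The fractional Gamma processes are $\Gamma_\nu(t)=\Gamma(\mathcal{L}_\nu(t))$ for $\nu\in(0,1)$ and $\overline{\Gamma}_\nu(t)=\Gamma(\mathcal{A}_{1/\nu}(t))$ for $\nu>1$, with densities $f_{\Gamma_\nu}$, $f_{\overline{\Gamma}_\nu}$; the processes $B$, $\Gamma$ and $\mathcal{L}_\nu$ (resp. $\mathcal{A}_{1/\nu}$) are independent. Caputo derivative ($0<\nu<1$): $D_t^\nu u(t)=\frac{1}{\Gamma(1-\nu)}\int_0^t (t-s)^{-\nu}u'(s)\,ds$. Right-sided Riemann–Liouville derivative ($m-1<\nu<m$): $\mathcal{D}^\nu_{-,t}u(t)=\frac{1}{\Gamma(m-\nu)}\left(-\frac{d}{dt}\right)^m\int_t^{+\infty}\frac{u(s)}{(s-t)^{1+\nu-m}}\,ds$, and $\mathcal{D}^n_{-,t}=(-1)^n d^n/dt^n$ for $n\in\mathbb{N}$. Fractional shift operators (provided the series converge), acting on the variable $t$: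 $\mathcal{O}^\nu_{c,t}f:=\sum_{n\ge0}\frac{c^n}{n!}\underbrace{D_t^\nu\cdots D_t^\nu}_{n\text{ times}}f$ for $\nu\le1$ and $\overline{\mathcal{O}}^\nu_{c,t}f:=\sum_{n\ge0}\frac{(-c)^n}{n!}\underbrace{\mathcal{D}_{-,t}^\nu\cdots\mathcal{D}_{-,t}^\nu}_{n\text{ times}}f$ for $\nu\ge1$.
   Formalization: The equations are claimed only where their terms are finite: the integral defining f(x,t) must converge (it is infinite at x=0), and for non-integer ν>1 the integral in the Riemann–Liouville derivative of f must converge at t (it diverges for 1<ν≤4/3). *)

theory Defs
  imports "HOL-Probability.Probability"
begin

section \<open>Processes\<close>

text \<open>Only times \<open>t \<ge> 0\<close> are meaningful; values at negative times are never used.\<close>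

definition independent_increments :: "'w measure \<Rightarrow> (real \<Rightarrow> 'w \<Rightarrow> real) \<Rightarrow> bool" where
  "independent_increments M X \<longleftrightarrow>
     (\<forall>(n::nat) (t :: nat \<Rightarrow> real). 0 \<le> t 0 \<and> mono t \<longrightarrow>
        prob_space.indep_vars M (\<lambda>_. borel)
          (\<lambda>i \<omega>. X (t (Suc i)) \<omega> - X (t i) \<omega>) {..<n})"

definition standard_brownian_motion :: "'w measure \<Rightarrow> (real \<Rightarrow> 'w \<Rightarrow> real) \<Rightarrow> bool" where
  "standard_brownian_motion M B \<longleftrightarrow>
     (\<forall>t\<ge>0. B t \<in> borel_measurable M) \<and>
     (\<forall>\<omega>\<in>space M. B 0 \<omega> = 0 \<and> continuous_on {0..} (\<lambda>t. B t \<omega>)) \<and>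
     independent_increments M B \<and>
     (\<forall>s\<ge>0. \<forall>t>s. distributed M lborel (\<lambda>\<omega>. B t \<omega> - B s \<omega>)
        (\<lambda>x. ennreal (normal_density 0 (sqrt (t - s)) x)))"

definition subordinator :: "'w measure \<Rightarrow> (real \<Rightarrow> 'w \<Rightarrow> real) \<Rightarrow> bool" where
  "subordinator M X \<longleftrightarrow>
     (\<forall>t\<ge>0. X t \<in> borel_measurable M) \<and>
     (\<forall>\<omega>\<in>space M. X 0 \<omega> = 0 \<and> mono_on {0..} (\<lambda>t. X t \<omega>) \<and>
        (\<forall>t\<ge>0. continuous (at_right t) (\<lambda>s. X s \<omega>))) \<and>
     independent_increments M X \<and>
     (\<forall>s\<ge>0. \<forall>h\<ge>0. distr M borel (\<lambda>\<omega>. X (s + h) \<omega> - X s \<omega>) = distr M borel (X h))"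

definition gamma_density :: "real \<Rightarrow> real \<Rightarrow> real" where
  "gamma_density x t = (if x < 0 then 0 else x powr (t - 1) * exp (- x) / Gamma t)"

definition gamma_subordinator :: "'w measure \<Rightarrow> (real \<Rightarrow> 'w \<Rightarrow> real) \<Rightarrow> bool" where
  "gamma_subordinator M G \<longleftrightarrow> subordinator M G \<and>
     (\<forall>t>0. distributed M lborel (G t) (\<lambda>x. ennreal (gamma_density x t)))"

definition stable_subordinator :: "'w measure \<Rightarrow> real \<Rightarrow> (real \<Rightarrow> 'w \<Rightarrow> real) \<Rightarrow> bool" where
  "stable_subordinator M \<alpha> A \<longleftrightarrow> subordinator M A \<and>
     (\<forall>t\<ge>0. \<forall>k>0. integral\<^sup>L M (\<lambda>\<omega>. exp (- k * A t \<omega>)) = exp (- (k powr \<alpha>) * t))"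

text \<open>The first passage time is infinite on the event that the path never exceeds \<open>t\<close>. This event
  is null for a stable subordinator; it gets the value 0 because \<open>Inf {}\<close> is unspecified
  on the reals.\<close>

definition inverse_process :: "(real \<Rightarrow> 'w \<Rightarrow> real) \<Rightarrow> real \<Rightarrow> 'w \<Rightarrow> real" where
  "inverse_process A t \<omega> =
     (if \<exists>z\<ge>0. A z \<omega> > t then Inf {z. z \<ge> 0 \<and> A z \<omega> > t} else 0)"

definition independent_processes ::
  "'w measure \<Rightarrow> (real \<Rightarrow> 'w \<Rightarrow> real) \<Rightarrow> (real \<Rightarrow> 'w \<Rightarrow> real) \<Rightarrow> (real \<Rightarrow> 'w \<Rightarrow> real) \<Rightarrow> bool" where
  "independent_processes M X Y Z \<longleftrightarrow>
     prob_space.indep_vars M (\<lambda>_. PiM {0..} (\<lambda>_. borel))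
       (\<lambda>i \<omega>. \<lambda>s\<in>{0..}. ([X, Y, Z] ! i) s \<omega>) {..<3}"

definition density_family ::
  "'w measure \<Rightarrow> (real \<Rightarrow> 'w \<Rightarrow> real) \<Rightarrow> (real \<Rightarrow> real \<Rightarrow> real) \<Rightarrow> bool" where
  "density_family M Y f \<longleftrightarrow>
     (\<forall>t>0. (\<forall>z. 0 \<le> f z t) \<and> distributed M lborel (Y t) (\<lambda>z. ennreal (f z t)))"

section \<open>The subordinated density\<close>

definition brownian_density :: "real \<Rightarrow> real \<Rightarrow> real" where
  "brownian_density x t = (2 * pi * t) powr (- 1 / 2) * exp (- (x\<^sup>2) / (2 * t))"

text \<open>Altering \<open>f\<close> on a null set for some time does not change \<open>subordinated_density f\<close>,
  so any version of the density of the time change may be used.\<close>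

definition subordinated_density :: "(real \<Rightarrow> real \<Rightarrow> real) \<Rightarrow> real \<Rightarrow> real \<Rightarrow> real" where
  "subordinated_density f x t = (LINT z:{0<..}|lborel. brownian_density x z * f z t)"

text \<open>Always true for \<open>x \<noteq> 0\<close>, since then the Gaussian factor is bounded in \<open>z\<close>. At \<open>x = 0\<close>
  the integral has the integrand \<open>f z t / sqrt (2 * pi * z)\<close> and may diverge.\<close>

definition subordinated_density_finite :: "(real \<Rightarrow> real \<Rightarrow> real) \<Rightarrow> real \<Rightarrow> real \<Rightarrow> bool" where
  "subordinated_density_finite f x t \<longleftrightarrow>
     set_integrable lborel {0<..} (\<lambda>z. brownian_density x z * f z t)"

section \<open>Fractional derivatives and shift operators\<close>

text \<open>Each operator is a total function, accompanied by a predicate stating that the integrals,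
  derivatives and series in its definition really exist at the given point.\<close>

definition caputo :: "real \<Rightarrow> (real \<Rightarrow> real) \<Rightarrow> real \<Rightarrow> real" where
  "caputo \<nu> u t =
     1 / Gamma (1 - \<nu>) * (LINT s:{0<..<t}|lborel. (t - s) powr (- \<nu>) * deriv u s)"

definition caputo_exists :: "real \<Rightarrow> (real \<Rightarrow> real) \<Rightarrow> real \<Rightarrow> bool" where
  "caputo_exists \<nu> u t \<longleftrightarrow>
     (\<forall>s\<in>{0<..<t}. u differentiable (at s)) \<and>
     set_integrable lborel {0<..<t} (\<lambda>s. (t - s) powr (- \<nu>) * deriv u s)"

definition caputo_shift :: "real \<Rightarrow> real \<Rightarrow> (real \<Rightarrow> real) \<Rightarrow> real \<Rightarrow> real" where
  "caputo_shift \<nu> c u t = (\<Sum>n. c ^ n / fact n * (caputo \<nu> ^^ n) u t)"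

definition caputo_shift_exists :: "real \<Rightarrow> real \<Rightarrow> (real \<Rightarrow> real) \<Rightarrow> real \<Rightarrow> bool" where
  "caputo_shift_exists \<nu> c u t \<longleftrightarrow>
     (\<forall>n. \<forall>s\<in>{0<..t}. caputo_exists \<nu> ((caputo \<nu> ^^ n) u) s) \<and>
     summable (\<lambda>n. c ^ n / fact n * (caputo \<nu> ^^ n) u t)"

text \<open>The order is the \<open>m\<close> with \<open>m - 1 < \<nu> < m\<close> if \<open>\<nu>\<close> is not an integer, and \<open>\<nu>\<close> itself if it is.\<close>

definition rl_order :: "real \<Rightarrow> nat" where
  "rl_order \<nu> = nat \<lceil>\<nu>\<rceil>"

definition rl_tail :: "real \<Rightarrow> (real \<Rightarrow> real) \<Rightarrow> real \<Rightarrow> real" where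
  "rl_tail \<nu> u t =
     (LINT s:{t<..}|lborel. u s / (s - t) powr (1 + \<nu> - real (rl_order \<nu>)))"

definition rl_tail_converges :: "real \<Rightarrow> (real \<Rightarrow> real) \<Rightarrow> real \<Rightarrow> bool" where
  "rl_tail_converges \<nu> u t \<longleftrightarrow>
     set_integrable lborel {t<..} (\<lambda>s. u s / (s - t) powr (1 + \<nu> - real (rl_order \<nu>)))"

definition rl_right :: "real \<Rightarrow> (real \<Rightarrow> real) \<Rightarrow> real \<Rightarrow> real" where
  "rl_right \<nu> u t =
     (if \<nu> \<in> \<nat> then (- 1) ^ rl_order \<nu> * (deriv ^^ rl_order \<nu>) u t
      else 1 / Gamma (real (rl_order \<nu>) - \<nu>) *
           ((- 1) ^ rl_order \<nu> * (deriv ^^ rl_order \<nu>) (rl_tail \<nu> u) t))"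

definition rl_right_exists :: "real \<Rightarrow> (real \<Rightarrow> real) \<Rightarrow> real \<Rightarrow> bool" where
  "rl_right_exists \<nu> u t \<longleftrightarrow>
     (\<nu> \<notin> \<nat> \<longrightarrow> (\<forall>\<^sub>F r in nhds t. rl_tail_converges \<nu> u r)) \<and>
     (\<forall>k<rl_order \<nu>. \<forall>\<^sub>F r in nhds t.
        (deriv ^^ k) (if \<nu> \<in> \<nat> then u else rl_tail \<nu> u) differentiable (at r))"

definition rl_shift :: "real \<Rightarrow> real \<Rightarrow> (real \<Rightarrow> real) \<Rightarrow> real \<Rightarrow> real" where
  "rl_shift \<nu> c u t = (\<Sum>n. (- c) ^ n / fact n * (rl_right \<nu> ^^ n) u t)"

definition rl_shift_exists :: "real \<Rightarrow> real \<Rightarrow> (real \<Rightarrow> real) \<Rightarrow> real \<Rightarrow> bool" where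
  "rl_shift_exists \<nu> c u t \<longleftrightarrow>
     (\<forall>n. \<forall>s\<ge>t. rl_right_exists \<nu> ((rl_right \<nu> ^^ n) u) s) \<and>
     summable (\<lambda>n. (- c) ^ n / fact n * (rl_right \<nu> ^^ n) u t)"

section \<open>Derivatives in the space variable\<close>

definition twice_differentiable_at :: "(real \<Rightarrow> real) \<Rightarrow> real \<Rightarrow> bool" where
  "twice_differentiable_at u x \<longleftrightarrow>
     (\<forall>\<^sub>F y in nhds x. u differentiable (at y)) \<and> deriv u differentiable (at x)"

definition vanishes_at_infinity :: "(real \<Rightarrow> real) \<Rightarrow> bool" where
  "vanishes_at_infinity u \<longleftrightarrow>
     (u \<longlongrightarrow> 0) at_infinity \<and>
     (\<forall>\<^sub>F x in at_infinity. u differentiable (at x)) \<and>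
     (deriv u \<longlongrightarrow> 0) at_infinity"

end

theory Submission
  imports Defs "HOL-Complex_Analysis.Complex_Analysis" "HOL-Real_Asymp.Real_Asymp"
begin

text \<open>
  Let \<open>T\<close> be the random clock, so that \<open>T t\<close> is the inverse stable time for orders below one and
  the stable time for orders above one.  Conditioning on the clock gives
  \<open>f(x, t) = E K(x, T t)\<close>, where \<open>K(x, l)\<close> is the density of Brownian motion at the gamma time
  \<open>l\<close> (a variance gamma density).  For \<open>x \<noteq> 0\<close> three facts carry the proof.

  First, \<open>K(x, l)\<close> is \<open>1 / Gamma l\<close> times a Mellin integral of the Gaussian kernel.  Near
  \<open>z = 0\<close> that kernel vanishes faster than every power, so \<open>K(x, \<cdot>)\<close> extends to an entire
  function (\<open>vg_kernel x n\<close> is its \<open>n\<close>-th derivative on the real line).  The heat equation and one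
  integration by parts turn \<open>K''/2\<close>, primes denoting \<open>x\<close>-derivatives, into
  \<open>K(x, l) - K(x, l - 1)\<close> (\<open>vg_kernel_gamma_mean_xx\<close>): half the Laplacian is the identity minus
  the unit backward shift in gamma time.  As \<open>K(x, \<cdot>)\<close> is bounded on the strip
  \<open>Re w \<ge> -2, \<bar>Im w\<bar> \<le> 2\<close>, Cauchy's estimate on discs of radius two lets the Taylor series
  of \<open>K(x, l - 1)\<close> be integrated term by term, and
  \<open>f - f''/2 = (\<Sum>n. (-1)^n / n! * E (d/dl)^n K(x, T t))\<close> (\<open>vg_kernel_series\<close>).

  Second, for orders below one the Caputo derivative of \<open>t \<mapsto> E g(T t)\<close> is \<open>E g'(T t)\<close>.
  By scaling, \<open>T t\<close> has the law of \<open>t^\<nu> \<Lambda>\<close> with \<open>\<Lambda> = A 1 ^ -\<nu>\<close>, and the claim becomes an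
  identity between the law of \<open>t^\<nu> \<Lambda>\<close> and a mixture of size-biased laws.  Both sides have the
  Mittag--Leffler moments, which determine them (\<open>caputo_mixture_eq\<close>, \<open>caputo_of_mean\<close>).

  Third, for orders above one \<open>E g(T t)\<close> has to be treated with care, because \<open>K(x, l)\<close> decays only
  like \<open>l^(-1/2)\<close> and the defining tail integral may diverge.  From the Fourier representation of the
  Gaussian kernel, \<open>K(x, \<cdot>)\<close> and \<open>f(x, \<cdot>)\<close> are Laplace integrals
  \<open>W 0 t = \<integral> S(l) t e^(-t l) dl\<close> of a bounded oscillating function \<open>S\<close>, and the right-sided derivative
  of order \<open>\<nu>\<close> acts by \<open>W a \<mapsto> W (a + \<nu>)\<close> (\<open>rl_right_W\<close>).  The convergence assumed for the
  first tail integral implies that \<open>S\<close> is small enough at the origin for this step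
  (\<open>strong_of_tail\<close>); all later iterates converge by themselves.  The iterates are identified
  with \<open>(-1)^n E (d/dl)^n K(x, T t)\<close> in \<open>mean_W\<close>.

  In both cases the shift operator applied to \<open>f\<close> is therefore the series of the first step.  At
  \<open>x = 0\<close> the density is infinite, because the clock is below \<open>1/2\<close> with positive probability and
  \<open>E G(l)^(-1/2) = \<infinity>\<close> for \<open>l \<le> 1/2\<close> (\<open>not_finite_at_0\<close>).
\<close>

section \<open>Differentiation under the integral sign; determinacy by moments and Laplace transforms\<close>

text \<open>By the mean value theorem the bound on the derivative also dominates the difference quotients, so that dominated convergence applies along every sequence of increments tending to zero.\<close>

lemma
  fixes F F' :: "real \<Rightarrow> 'a \<Rightarrow> real"
  assumes x: "x \<in> {a<..<b}"
    and int: "\<And>y. y \<in> {a<..<b} \<Longrightarrow> integrable M (F y)"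
    and der: "\<And>y w. y \<in> {a<..<b} \<Longrightarrow> w \<in> space M \<Longrightarrow>
                ((\<lambda>y. F y w) has_real_derivative F' y w) (at y)"
    and bnd: "\<And>y w. y \<in> {a<..<b} \<Longrightarrow> w \<in> space M \<Longrightarrow> \<bar>F' y w\<bar> \<le> D w"
    and D: "integrable M D"
  shows integrable_derivative_under_integral: "integrable M (F' x)"
    and has_real_derivative_under_integral:
      "((\<lambda>y. integral\<^sup>L M (F y)) has_real_derivative integral\<^sup>L M (F' x)) (at x)"
proof -
  define e where "e = min (x - a) (b - x)"
  have e: "e > 0" using x by (auto simp: e_def)
  have ball: "x + h \<in> {a<..<b}" if "\<bar>h\<bar> < e" for h
    using that x by (auto simp: e_def)
  have quot: "\<bar>(F (x + h) w - F x w) / h\<bar> \<le> D w"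
    if h: "\<bar>h\<bar> < e" "h \<noteq> 0" and w: "w \<in> space M" for h w
  proof -
    have "norm (F (x + h) w - F x w) \<le> D w * norm (x + h - x)"
      by (rule field_differentiable_bound[of "{a<..<b}" _ "\<lambda>y. F' y w"])
         (use der bnd w ball h x in \<open>auto intro: has_field_derivative_at_within\<close>)
    then show ?thesis using h by (simp add: divide_le_eq)
  qed
  have lim: "(\<lambda>i. (F (x + X i) w - F x w) / X i) \<longlonglongrightarrow> F' x w"
    if "\<And>i. X i \<noteq> 0" "X \<longlonglongrightarrow> 0" "w \<in> space M" for X :: "nat \<Rightarrow> real" and w
  proof -
    have "(\<lambda>h. (F (x + h) w - F x w) / h) \<midarrow>0\<rightarrow> F' x w"
      using der[OF x that(3)] by (simp add: DERIV_def)
    with that(1,2) show ?thesis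
      unfolding tendsto_at_iff_sequentially by (auto simp: comp_def)
  qed
  define X0 :: "nat \<Rightarrow> real" where "X0 i = (e / 2) / real (Suc i)" for i
  have X0: "\<And>i. X0 i \<noteq> 0" "X0 \<longlonglongrightarrow> 0"
    using e LIMSEQ_Suc[OF lim_const_over_n[of "e/2"]] by (auto simp: X0_def[abs_def])
  have X0e: "\<bar>X0 i\<bar> < e" for i
  proof -
    have "0 \<le> X0 i" "X0 i \<le> e / 2"
      using e unfolding X0_def by (auto simp: divide_le_eq mult_le_cancel_left1)
    then show ?thesis using e by linarith
  qed
  have m: "F' x \<in> borel_measurable M"
  proof (rule borel_measurable_LIMSEQ_real[OF lim[OF X0]])
    fix i show "(\<lambda>w. (F (x + X0 i) w - F x w) / X0 i) \<in> borel_measurable M"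
      using int[OF ball[OF X0e[of i]]] int[OF x] by auto
  qed
  show "integrable M (F' x)"
  proof (rule Bochner_Integration.integrable_bound[OF D m], rule AE_I2)
    fix w assume "w \<in> space M"
    from bnd[OF x this] show "norm (F' x w) \<le> norm (D w)" by simp
  qed
  show "((\<lambda>y. integral\<^sup>L M (F y)) has_real_derivative integral\<^sup>L M (F' x)) (at x)"
    unfolding DERIV_def tendsto_at_iff_sequentially
  proof (intro allI impI)
    fix X :: "nat \<Rightarrow> real"
    assume X: "\<forall>i. X i \<in> UNIV - {0}" and X0: "X \<longlonglongrightarrow> 0"
    have "eventually (\<lambda>i. \<bar>X i\<bar> < e) sequentially"
      using tendstoD[OF X0 e] by (simp add: dist_real_def)
    then obtain N where N: "\<And>i. i \<ge> N \<Longrightarrow> \<bar>X i\<bar> < e" by (auto simp: eventually_sequentially)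
    define Y where "Y i = X (i + N)" for i
    have Y: "\<And>i. Y i \<noteq> 0" "Y \<longlonglongrightarrow> 0" "\<And>i. \<bar>Y i\<bar> < e"
      using X N LIMSEQ_ignore_initial_segment[OF X0, of N] by (auto simp: Y_def[abs_def])
    have L: "(\<lambda>i. integral\<^sup>L M (\<lambda>w. (F (x + Y i) w - F x w) / Y i)) \<longlonglongrightarrow> integral\<^sup>L M (F' x)"
    proof (rule integral_dominated_convergence[where w = D])
      show "F' x \<in> borel_measurable M" by (rule m)
      show "\<And>i. (\<lambda>w. (F (x + Y i) w - F x w) / Y i) \<in> borel_measurable M"
        using int[OF ball[OF Y(3)]] int[OF x] by auto
      show "integrable M D" by (rule D)
      show "AE w in M. (\<lambda>i. (F (x + Y i) w - F x w) / Y i) \<longlonglongrightarrow> F' x w"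
        using lim[OF Y(1,2)] by auto
      show "\<And>i. AE w in M. norm ((F (x + Y i) w - F x w) / Y i) \<le> D w"
        using quot[OF Y(3,1)] by auto
    qed
    have E: "integral\<^sup>L M (\<lambda>w. (F (x + Y i) w - F x w) / Y i)
        = (integral\<^sup>L M (F (x + Y i)) - integral\<^sup>L M (F x)) / Y i" for i
      using int[OF ball[OF Y(3)]] int[OF x] by simp
    have "(\<lambda>i. (integral\<^sup>L M (F (x + X (i + N))) - integral\<^sup>L M (F x)) / X (i + N))
        \<longlonglongrightarrow> integral\<^sup>L M (F' x)"
      using L[unfolded E] unfolding Y_def .
    from LIMSEQ_offset[OF this]
    show "((\<lambda>h. (integral\<^sup>L M (F (x + h)) - integral\<^sup>L M (F x)) / h) \<circ> X)
        \<longlonglongrightarrow> integral\<^sup>L M (F' x)"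
      by (simp add: comp_def)
  qed
qed

lemma has_real_derivative_under_set_integral:
  fixes F F' :: "real \<Rightarrow> 'a \<Rightarrow> real"
  assumes x: "x \<in> {a<..<b}"
    and int: "\<And>y. y \<in> {a<..<b} \<Longrightarrow> set_integrable M A (F y)"
    and der: "\<And>y w. y \<in> {a<..<b} \<Longrightarrow> w \<in> A \<Longrightarrow>
                ((\<lambda>y. F y w) has_real_derivative F' y w) (at y)"
    and bnd: "\<And>y w. y \<in> {a<..<b} \<Longrightarrow> w \<in> A \<Longrightarrow> \<bar>F' y w\<bar> \<le> D w"
    and D: "set_integrable M A D"
  shows "((\<lambda>y. LINT w:A|M. F y w) has_real_derivative (LINT w:A|M. F' x w)) (at x)"
  unfolding set_lebesgue_integral_def
proof (rule has_real_derivative_under_integral[OF x, where D = "\<lambda>w. indicator A w *\<^sub>R D w"])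
  show "integrable M (\<lambda>w. indicator A w *\<^sub>R F y w)" if "y \<in> {a<..<b}" for y
    using int[OF that] by (simp add: set_integrable_def)
  show "((\<lambda>y. indicator A w *\<^sub>R F y w) has_real_derivative indicator A w *\<^sub>R F' y w) (at y)"
    if "y \<in> {a<..<b}" for y w
    using der[OF that] by (auto simp: indicator_def)
  show "\<bar>indicator A w *\<^sub>R F' y w\<bar> \<le> indicator A w *\<^sub>R D w" if "y \<in> {a<..<b}" for y w
    using bnd[OF that] by (auto simp: indicator_def)
  show "integrable M (\<lambda>w. indicator A w *\<^sub>R D w)" using D by (simp add: set_integrable_def)
qed

text \<open>The growth condition lets the characteristic function be expanded into its moment series at every point; equal moments then give equal characteristic functions.\<close>

lemma moment_determinacy:
  assumes M: "real_distribution M" and N: "real_distribution N"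
    and int: "\<And>n. integrable M (\<lambda>x. x ^ n)" "\<And>n. integrable N (\<lambda>x. x ^ n)"
    and eq: "\<And>n. (LINT x|M. x ^ n) = (LINT x|N. x ^ n)"
    and M0: "AE x in M. 0 \<le> x" and N0: "AE x in N. 0 \<le> x"
    and sm: "\<And>s. 0 \<le> s \<Longrightarrow> summable (\<lambda>n. s ^ n / fact n * (LINT x|M. x ^ n))"
  shows "M = N"
proof -
  have *: "(\<lambda>n. (\<i> * complex_of_real s) ^ n / fact n * complex_of_real (LINT x|R. x ^ n)) sums char R s"
    if R: "real_distribution R" and iR: "\<And>n. integrable R (\<lambda>x. x ^ n)"
      and R0: "AE x in R. 0 \<le> x"
      and sR: "\<And>s. 0 \<le> s \<Longrightarrow> summable (\<lambda>n. s ^ n / fact n * (LINT x|R. x ^ n))" for R s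
  proof -
    interpret real_distribution R by fact
    define f where "f n x = (\<i> * complex_of_real s) ^ n / fact n * complex_of_real (x ^ n)" for n x
    have f: "integrable R (f n)" for n
      unfolding f_def by (intro integrable_mult_right integrable_of_real iR)
    have nf: "norm (f n x) = \<bar>s\<bar> ^ n / fact n * \<bar>x\<bar> ^ n" for n x
      by (simp add: f_def norm_mult norm_divide norm_power power_abs)
    have e: "(\<lambda>n. f n x) sums iexp (s * x)" for x
    proof -
      have "(\<lambda>n. (\<i> * complex_of_real (s * x)) ^ n /\<^sub>R fact n) sums exp (\<i> * complex_of_real (s * x))"
        by (rule exp_converges)
      then show ?thesis
        by (simp add: f_def scaleR_conv_of_real power_mult_distrib divide_inverse mult_ac)
    qed
    have "(\<lambda>n. integral\<^sup>L R (f n)) sums (LINT x|R. (\<Sum>n. f n x))"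
    proof (rule sums_integral[OF f])
      have "summable (\<lambda>n. norm (f n x))" for x
      proof -
        have "summable (\<lambda>n. (\<bar>s\<bar> * \<bar>x\<bar>) ^ n /\<^sub>R fact n)" by (rule summable_exp_generic)
        then show ?thesis by (simp add: nf power_mult_distrib field_simps)
      qed
      then show "AE x in R. summable (\<lambda>n. norm (f n x))" by simp
      have "(LINT x|R. norm (f n x)) = \<bar>s\<bar> ^ n / fact n * (LINT x|R. x ^ n)" for n
      proof -
        have "(LINT x|R. norm (f n x)) = (LINT x|R. \<bar>s\<bar> ^ n / fact n * x ^ n)"
        proof (rule integral_cong_AE)
          show "(\<lambda>x. norm (f n x)) \<in> borel_measurable R"
            by (rule measurable_compose[OF borel_measurable_integrable[OF f]]) simp
          show "(\<lambda>x. \<bar>s\<bar> ^ n / fact n * x ^ n) \<in> borel_measurable R"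
            by (rule borel_measurable_times[OF borel_measurable_const borel_measurable_integrable[OF iR]])
          show "AE x in R. norm (f n x) = \<bar>s\<bar> ^ n / fact n * x ^ n"
            by (rule eventually_mono[OF R0]) (simp add: nf)
        qed
        then show ?thesis by simp
      qed
      then show "summable (\<lambda>n. LINT x|R. norm (f n x))" using sR[of "\<bar>s\<bar>"] by simp
    qed
    moreover have "(LINT x|R. (\<Sum>n. f n x)) = char R s"
      unfolding char_def using sums_unique[OF e] by simp
    moreover have "integral\<^sup>L R (f n) = (\<i> * complex_of_real s) ^ n / fact n * complex_of_real (LINT x|R. x ^ n)" for n
      unfolding f_def by (simp only: integral_mult_right_zero integral_complex_of_real)
    ultimately show ?thesis by simp
  qed
  have "char M = char N"
  proof
    fix s
    have sN: "\<And>s. 0 \<le> s \<Longrightarrow> summable (\<lambda>n. s ^ n / fact n * (LINT x|N. x ^ n))"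
      using sm by (simp add: eq)
    show "char M s = char N s"
      using sums_unique2[OF *[OF M int(1) M0 sm, of s]] *[OF N int(2) N0 sN, of s] by (simp add: eq)
  qed
  then show ?thesis by (rule Levy_uniqueness[OF M N])
qed

text \<open>Under the map \<open>x \<mapsto> exp (- x)\<close> Laplace transforms at integers become moments of a law on the unit interval, and those grow slowly enough to determine it.\<close>

lemma laplace_determinacy:
  assumes M: "real_distribution M" and N: "real_distribution N"
    and M0: "AE x in M. 0 \<le> x" and N0: "AE x in N. 0 \<le> x"
    and eq: "\<And>k. 0 < k \<Longrightarrow> (LINT x|M. exp (- k * x)) = (LINT x|N. exp (- k * x))"
  shows "M = N"
proof -
  define E where "E R = distr R borel (\<lambda>x::real. exp (- x))" for R
  have E: "real_distribution (E R)" if "real_distribution R" for R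
  proof -
    interpret real_distribution R by fact
    show ?thesis unfolding E_def by (rule real_distribution_distr) simp
  qed
  have inv: "distr (E R) borel (\<lambda>y. - ln y) = R" if "real_distribution R" for R
  proof -
    interpret real_distribution R by fact
    have "distr (E R) borel (\<lambda>y. - ln y) = distr R borel ((\<lambda>y. - ln y) \<circ> (\<lambda>x. exp (- x)))"
      unfolding E_def by (rule distr_distr) auto
    also have "\<dots> = distr R R (\<lambda>x. x)" by (intro distr_cong) auto
    finally show ?thesis by simp
  qed
  have b: "AE y in E R. 0 \<le> y \<and> y \<le> 1" if "real_distribution R" "AE x in R. 0 \<le> x" for R
  proof -
    interpret real_distribution R by fact
    show ?thesis unfolding E_def using that(2) by (subst AE_distr_iff) auto
  qed
  have i: "integrable (E R) (\<lambda>y. y ^ n)" if "real_distribution R" "AE x in R. 0 \<le> x" for R n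
  proof -
    interpret real_distribution "E R" by (rule E) fact
    show ?thesis
      by (rule integrable_const_bound[of _ 1], rule eventually_mono[OF b[OF that]])
         (auto simp: power_le_one)
  qed
  have mom: "(LINT y|E R. y ^ n) = (LINT x|R. exp (- real n * x))" if "real_distribution R" for R n
  proof -
    interpret real_distribution R by fact
    show ?thesis unfolding E_def by (subst integral_distr) (auto simp: exp_of_nat_mult[symmetric])
  qed
  interpret EM: real_distribution "E M" by (rule E) fact
  have "E M = E N"
  proof (rule moment_determinacy[OF E[OF M] E[OF N] i[OF M M0] i[OF N N0]])
    fix n show "(LINT y|E M. y ^ n) = (LINT y|E N. y ^ n)"
    proof (cases "n = 0")
      case True
      interpret M: real_distribution M by fact
      interpret N: real_distribution N by fact
      have "measure M UNIV = 1" "measure N UNIV = 1"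
        using M.prob_space N.prob_space by (simp_all only: M.space_eq_univ N.space_eq_univ)
      then show ?thesis
        unfolding mom[OF M] mom[OF N] by (simp add: True)
    next
      case False then show ?thesis using eq[of "real n"] by (simp add: mom M N)
    qed
  next
    show "AE x in E M. 0 \<le> x" "AE x in E N. 0 \<le> x" using b[OF M M0] b[OF N N0] by auto
  next
    fix s :: real assume s: "0 \<le> s"
    have "\<bar>LINT y|E M. y ^ n\<bar> \<le> 1" for n
    proof -
      have "\<bar>LINT y|E M. y ^ n\<bar> \<le> (LINT y|E M. \<bar>y ^ n\<bar>)" by (rule integral_abs_bound)
      also have "\<dots> \<le> (LINT y|E M. 1)"
        by (rule integral_mono_AE, use i[OF M M0, of n] in simp, simp,
            rule eventually_mono[OF b[OF M M0]]) (auto simp: power_le_one)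
      also have "(LINT y|E M. 1) = (1::real)"
        unfolding lebesgue_integral_const EM.prob_space by simp
      finally show ?thesis .
    qed note le1 = this
    show "summable (\<lambda>n. s ^ n / fact n * (LINT y|E M. y ^ n))"
    proof (rule summable_comparison_test)
      show "summable (\<lambda>n. s ^ n / fact n)"
        using summable_exp[of s] by (simp add: field_simps)
      show "\<exists>N. \<forall>n\<ge>N. norm (s ^ n / fact n * (LINT y|E M. y ^ n)) \<le> s ^ n / fact n"
      proof (intro exI allI impI)
        fix n
        have "norm (s ^ n / fact n * (LINT y|E M. y ^ n)) = s ^ n / fact n * \<bar>LINT y|E M. y ^ n\<bar>"
          using s by (simp add: abs_mult)
        also have "\<dots> \<le> s ^ n / fact n * 1"
          using s le1[of n] by (intro mult_left_mono) auto
        finally show "norm (s ^ n / fact n * (LINT y|E M. y ^ n)) \<le> s ^ n / fact n" by simp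
      qed
    qed
  qed
  then show ?thesis by (metis inv[OF M] inv[OF N])
qed

section \<open>Evaluating a right-continuous process at an independent random time\<close>

text \<open>The grid point lies strictly to the right of \<open>s\<close> when \<open>s \<ge> 0\<close>, which is what right-continuity needs. It is nonnegative for every real \<open>s\<close>, so that it is always an index of the product space \<open>PiM {0..}\<close>.\<close>

definition next_grid_point :: "nat \<Rightarrow> real \<Rightarrow> real" where
  "next_grid_point n s = real (nat \<lfloor>real (Suc n) * s\<rfloor> + 1) / real (Suc n)"

text \<open>The value of a path at a time is not jointly measurable in both on \<open>PiM {0..}\<close>. This limit along countably many coordinates is, and it is the value of the path wherever the path is right-continuous.\<close>

definition path_limit :: "(real \<Rightarrow> real) \<Rightarrow> real \<Rightarrow> real" where
  "path_limit y s = lim (\<lambda>n. y (next_grid_point n s))"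

lemma next_grid_point_pos: "0 \<le> next_grid_point n s"
  by (simp add: next_grid_point_def)

lemma next_grid_point_bounds:
  assumes "0 \<le> s"
  shows "s < next_grid_point n s" "next_grid_point n s \<le> s + 1 / real (Suc n)"
proof -
  have f: "real (nat \<lfloor>real (Suc n) * s\<rfloor>) = of_int \<lfloor>real (Suc n) * s\<rfloor>"
    using assms by simp
  have "real (Suc n) * s < real (nat \<lfloor>real (Suc n) * s\<rfloor> + 1)"
    unfolding of_nat_add f by linarith
  then show "s < next_grid_point n s"
    unfolding next_grid_point_def by (simp add: less_divide_eq mult.commute del: of_nat_Suc)
  have "real (nat \<lfloor>real (Suc n) * s\<rfloor> + 1) \<le> real (Suc n) * s + 1"
    unfolding of_nat_add f by linarith
  then have "next_grid_point n s \<le> (real (Suc n) * s + 1) / real (Suc n)"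
    unfolding next_grid_point_def by (intro divide_right_mono) auto
  also have "\<dots> = s + 1 / real (Suc n)"
    by (simp add: add_divide_distrib del: of_nat_Suc)
  finally show "next_grid_point n s \<le> s + 1 / real (Suc n)" .
qed

lemma path_limit_right_continuous:
  assumes s: "0 \<le> s" and c: "continuous (at_right s) y"
    and eq: "\<And>r. 0 \<le> r \<Longrightarrow> y' r = y r"
  shows "path_limit y' s = y s"
proof -
  have lim: "(\<lambda>n. s + 1 / real (Suc n)) \<longlonglongrightarrow> s + 0"
    by (intro tendsto_intros LIMSEQ_Suc[OF lim_const_over_n])
  have l: "(\<lambda>n. next_grid_point n s) \<longlonglongrightarrow> s"
  proof (rule tendsto_sandwich)
    show "eventually (\<lambda>n. s \<le> next_grid_point n s) sequentially"
      using next_grid_point_bounds(1)[OF s] by (intro always_eventually allI less_imp_le)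
    show "eventually (\<lambda>n. next_grid_point n s \<le> s + 1 / real (Suc n)) sequentially"
      using next_grid_point_bounds(2)[OF s] by (intro always_eventually allI)
    show "(\<lambda>n. s + 1 / real (Suc n)) \<longlonglongrightarrow> s"
      using lim by simp
  qed (rule tendsto_const)
  have "filterlim (\<lambda>n. next_grid_point n s) (at_right s) sequentially"
    unfolding filterlim_at using l next_grid_point_bounds(1)[OF s] by (auto simp: less_imp_neq[symmetric])
  then have "(\<lambda>n. y (next_grid_point n s)) \<longlonglongrightarrow> y s"
    using c unfolding continuous_within by (rule filterlim_compose[rotated])
  then show ?thesis
    unfolding path_limit_def by (simp add: eq next_grid_point_pos limI)
qed

lemma measurable_path_limit [measurable]:
  "(\<lambda>p. path_limit (fst p) (snd p)) \<in> borel_measurable (PiM {0..} (\<lambda>_. borel) \<Otimes>\<^sub>M borel)"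
  unfolding path_limit_def
proof (rule borel_measurable_lim_metric)
  fix n
  have "(\<lambda>p. fst p (real (k + 1) / real (Suc n)))
      \<in> borel_measurable (PiM {0..} (\<lambda>_. borel) \<Otimes>\<^sub>M borel)" for k
    by (rule measurable_compose[OF measurable_fst]) (rule measurable_component_singleton, simp)
  from measurable_compose_countable[OF this, where g = "\<lambda>p. nat \<lfloor>real (Suc n) * snd p\<rfloor>"]
  show "(\<lambda>p. fst p (next_grid_point n (snd p)))
      \<in> borel_measurable (PiM {0..} (\<lambda>_. borel) \<Otimes>\<^sub>M borel)"
    unfolding next_grid_point_def by measurable
qed

text \<open>Independence is a product law for the path and the clock. Evaluation of the path at the clock is a measurable function on the product by the previous lemma, so the claim is Tonelli's theorem. The independent random elements \<open>Q\<close> and \<open>R\<close> take values in one and the same type, which is why \<open>\<pi>\<close> and \<open>\<tau>\<close> extract the path and the time from them.\<close>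

lemma
  fixes Y :: "real \<Rightarrow> 'w \<Rightarrow> real" and h :: "real \<Rightarrow> ennreal"
  assumes "prob_space M"
    and ind: "prob_space.indep_var M P Q S R"
    and pth: "\<pi> \<in> P \<rightarrow>\<^sub>M PiM {0..} (\<lambda>_. borel)"
    and val: "\<And>w s. w \<in> space M \<Longrightarrow> 0 \<le> s \<Longrightarrow> \<pi> (Q w) s = Y s w"
    and tau: "\<tau> \<in> borel_measurable S" and tau0: "\<And>w. w \<in> space M \<Longrightarrow> 0 \<le> \<tau> (R w)"
    and rc: "\<And>w t. w \<in> space M \<Longrightarrow> 0 \<le> t \<Longrightarrow> continuous (at_right t) (\<lambda>s. Y s w)"
  shows measurable_subordinate: "(\<lambda>w. Y (\<tau> (R w)) w) \<in> borel_measurable M"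
    and nn_integral_subordinate: "h \<in> borel_measurable borel \<Longrightarrow>
      (\<integral>\<^sup>+w. h (Y (\<tau> (R w)) w) \<partial>M) = (\<integral>\<^sup>+w. (\<integral>\<^sup>+w'. h (Y (\<tau> (R w)) w') \<partial>M) \<partial>M)"
proof -
  interpret prob_space M by fact
  have Q[measurable]: "Q \<in> M \<rightarrow>\<^sub>M P" and R[measurable]: "R \<in> M \<rightarrow>\<^sub>M S"
    and joint: "distr M P Q \<Otimes>\<^sub>M distr M S R = distr M (P \<Otimes>\<^sub>M S) (\<lambda>w. (Q w, R w))"
    using ind unfolding indep_var_distribution_eq by auto
  note pth[measurable]
  note tau[measurable]
  have ev: "path_limit (\<pi> (Q w')) (\<tau> (R w)) = Y (\<tau> (R w)) w'" if "w \<in> space M" "w' \<in> space M" for w w'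
    by (rule path_limit_right_continuous) (use that tau0 rc val in auto)
  have m: "(\<lambda>p. path_limit (\<pi> (fst p)) (\<tau> (snd p))) \<in> borel_measurable (P \<Otimes>\<^sub>M S)"
    by (rule measurable_compose[OF _ measurable_path_limit, of "\<lambda>p. (\<pi> (fst p), \<tau> (snd p))", simplified]) measurable
  have "(\<lambda>w. path_limit (\<pi> (Q w)) (\<tau> (R w))) \<in> borel_measurable M"
    by (rule measurable_compose[OF _ m, of "\<lambda>w. (Q w, R w)", simplified]) measurable
  then show "(\<lambda>w. Y (\<tau> (R w)) w) \<in> borel_measurable M"
    by (rule measurable_cong[THEN iffD1, rotated]) (simp add: ev)
  assume h[measurable]: "h \<in> borel_measurable borel"
  have hm[measurable]: "(\<lambda>p. h (path_limit (\<pi> (fst p)) (\<tau> (snd p)))) \<in> borel_measurable (P \<Otimes>\<^sub>M S)"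
    using m by measurable
  have hm'[measurable]: "(\<lambda>x. h (path_limit (\<pi> x) (\<tau> v))) \<in> borel_measurable P" if "v \<in> space S" for v
    using measurable_compose[OF measurable_Pair2'[OF that] hm] by simp
  interpret Q: prob_space "distr M P Q" by (rule prob_space_distr) measurable
  interpret R: prob_space "distr M S R" by (rule prob_space_distr) measurable
  interpret QR: pair_prob_space "distr M P Q" "distr M S R" ..
  have "(\<integral>\<^sup>+w. h (Y (\<tau> (R w)) w) \<partial>M) = (\<integral>\<^sup>+w. h (path_limit (\<pi> (Q w)) (\<tau> (R w))) \<partial>M)"
    by (rule nn_integral_cong) (simp add: ev)
  also have "\<dots> = (\<integral>\<^sup>+p. h (path_limit (\<pi> (fst p)) (\<tau> (snd p))) \<partial>distr M (P \<Otimes>\<^sub>M S) (\<lambda>w. (Q w, R w)))"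
    by (subst nn_integral_distr) (simp_all del: fst_conv snd_conv, simp)
  also have "\<dots> = (\<integral>\<^sup>+v. (\<integral>\<^sup>+x. h (path_limit (\<pi> x) (\<tau> v)) \<partial>distr M P Q) \<partial>distr M S R)"
  proof -
    have "(\<lambda>(x, v). h (path_limit (\<pi> x) (\<tau> v))) \<in> borel_measurable (distr M P Q \<Otimes>\<^sub>M distr M S R)"
      using hm measurable_cong_sets[OF sets_pair_measure_cong[OF sets_distr sets_distr] refl, of M P Q M S R borel]
      by (simp add: split_beta')
    from QR.nn_integral_snd[OF this] show ?thesis
      unfolding joint[symmetric] by (simp add: split_beta')
  qed
  also have "\<dots> = (\<integral>\<^sup>+w. (\<integral>\<^sup>+x. h (path_limit (\<pi> x) (\<tau> (R w))) \<partial>distr M P Q) \<partial>M)"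
  proof (rule nn_integral_distr)
    have "(\<lambda>p. h (path_limit (\<pi> (snd p)) (\<tau> (fst p)))) \<in> borel_measurable (S \<Otimes>\<^sub>M P)"
      by (rule measurable_compose[OF _ hm, of "\<lambda>p. (snd p, fst p)", simplified]) measurable
    then have "(\<lambda>(v, x). h (path_limit (\<pi> x) (\<tau> v))) \<in> borel_measurable (S \<Otimes>\<^sub>M distr M P Q)"
      using measurable_cong_sets[OF sets_pair_measure_cong[OF refl sets_distr] refl, of S M P Q borel]
      by (simp add: split_beta')
    from Q.borel_measurable_nn_integral[OF this]
    show "(\<lambda>v. \<integral>\<^sup>+x. h (path_limit (\<pi> x) (\<tau> v)) \<partial>distr M P Q) \<in> borel_measurable (distr M S R)"
      by simp
  qed measurable
  also have "\<dots> = (\<integral>\<^sup>+w. (\<integral>\<^sup>+w'. h (Y (\<tau> (R w)) w') \<partial>M) \<partial>M)"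
    by (intro nn_integral_cong, subst nn_integral_distr)
       (auto simp: ev measurable_space[OF R] intro!: nn_integral_cong hm')
  finally show "(\<integral>\<^sup>+w. h (Y (\<tau> (R w)) w) \<partial>M) = (\<integral>\<^sup>+w. (\<integral>\<^sup>+w'. h (Y (\<tau> (R w)) w') \<partial>M) \<partial>M)" .
qed

section \<open>The Gaussian kernel away from the origin\<close>

lemma powr_mult_exp_minus_le:
  fixes y c :: real
  assumes "0 < c" "0 < y"
  shows "y powr c * exp (- y) \<le> c powr c"
proof -
  have "ln (y / c) \<le> y / c - 1" using assms by (intro ln_le_minus_one) auto
  then have "c * ln (y / c) \<le> c * (y / c - 1)" using assms by (intro mult_left_mono) auto
  then have "c * ln y - y \<le> c * ln c" using assms by (simp add: ln_div algebra_simps)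
  then have "exp (c * ln y - y) \<le> exp (c * ln c)" by simp
  then show ?thesis using assms by (simp add: powr_def exp_diff exp_minus divide_inverse)
qed

text \<open>With \<open>y = x^2 / (2 z)\<close> the exponential factor is \<open>exp (- y)\<close>, which beats every power of \<open>1 / z\<close>; the constant is the maximum of \<open>y^c exp (- y)\<close>.\<close>

lemma brownian_density_div_power_le:
  assumes z: "0 < z" and x: "x \<noteq> 0"
  shows "brownian_density x z / z ^ j \<le> ((2 * real j + 1) / x\<^sup>2) powr (real j + 1 / 2)"
proof -
  define c where "c = real j + 1 / 2"
  define y where "y = x\<^sup>2 / (2 * z)"
  have c: "0 < c" and y: "0 < y" using z x by (auto simp: c_def y_def)
  have "z powr (- c) = (2 * y / x\<^sup>2) powr c"
  proof -
    have "2 * y / x\<^sup>2 = 1 / z" using z x by (simp add: y_def)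
    then show ?thesis using z by (simp add: powr_minus_divide powr_divide)
  qed
  also have "\<dots> = (2 / x\<^sup>2) powr c * y powr c"
    using y x by (simp add: powr_mult[symmetric])
  finally have zc: "z powr (- c) = (2 / x\<^sup>2) powr c * y powr c" .
  have "z powr (- (1 / 2)) / z ^ j = z powr (- (1 / 2)) / z powr real j"
    using z by (simp add: powr_realpow)
  also have "\<dots> = z powr (- (1 / 2) - real j)" by (simp only: powr_diff)
  also have "- (1 / 2) - real j = - c" by (simp add: c_def)
  finally have zj: "z powr (- (1 / 2)) / z ^ j = z powr (- c)" .
  have "brownian_density x z / z ^ j = (2 * pi) powr (- (1 / 2)) * (z powr (- c) * exp (- y))"
    using z by (simp add: brownian_density_def y_def powr_mult zj[symmetric])
  also have "\<dots> \<le> 1 * (z powr (- c) * exp (- y))"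
  proof (rule mult_right_mono)
    have "1 \<le> (2 * pi) powr (1 / 2)"
      using pi_gt3 by (intro ge_one_powr_ge_zero) auto
    then show "(2 * pi) powr (- (1 / 2)) \<le> 1"
      by (simp add: powr_minus inverse_le_1_iff)
  qed simp
  also have "z powr (- c) * exp (- y) = (2 / x\<^sup>2) powr c * (y powr c * exp (- y))"
    by (simp add: zc)
  also have "\<dots> \<le> (2 / x\<^sup>2) powr c * c powr c"
    by (intro mult_left_mono powr_mult_exp_minus_le c y) simp
  also have "\<dots> = (2 * c / x\<^sup>2) powr c"
    using c x by (simp add: powr_mult[symmetric])
  finally show ?thesis by (simp add: c_def algebra_simps)
qed

lemma brownian_density_nonneg [simp]: "0 \<le> brownian_density x z"
  by (simp add: brownian_density_def)

lemma brownian_density_le: "0 < z \<Longrightarrow> x \<noteq> 0 \<Longrightarrow> brownian_density x z \<le> 1 / \<bar>x\<bar>"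
  using brownian_density_div_power_le[of z x 0]
  by (simp add: powr_divide powr_half_sqrt)

lemma brownian_density_antimono:
  assumes "0 < z" "\<bar>d\<bar> \<le> \<bar>y\<bar>"
  shows "brownian_density y z \<le> brownian_density d z"
proof -
  have "d\<^sup>2 \<le> y\<^sup>2" using assms(2) by (simp add: abs_le_square_iff)
  then show ?thesis
    using assms(1) unfolding brownian_density_def
    by (intro mult_left_mono) (auto simp: divide_right_mono)
qed

lemma brownian_density_measurable [measurable]:
  "(\<lambda>p. brownian_density (fst p) (snd p)) \<in> borel_measurable borel"
  "brownian_density x \<in> borel_measurable borel"
  by (simp_all add: brownian_density_def[abs_def] borel_prod[symmetric])

definition brownian_density_x :: "real \<Rightarrow> real \<Rightarrow> real" where
  "brownian_density_x x z = - (x / z) * brownian_density x z"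

definition brownian_density_xx :: "real \<Rightarrow> real \<Rightarrow> real" where
  "brownian_density_xx x z = (x\<^sup>2 / z\<^sup>2 - 1 / z) * brownian_density x z"

lemma brownian_density_x_measurable [measurable]: "brownian_density_x x \<in> borel_measurable borel"
  by (simp add: brownian_density_x_def[abs_def])

lemma brownian_density_xx_measurable [measurable]: "brownian_density_xx x \<in> borel_measurable borel"
  by (simp add: brownian_density_xx_def[abs_def])

lemma has_derivative_brownian_density:
  assumes "0 < z"
  shows "((\<lambda>y. brownian_density y z) has_real_derivative brownian_density_x x z) (at x)"
    and "((\<lambda>y. brownian_density_x y z) has_real_derivative brownian_density_xx x z) (at x)"
proof -
  show 1: "((\<lambda>y. brownian_density y z) has_real_derivative brownian_density_x x z) (at x)" for x
    unfolding brownian_density_def brownian_density_x_def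
    using assms by (auto intro!: derivative_eq_intros simp: field_simps)
  have 2: "((\<lambda>y. - (y / z)) has_real_derivative - (1 / z)) (at x)"
    using assms by (auto intro!: derivative_eq_intros)
  show "((\<lambda>y. brownian_density_x y z) has_real_derivative brownian_density_xx x z) (at x)"
    unfolding brownian_density_x_def
    by (rule DERIV_cong[OF DERIV_mult[OF 2 1]])
       (use assms in \<open>simp add: brownian_density_x_def brownian_density_xx_def field_simps power2_eq_square\<close>)
qed

lemma heat_equation:
  assumes "0 < z"
  shows "((\<lambda>z. brownian_density x z) has_real_derivative brownian_density_xx x z / 2) (at z)"
proof -
  have e: "brownian_density x z = (2 * pi) powr (- (1 / 2)) * (z powr (- (1/2)) * exp (- (x\<^sup>2) / (2 * z)))"
    if "0 < z" for z
    using that by (simp add: brownian_density_def powr_mult)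
  have zz: "z powr (- (1/2)) = z * z powr (- (3/2))"
    using powr_mult_base[of z "- (3/2)"] assms by simp
  have "((\<lambda>z. (2 * pi) powr (- (1 / 2)) * (z powr (- (1/2)) * exp (- (x\<^sup>2) / (2 * z))))
      has_real_derivative brownian_density_xx x z / 2) (at z)"
    using assms unfolding brownian_density_xx_def e[OF assms]
    by (auto intro!: derivative_eq_intros simp: zz field_simps power2_eq_square)
  then show ?thesis
    by (rule has_field_derivative_transform_within_open[of _ _ _ "{0<..}"])
       (use assms e in auto)
qed

lemma brownian_density_x_le:
  assumes "0 < z" "d \<noteq> 0" "\<bar>d\<bar> \<le> \<bar>y\<bar>"
  shows "\<bar>brownian_density_x y z\<bar> \<le> \<bar>y\<bar> * (3 / d\<^sup>2) powr (3 / 2)"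
proof -
  have "\<bar>brownian_density_x y z\<bar> = \<bar>y\<bar> * (brownian_density y z / z ^ 1)"
    using assms by (simp add: brownian_density_x_def abs_mult)
  also have "\<dots> \<le> \<bar>y\<bar> * (brownian_density d z / z ^ 1)"
    using assms by (intro mult_left_mono divide_right_mono brownian_density_antimono) auto
  also have "\<dots> \<le> \<bar>y\<bar> * (3 / d\<^sup>2) powr (3 / 2)"
    using brownian_density_div_power_le[OF assms(1,2), of 1]
    by (intro mult_left_mono) auto
  finally show ?thesis .
qed

lemma brownian_density_xx_le:
  assumes "0 < z" "d \<noteq> 0" "\<bar>d\<bar> \<le> \<bar>y\<bar>"
  shows "\<bar>brownian_density_xx y z\<bar> \<le> y\<^sup>2 * (5 / d\<^sup>2) powr (5 / 2) + (3 / d\<^sup>2) powr (3 / 2)"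
proof -
  have "\<bar>brownian_density_xx y z\<bar> \<le> (y\<^sup>2 / z\<^sup>2 + 1 / z) * brownian_density y z"
    using assms unfolding brownian_density_xx_def abs_mult
    by (intro mult_mono) (auto simp: abs_le_iff intro: order_trans[of _ 0])
  also have "\<dots> = y\<^sup>2 * (brownian_density y z / z ^ 2) + brownian_density y z / z ^ 1"
    by (simp add: algebra_simps)
  also have "\<dots> \<le> y\<^sup>2 * (brownian_density d z / z ^ 2) + brownian_density d z / z ^ 1"
    using assms by (intro add_mono mult_left_mono divide_right_mono brownian_density_antimono) auto
  also have "\<dots> \<le> y\<^sup>2 * (5 / d\<^sup>2) powr (5 / 2) + (3 / d\<^sup>2) powr (3 / 2)"
    using brownian_density_div_power_le[OF assms(1,2), of 1]
      brownian_density_div_power_le[OF assms(1,2), of 2]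
    by (intro mult_left_mono add_mono) auto
  finally show ?thesis .
qed

lemma set_integrable_bounded_mult:
  fixes f g :: "'a \<Rightarrow> real"
  assumes f: "set_integrable M A f" and g: "g \<in> borel_measurable M"
    and b: "\<And>z. z \<in> A \<Longrightarrow> \<bar>g z\<bar> \<le> C"
  shows "set_integrable M A (\<lambda>z. g z * f z)"
proof -
  have i: "integrable M (\<lambda>z. C * (indicator A z *\<^sub>R f z))"
    using f unfolding set_integrable_def by simp
  have fm: "(\<lambda>z. indicator A z *\<^sub>R f z) \<in> borel_measurable M"
    using f unfolding set_integrable_def by (rule borel_measurable_integrable)
  show ?thesis unfolding set_integrable_def
  proof (rule Bochner_Integration.integrable_bound[OF i])
    have "(\<lambda>z. g z * (indicator A z *\<^sub>R f z)) \<in> borel_measurable M" using fm g by measurable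
    then show "(\<lambda>z. indicator A z *\<^sub>R (g z * f z)) \<in> borel_measurable M"
      by (simp add: mult_ac)
    show "AE z in M. norm (indicator A z *\<^sub>R (g z * f z)) \<le> norm (C * (indicator A z *\<^sub>R f z))"
    proof (rule AE_I2)
      fix z
      show "norm (indicator A z *\<^sub>R (g z * f z)) \<le> norm (C * (indicator A z *\<^sub>R f z))"
        using b[of z] by (auto simp: indicator_def abs_mult intro!: mult_right_mono)
    qed
  qed
qed

text \<open>For \<open>\<bar>y\<bar> \<ge> \<bar>x\<bar> / 2\<close> the Gaussian kernel and its first two derivatives in \<open>y\<close> are bounded uniformly in \<open>z\<close>, so multiples of \<open>f\<close> dominate the integrands.\<close>

lemma subordinated_derivatives:
  fixes f :: "real \<Rightarrow> real"
  assumes f: "set_integrable lborel {0<..} f" and x: "x \<noteq> 0"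
  shows "((\<lambda>y. LINT z:{0<..}|lborel. brownian_density y z * f z) has_real_derivative
           (LINT z:{0<..}|lborel. brownian_density_x x z * f z)) (at x)"
    and "((\<lambda>y. LINT z:{0<..}|lborel. brownian_density_x y z * f z) has_real_derivative
           (LINT z:{0<..}|lborel. brownian_density_xx x z * f z)) (at x)"
proof -
  define d where "d = \<bar>x\<bar> / 2"
  have d: "d \<noteq> 0" "0 < d" and xi: "x \<in> {x - d<..<x + d}" using x by (auto simp: d_def)
  have y: "\<bar>d\<bar> \<le> \<bar>y\<bar>" "\<bar>y\<bar> \<le> 2 * \<bar>x\<bar>" if "y \<in> {x - d<..<x + d}" for y
    using that by (auto simp: d_def)
  have y2: "y\<^sup>2 \<le> 4 * x\<^sup>2" if "y \<in> {x - d<..<x + d}" for y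
    using power_mono[OF y(2)[OF that], of 2] by (simp add: power_mult_distrib)
  have i0: "set_integrable lborel {0<..} (\<lambda>z. brownian_density y z * f z)" if "y \<in> {x - d<..<x + d}" for y
    using y[OF that] d by (intro set_integrable_bounded_mult[OF f, of _ "1 / \<bar>y\<bar>"]) 
       (auto intro!: brownian_density_le)
  have i1: "set_integrable lborel {0<..} (\<lambda>z. brownian_density_x y z * f z)" if "y \<in> {x - d<..<x + d}" for y
    by (rule set_integrable_bounded_mult[OF f, of _ "\<bar>y\<bar> * (3 / d\<^sup>2) powr (3 / 2)"])
       (use brownian_density_x_le[OF _ d(1) y(1)[OF that]] in simp_all)
  let ?C1 = "2 * \<bar>x\<bar> * (3 / d\<^sup>2) powr (3 / 2)"
  let ?C2 = "4 * x\<^sup>2 * (5 / d\<^sup>2) powr (5 / 2) + (3 / d\<^sup>2) powr (3 / 2)"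
  have f': "set_integrable lborel {0<..} (\<lambda>z. C * \<bar>f z\<bar>)" for C
    using set_integrable_abs[OF f] by simp
  show "((\<lambda>y. LINT z:{0<..}|lborel. brownian_density y z * f z) has_real_derivative
           (LINT z:{0<..}|lborel. brownian_density_x x z * f z)) (at x)"
  proof (rule has_real_derivative_under_set_integral[OF xi, where D = "\<lambda>z. ?C1 * \<bar>f z\<bar>"])
    fix y z :: real assume yz: "y \<in> {x - d<..<x + d}" "z \<in> {0<..}"
    then show "((\<lambda>y. brownian_density y z * f z) has_real_derivative brownian_density_x y z * f z) (at y)"
      by (intro DERIV_cmult_right has_derivative_brownian_density) auto
    have "\<bar>brownian_density_x y z\<bar> \<le> \<bar>y\<bar> * (3 / d\<^sup>2) powr (3 / 2)"
      using yz y[OF yz(1)] d by (intro brownian_density_x_le) auto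
    also have "\<dots> \<le> ?C1" using y[OF yz(1)] by (intro mult_right_mono) auto
    finally show "\<bar>brownian_density_x y z * f z\<bar> \<le> ?C1 * \<bar>f z\<bar>"
      unfolding abs_mult by (rule mult_right_mono) simp
  qed (use i0 f' in auto)
  show "((\<lambda>y. LINT z:{0<..}|lborel. brownian_density_x y z * f z) has_real_derivative
           (LINT z:{0<..}|lborel. brownian_density_xx x z * f z)) (at x)"
  proof (rule has_real_derivative_under_set_integral[OF xi, where D = "\<lambda>z. ?C2 * \<bar>f z\<bar>"])
    fix y z :: real assume yz: "y \<in> {x - d<..<x + d}" "z \<in> {0<..}"
    then show "((\<lambda>y. brownian_density_x y z * f z) has_real_derivative brownian_density_xx y z * f z) (at y)"
      by (intro DERIV_cmult_right has_derivative_brownian_density) auto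
    have "\<bar>brownian_density_xx y z\<bar> \<le> y\<^sup>2 * (5 / d\<^sup>2) powr (5 / 2) + (3 / d\<^sup>2) powr (3 / 2)"
      using yz y[OF yz(1)] d by (intro brownian_density_xx_le) auto
    also have "\<dots> \<le> ?C2" using y2[OF yz(1)] by (intro add_right_mono mult_right_mono) auto
    finally show "\<bar>brownian_density_xx y z * f z\<bar> \<le> ?C2 * \<bar>f z\<bar>"
      unfolding abs_mult by (rule mult_right_mono) simp
  qed (use i1 f' in auto)
qed

lemma twice_differentiable_subordinated:
  fixes f :: "real \<Rightarrow> real"
  assumes f: "set_integrable lborel {0<..} f" and x: "x \<noteq> 0"
  defines "u \<equiv> \<lambda>y. LINT z:{0<..}|lborel. brownian_density y z * f z"
  shows "twice_differentiable_at u x"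
    and "deriv (deriv u) x = (LINT z:{0<..}|lborel. brownian_density_xx x z * f z)"
proof -
  let ?v = "\<lambda>y. LINT z:{0<..}|lborel. brownian_density_x y z * f z"
  have e: "\<forall>\<^sub>F y in nhds x. y \<noteq> 0" using x by (rule t1_space_nhds)
  have du: "(u has_real_derivative ?v y) (at y)" if "y \<noteq> 0" for y
    unfolding u_def by (rule subordinated_derivatives[OF f that])
  have eq: "\<forall>\<^sub>F y in nhds x. deriv u y = ?v y"
    using e by eventually_elim (rule DERIV_imp_deriv[OF du])
  have dv: "(?v has_real_derivative (LINT z:{0<..}|lborel. brownian_density_xx x z * f z)) (at x)"
    by (rule subordinated_derivatives[OF f x])
  then have dd: "(deriv u has_real_derivative (LINT z:{0<..}|lborel. brownian_density_xx x z * f z)) (at x)"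
    using DERIV_cong_ev[OF refl eq refl] by blast
  have "\<forall>\<^sub>F y in nhds x. u differentiable (at y)"
    using e by eventually_elim (auto simp: real_differentiable_def intro: du)
  then show "twice_differentiable_at u x"
    unfolding twice_differentiable_at_def
    using dd by (auto simp: real_differentiable_def)
  show "deriv (deriv u) x = (LINT z:{0<..}|lborel. brownian_density_xx x z * f z)"
    by (rule DERIV_imp_deriv[OF dd])
qed

text \<open>The kernel is at most \<open>1 / \<bar>x\<bar>\<close> and its derivative at most a constant times \<open>1 / x^2\<close>, uniformly in \<open>z\<close>.\<close>

lemma vanishes_at_infinity_subordinated:
  fixes f :: "real \<Rightarrow> real"
  assumes f: "set_integrable lborel {0<..} f" and f0: "\<And>z. 0 \<le> f z"
  defines "u \<equiv> \<lambda>y. LINT z:{0<..}|lborel. brownian_density y z * f z"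
  shows "vanishes_at_infinity u"
proof -
  define I where "I = (LINT z:{0<..}|lborel. f z)"
  have e: "\<forall>\<^sub>F x in at_infinity. (x::real) \<noteq> 0"
    using eventually_at_infinity[of "\<lambda>x::real. x \<noteq> 0"] by (auto intro!: exI[of _ 1])
  have ub: "\<bar>u x\<bar> \<le> I * (1 / \<bar>x\<bar>)" if "x \<noteq> 0" for x
  proof -
    have "u x \<le> (LINT z:{0<..}|lborel. 1 / \<bar>x\<bar> * f z)" unfolding u_def
    proof (rule set_integral_mono)
      show "set_integrable lborel {0<..} (\<lambda>z. brownian_density x z * f z)"
        using that by (intro set_integrable_bounded_mult[OF f, of _ "1 / \<bar>x\<bar>"])
          (auto intro!: brownian_density_le)
      show "set_integrable lborel {0<..} (\<lambda>z. 1 / \<bar>x\<bar> * f z)" using f by simp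
      show "brownian_density x z * f z \<le> 1 / \<bar>x\<bar> * f z" if "z \<in> {0<..}" for z
        using that \<open>x \<noteq> 0\<close> f0 by (intro mult_right_mono brownian_density_le) auto
    qed
    moreover have "0 \<le> u x" unfolding u_def set_lebesgue_integral_def
      using f0 by (intro integral_nonneg_AE) auto
    ultimately show ?thesis by (simp add: I_def)
  qed
  have vb: "\<bar>deriv u x\<bar> \<le> I * (sqrt 27 * (1 / \<bar>x\<bar>) ^ 2)" if "x \<noteq> 0" for x
  proof -
    have c: "\<bar>x\<bar> * (3 / x\<^sup>2) powr (3 / 2) = sqrt 27 * (1 / \<bar>x\<bar>) ^ 2"
    proof -
      have "(3 / x\<^sup>2) powr (3 / 2) = ((3 / x\<^sup>2) powr 3) powr (1 / 2)"
        by (simp only: powr_powr) simp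
      also have "(3 / x\<^sup>2) powr 3 = (3 / x\<^sup>2) ^ 3"
        using that powr_realpow[of "3 / x\<^sup>2" 3] by simp
      also have "((3 / x\<^sup>2) ^ 3) powr (1 / 2) = sqrt ((3 / x\<^sup>2) ^ 3)"
        by (rule powr_half_sqrt) simp
      also have "(3 / x\<^sup>2) ^ 3 = 27 / (\<bar>x\<bar> ^ 3) ^ 2"
        by (simp add: power_divide power_mult[symmetric] power_even_abs)
      also have "sqrt (27 / (\<bar>x\<bar> ^ 3) ^ 2) = sqrt 27 / \<bar>x\<bar> ^ 3"
        by (simp only: real_sqrt_divide real_sqrt_abs) simp
      finally show ?thesis using that by (simp add: field_simps power2_eq_square power3_eq_cube)
    qed
    have i: "set_integrable lborel {0<..} (\<lambda>z. brownian_density_x x z * f z)"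
      by (rule set_integrable_bounded_mult[OF f, of _ "\<bar>x\<bar> * (3 / x\<^sup>2) powr (3 / 2)"])
         (use brownian_density_x_le[OF _ that, of _ x] in simp_all)
    have "deriv u x = (LINT z:{0<..}|lborel. brownian_density_x x z * f z)"
      unfolding u_def by (rule DERIV_imp_deriv[OF subordinated_derivatives(1)[OF f that]])
    also have "\<bar>\<dots>\<bar> \<le> (LINT z:{0<..}|lborel. \<bar>brownian_density_x x z * f z\<bar>)"
      using integral_abs_bound[of lborel "\<lambda>z. indicator {0<..} z *\<^sub>R (brownian_density_x x z * f z)"]
      by (simp add: set_lebesgue_integral_def abs_mult)
    also have "\<dots> \<le> (LINT z:{0<..}|lborel. (\<bar>x\<bar> * (3 / x\<^sup>2) powr (3 / 2)) * f z)"
    proof (rule set_integral_mono)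
      fix z :: real assume "z \<in> {0<..}"
      then have "\<bar>brownian_density_x x z\<bar> \<le> \<bar>x\<bar> * (3 / x\<^sup>2) powr (3 / 2)"
        using that by (intro brownian_density_x_le) auto
      then show "\<bar>brownian_density_x x z * f z\<bar> \<le> (\<bar>x\<bar> * (3 / x\<^sup>2) powr (3 / 2)) * f z"
        using f0[of z] unfolding abs_mult by (simp add: mult_right_mono)
    qed (use f set_integrable_abs[OF i] in auto)
    finally show ?thesis unfolding c by (simp add: I_def mult_ac)
  qed
  have inv: "((\<lambda>x::real. 1 / \<bar>x\<bar>) \<longlongrightarrow> 0) at_infinity"
    using tendsto_norm_zero[OF tendsto_inverse_0[where 'a = real]] by (simp add: divide_inverse)
  have "((\<lambda>x. I * (1 / \<bar>x\<bar>)) \<longlongrightarrow> 0) at_infinity"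
    by (rule tendsto_mult_right_zero[OF inv])
  then have 1: "(u \<longlongrightarrow> 0) at_infinity"
    by (rule Lim_null_comparison[rotated]) (use e ub in \<open>auto elim!: eventually_mono\<close>)
  have "((\<lambda>x. I * (sqrt 27 * (1 / \<bar>x\<bar>) ^ 2)) \<longlongrightarrow> 0) at_infinity"
    by (rule tendsto_mult_right_zero, rule tendsto_mult_right_zero, rule tendsto_null_power[OF inv]) simp
  then have 2: "(deriv u \<longlongrightarrow> 0) at_infinity"
    by (rule Lim_null_comparison[rotated]) (use e vb in \<open>auto elim!: eventually_mono\<close>)
  have 3: "\<forall>\<^sub>F x in at_infinity. u differentiable (at x)"
    using e by eventually_elim
      (auto simp: u_def real_differentiable_def intro!: exI subordinated_derivatives(1)[OF f])
  from 1 2 3 show ?thesis by (simp add: vanishes_at_infinity_def)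
qed

section \<open>The Mellin transform of the Gaussian kernel\<close>

lemma set_integrable_eq_on:
  assumes "set_integrable M A f" "\<And>x. x \<in> A \<Longrightarrow> f x = g x"
  shows "set_integrable M A g"
proof -
  have "(\<lambda>x. indicator A x *\<^sub>R f x) = (\<lambda>x. indicator A x *\<^sub>R g x)"
    using assms(2) by (auto simp: fun_eq_iff indicator_def)
  then show ?thesis using assms(1) by (simp add: set_integrable_def)
qed

lemma
  fixes s c :: real
  assumes s: "0 < s" and c: "0 < c"
  shows set_integrable_powr_exp: "set_integrable lborel {0<..} (\<lambda>z. z powr (s - 1) * exp (- (c * z)))"
    and LINT_powr_exp: "(LINT z:{0<..}|lborel. z powr (s - 1) * exp (- (c * z))) = Gamma s / c powr s"
proof -
  let ?f = "\<lambda>z::real. indicator {0<..} z *\<^sub>R (z powr (s - 1) * exp (- z))"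
  have "has_bochner_integral lborel ?f (Gamma s)"
  proof (rule has_bochner_integral_nn_integral)
    have "(\<integral>\<^sup>+z. ennreal (?f z) \<partial>lborel) = (\<integral>\<^sup>+z. ennreal (indicator {0..} z * z powr (s - 1) / exp z) \<partial>lborel)"
      by (intro nn_integral_cong) (auto simp: indicator_def exp_minus divide_inverse)
    then show "(\<integral>\<^sup>+z. ennreal (?f z) \<partial>lborel) = ennreal (Gamma s)"
      using Gamma_conv_nn_integral_real[OF s] by simp
  qed (use s in \<open>auto intro: Gamma_real_nonneg\<close>)
  then have "has_bochner_integral lborel (\<lambda>z. ?f (0 + c * z)) (Gamma s /\<^sub>R \<bar>c\<bar>)"
    using c lborel_has_bochner_integral_real_affine_iff[of c ?f "Gamma s" 0] by simp
  then have "has_bochner_integral lborel (\<lambda>z. inverse (c powr (s - 1)) * ?f (0 + c * z))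
      (inverse (c powr (s - 1)) * (Gamma s /\<^sub>R \<bar>c\<bar>))"
    by (rule has_bochner_integral_mult_right)
  moreover have "inverse (c powr (s - 1)) * ?f (0 + c * z)
      = indicator {0<..} z *\<^sub>R (z powr (s - 1) * exp (- (c * z)))" for z
    using c by (auto simp: indicator_def powr_mult zero_less_mult_iff)
  moreover have "inverse (c powr (s - 1)) * (Gamma s /\<^sub>R \<bar>c\<bar>) = Gamma s / c powr s"
    using c by (simp add: powr_diff field_simps)
  ultimately have *: "has_bochner_integral lborel
      (\<lambda>z. indicator {0<..} z *\<^sub>R (z powr (s - 1) * exp (- (c * z)))) (Gamma s / c powr s)"
    by (simp only:)
  show "set_integrable lborel {0<..} (\<lambda>z. z powr (s - 1) * exp (- (c * z)))"
    unfolding set_integrable_def using * by (simp only: has_bochner_integral_iff)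
  show "(LINT z:{0<..}|lborel. z powr (s - 1) * exp (- (c * z))) = Gamma s / c powr s"
    unfolding set_lebesgue_integral_def using * by (rule has_bochner_integral_integral_eq)
qed

definition mellin_weight :: "real \<Rightarrow> real \<Rightarrow> real" where
  "mellin_weight x z = brownian_density x z * exp (- z) / z"

definition mellin_real :: "real \<Rightarrow> real \<Rightarrow> real" where
  "mellin_real x s = (LINT z:{0<..}|lborel. mellin_weight x z * z powr s)"

definition mellin :: "real \<Rightarrow> complex \<Rightarrow> complex" where
  "mellin x w = (LINT z:{0<..}|lborel. complex_of_real (mellin_weight x z) * exp (w * complex_of_real (ln z)))"

lemma mellin_weight_measurable [measurable]: "mellin_weight x \<in> borel_measurable borel"
  by (simp add: mellin_weight_def[abs_def])

lemma mellin_weight_nonneg: "0 < z \<Longrightarrow> 0 \<le> mellin_weight x z"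
  by (simp add: mellin_weight_def)

text \<open>The kernel is \<open>O(z^N)\<close> for each \<open>N\<close>, so that a large enough \<open>N\<close> compensates any negative \<open>s\<close>.\<close>

lemma mellin_integrable:
  assumes x: "x \<noteq> 0"
  shows "set_integrable lborel {0<..} (\<lambda>z. mellin_weight x z * z powr s)"
proof -
  define N where "N = nat (\<lceil>- s\<rceil> + 1)"
  have N: "0 < real N + s" unfolding N_def by linarith
  have "set_integrable lborel {0<..}
      (\<lambda>z. (brownian_density x z / z ^ N) * (z powr (real N + s - 1) * exp (- (1 * z))))"
    by (rule set_integrable_bounded_mult[OF set_integrable_powr_exp[OF N]])
       (use brownian_density_div_power_le[OF _ x, of _ N] in auto)
  moreover have "(brownian_density x z / z ^ N) * (z powr (real N + s - 1) * exp (- (1 * z)))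
      = mellin_weight x z * z powr s" if "z \<in> {0<..}" for z
  proof -
    have "z powr (real N + s - 1) = z ^ N * z powr s / z"
      using that by (simp add: powr_add powr_diff powr_realpow)
    then show ?thesis using that by (simp add: mellin_weight_def)
  qed
  ultimately show ?thesis
    by (rule set_integrable_eq_on)
qed

lemma exp_mult_abs_ln_le:
  assumes "0 < z" "0 \<le> (r::real)"
  shows "exp (r * \<bar>ln z\<bar>) \<le> z powr r + z powr (- r)"
proof -
  have "exp (r * \<bar>ln z\<bar>) = z powr r \<or> exp (r * \<bar>ln z\<bar>) = z powr (- r)"
    using assms(1) by (cases "0 \<le> ln z") (simp_all add: powr_def abs_if)
  then show ?thesis
    using powr_ge_zero[of z r] powr_ge_zero[of z "- r"] by linarith
qed

text \<open>Expand \<open>z^w\<close> into powers of \<open>w ln z\<close>. The series of norms is \<open>exp (\<bar>w\<bar> \<bar>ln z\<bar>) \<le> z^\<bar>w\<bar> + z^(-\<bar>w\<bar>)\<close>, which the weight integrates, so the order of sum and integral may be exchanged.\<close>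

lemma mellin_power_series:
  assumes x: "x \<noteq> 0"
  shows "(\<lambda>n. (LINT z:{0<..}|lborel. complex_of_real (mellin_weight x z) * (complex_of_real (ln z)) ^ n / fact n) * w ^ n)
    sums mellin x w"
proof -
  define f where "f n z = indicator {0<..} z *\<^sub>R (complex_of_real (mellin_weight x z) * (w * complex_of_real (ln z)) ^ n / fact n)" for n z
  define g where "g z = indicator {0<..} z *\<^sub>R (mellin_weight x z * exp (norm w * \<bar>ln z\<bar>))" for z
  have nf: "norm (f n z) = indicator {0<..} z * mellin_weight x z * ((norm w * \<bar>ln z\<bar>) ^ n / fact n)" for n z
    by (auto simp: f_def indicator_def norm_mult norm_divide norm_power mellin_weight_nonneg)
  have ssum: "(\<lambda>n. norm (f n z)) sums g z" for z
  proof -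
    have "(\<lambda>n. (norm w * \<bar>ln z\<bar>) ^ n / fact n) sums exp (norm w * \<bar>ln z\<bar>)"
      using exp_converges[of "norm w * \<bar>ln z\<bar>"] by (simp add: divide_inverse mult.commute)
    from sums_mult[OF this, of "indicator {0<..} z * mellin_weight x z"] show ?thesis
      by (simp add: nf g_def mult.assoc)
  qed
  have ig: "integrable lborel g"
  proof -
    have "set_integrable lborel {0<..} (\<lambda>z. mellin_weight x z * z powr norm w + mellin_weight x z * z powr (- norm w))"
      by (intro set_integral_add mellin_integrable x)
    then have "integrable lborel (\<lambda>z. indicator {0<..} z *\<^sub>R
        (mellin_weight x z * z powr norm w + mellin_weight x z * z powr (- norm w)))"
      by (simp add: set_integrable_def)
    then show ?thesis
    proof (rule Bochner_Integration.integrable_bound)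
      show "g \<in> borel_measurable lborel" by (simp add: g_def[abs_def])
      show "AE z in lborel. norm (g z) \<le> norm (indicator {0<..} z *\<^sub>R
        (mellin_weight x z * z powr norm w + mellin_weight x z * z powr (- norm w)))"
      proof (rule AE_I2)
        fix z :: real
        show "norm (g z) \<le> norm (indicator {0<..} z *\<^sub>R
          (mellin_weight x z * z powr norm w + mellin_weight x z * z powr (- norm w)))"
        proof (cases "0 < z")
          case True
          have "mellin_weight x z * exp (norm w * \<bar>ln z\<bar>) \<le> mellin_weight x z * (z powr norm w + z powr (- norm w))"
            using True by (intro mult_left_mono exp_mult_abs_ln_le mellin_weight_nonneg) auto
          then show ?thesis using True mellin_weight_nonneg[OF True, of x]
            by (simp add: g_def distrib_left)
        qed (simp add: g_def)
      qed
    qed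
  qed
  have fm: "f n \<in> borel_measurable lborel" for n
    by (simp add: f_def[abs_def])
  have gn: "norm (f n z) \<le> g z" for n z
    using sum_le_suminf[of "\<lambda>n. norm (f n z)" "{n}"] ssum[of z]
    by (simp add: sums_iff)
  have fi: "integrable lborel (f n)" for n
    by (rule Bochner_Integration.integrable_bound[OF ig fm], rule AE_I2)
       (use gn in \<open>force intro: order_trans[OF _ abs_ge_self]\<close>)
  have "(\<lambda>n. integral\<^sup>L lborel (f n)) sums (LINT z|lborel. (\<Sum>n. f n z))"
  proof (rule sums_integral[OF fi])
    show "AE z in lborel. summable (\<lambda>n. norm (f n z))" using ssum by (auto simp: sums_iff)
    show "summable (\<lambda>n. LINT z|lborel. norm (f n z))"
    proof (rule summableI_nonneg_bounded)
      fix n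
      have "(\<Sum>i<n. LINT z|lborel. norm (f i z)) = (LINT z|lborel. (\<Sum>i<n. norm (f i z)))"
        by (rule Bochner_Integration.integral_sum[symmetric]) (simp add: fi)
      also have "\<dots> \<le> integral\<^sup>L lborel g"
      proof (rule integral_mono[OF _ ig])
        show "integrable lborel (\<lambda>z. \<Sum>i<n. norm (f i z))" by (simp add: fi)
        show "(\<Sum>i<n. norm (f i z)) \<le> g z" for z
          using sum_le_suminf[of "\<lambda>n. norm (f n z)" "{..<n}"] ssum[of z] by (simp add: sums_iff)
      qed
      finally show "(\<Sum>i<n. LINT z|lborel. norm (f i z)) \<le> integral\<^sup>L lborel g" .
    qed simp
  qed
  moreover have "(\<lambda>n. f n z) sums (indicator {0<..} z *\<^sub>R (complex_of_real (mellin_weight x z) * exp (w * complex_of_real (ln z))))" for z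
  proof -
    have "(\<lambda>n. (w * complex_of_real (ln z)) ^ n / fact n) sums exp (w * complex_of_real (ln z))"
      using exp_converges[of "w * complex_of_real (ln z)"]
      by (simp add: divide_inverse mult.commute scaleR_conv_of_real)
    from sums_mult[OF this, of "indicator {0<..} z * complex_of_real (mellin_weight x z)"] show ?thesis
      by (cases "0 < z") (simp_all add: f_def mult.assoc)
  qed
  then have "(\<Sum>n. f n z) = indicator {0<..} z *\<^sub>R (complex_of_real (mellin_weight x z) * exp (w * complex_of_real (ln z)))" for z
    by (rule sums_unique[symmetric])
  moreover have "integral\<^sup>L lborel (f n) =
     (LINT z:{0<..}|lborel. complex_of_real (mellin_weight x z) * (complex_of_real (ln z)) ^ n / fact n) * w ^ n" for n
  proof -
    have "f n = (\<lambda>z. (indicator {0<..} z *\<^sub>R (complex_of_real (mellin_weight x z) * (complex_of_real (ln z)) ^ n / fact n)) * w ^ n)"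
      by (simp add: fun_eq_iff f_def power_mult_distrib mult_ac)
    then show ?thesis
      unfolding set_lebesgue_integral_def by (simp only: integral_mult_left_zero)
  qed
  ultimately show ?thesis by (simp add: mellin_def set_lebesgue_integral_def)
qed

lemma mellin_entire: "x \<noteq> 0 \<Longrightarrow> mellin x holomorphic_on S"
proof -
  assume x: "x \<noteq> 0"
  have "mellin x field_differentiable (at w)" for w
  proof -
    have "mellin x holomorphic_on ball 0 (norm w + 1)"
      by (rule power_series_holomorphic) (simp only: diff_zero, rule mellin_power_series[OF x])
    then show ?thesis
      by (rule holomorphic_on_imp_differentiable_at) auto
  qed
  then show ?thesis
    unfolding holomorphic_on_def by (auto intro: field_differentiable_at_within)
qed

lemma mellin_of_real: "mellin x (complex_of_real s) = complex_of_real (mellin_real x s)"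
proof -
  have "mellin x (complex_of_real s) = (LINT z:{0<..}|lborel. complex_of_real (mellin_weight x z * z powr s))"
    unfolding mellin_def
    by (rule set_lebesgue_integral_cong) (auto simp: powr_def exp_of_real simp flip: of_real_mult)
  then show ?thesis
    by (simp only: mellin_real_def set_integral_complex_of_real)
qed

lemma norm_mellin_le: 
  assumes x: "x \<noteq> 0"
  shows "norm (mellin x w) \<le> mellin_real x (Re w)"
proof -
  have "norm (mellin x w) \<le> (LINT z|lborel. norm (indicator {0<..} z *\<^sub>R (complex_of_real (mellin_weight x z) * exp (w * complex_of_real (ln z)))))"
    unfolding mellin_def set_lebesgue_integral_def by (rule integral_norm_bound)
  also have "\<dots> = mellin_real x (Re w)"
    unfolding mellin_real_def set_lebesgue_integral_def
    by (intro Bochner_Integration.integral_cong refl)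
       (auto simp: indicator_def norm_mult mellin_weight_nonneg powr_def)
  finally show ?thesis .
qed

lemma mellin_real_le:
  assumes x: "x \<noteq> 0" and s: "0 < s"
  shows "mellin_real x s \<le> Gamma s / \<bar>x\<bar>"
proof -
  have "mellin_real x s \<le> (LINT z:{0<..}|lborel. 1 / \<bar>x\<bar> * (z powr (s - 1) * exp (- (1 * z))))"
    unfolding mellin_real_def
  proof (rule set_integral_mono)
    show "set_integrable lborel {0<..} (\<lambda>z. mellin_weight x z * z powr s)"
      by (rule mellin_integrable[OF x])
    show "set_integrable lborel {0<..} (\<lambda>z. 1 / \<bar>x\<bar> * (z powr (s - 1) * exp (- (1 * z))))"
      by (rule set_integrable_mult_right) (rule set_integrable_powr_exp[OF s zero_less_one])
    fix z :: real assume z: "z \<in> {0<..}"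
    have "mellin_weight x z * z powr s = brownian_density x z * (z powr (s - 1) * exp (- (1 * z)))"
      using z by (simp add: mellin_weight_def powr_diff)
    also have "\<dots> \<le> 1 / \<bar>x\<bar> * (z powr (s - 1) * exp (- (1 * z)))"
      using z x by (intro mult_right_mono brownian_density_le) auto
    finally show "mellin_weight x z * z powr s \<le> 1 / \<bar>x\<bar> * (z powr (s - 1) * exp (- (1 * z)))" .
  qed
  also have "\<dots> = Gamma s / \<bar>x\<bar>"
    using LINT_powr_exp[OF s zero_less_one] by simp
  finally show ?thesis .
qed

text \<open>Integrate the derivative of \<open>brownian_density x z * z^(s-1) e^(-z)\<close> over the half-line. The boundary terms vanish, and the heat equation replaces the \<open>z\<close>-derivative of the kernel.\<close>

lemma mellin_heat:
  assumes x: "x \<noteq> 0"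
  shows "(LINT z:{0<..}|lborel. brownian_density_xx x z / 2 * (z powr (s - 1) * exp (- z)))
    = mellin_real x s - (s - 1) * mellin_real x (s - 1)"
    (is "?L = ?R")
proof -
  define F where "F z = brownian_density x z * (z powr (s - 1) * exp (- z))" for z
  define h where "h z = brownian_density_xx x z / 2 * (z powr (s - 1) * exp (- z))" for z
  define r where "r z = (s - 1) * (mellin_weight x z * z powr (s - 1)) - mellin_weight x z * z powr s" for z
  have ir: "set_integrable lborel {0<..} r"
    unfolding r_def by (intro set_integral_diff(1) set_integrable_mult_right mellin_integrable x)
  have ih: "set_integrable lborel {0<..} h"
  proof -
    have "set_integrable lborel {0<..} (\<lambda>z. x\<^sup>2 / 2 * (mellin_weight x z * z powr (s - 2)) - 1 / 2 * (mellin_weight x z * z powr (s - 1)))"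
      by (intro set_integral_diff(1) set_integrable_mult_right mellin_integrable x)
    moreover have "x\<^sup>2 / 2 * (mellin_weight x z * z powr (s - 2)) - 1 / 2 * (mellin_weight x z * z powr (s - 1)) = h z" if "z \<in> {0<..}" for z
    proof -
      have "z powr (s - 1) = z powr (s - 2) * z"
        using that powr_add[of z "s - 2" 1] by (simp add: powr_one')
      then show ?thesis
        using that by (simp add: h_def mellin_weight_def brownian_density_xx_def field_simps power2_eq_square)
    qed
    ultimately show ?thesis by (rule set_integrable_eq_on)
  qed
  have iF: "set_integrable lborel (einterval 0 \<infinity>) (\<lambda>z. h z + r z)"
    using set_integral_add(1)[OF ih ir] by (simp add: zero_ereal_def)
  have DF: "(F has_real_derivative h z + r z) (at z)" if z: "0 < z" for z
  proof -
    have p: "((\<lambda>z. z powr (s - 1) * exp (- z)) has_real_derivative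
        ((s - 1) * z powr (s - 1 - 1) * exp (- z) - z powr (s - 1) * exp (- z))) (at z)"
      using z by (auto intro!: derivative_eq_intros)
    have zz: "z powr (s - 1) = z powr s / z" "z powr (s - 2) = z powr s / z\<^sup>2"
      using z by (simp_all add: powr_diff)
    show ?thesis unfolding F_def
      by (rule DERIV_cong[OF DERIV_mult[OF heat_equation[OF z] p]])
         (use z in \<open>simp add: h_def r_def mellin_weight_def zz field_simps power2_eq_square\<close>)
  qed
  have "(LBINT z=0..\<infinity>. h z + r z) = 0 - 0"
  proof (rule interval_integral_FTC_integrable[where F = F])
    show "(F has_vector_derivative h z + r z) (at z)" if "0 < ereal z" for z
      using DF[of z] that by (simp add: has_real_derivative_iff_has_vector_derivative)
    show "isCont (\<lambda>z. h z + r z) z" if "0 < ereal z" for z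
    proof -
      have "0 < z" using that by simp
      then have c: "isCont (brownian_density x) z"
        using heat_equation[of z x] DERIV_isCont by (simp add: eta_contract_eq)
      show ?thesis
        unfolding h_def r_def mellin_weight_def brownian_density_xx_def
        using c \<open>0 < z\<close> by (intro continuous_intros) auto
    qed
    show "((F \<circ> real_of_ereal) \<longlongrightarrow> 0) (at_right 0)"
    proof -
      define N where "N = nat (\<lceil>1 - s\<rceil> + 1)"
      have N: "0 < real N + s - 1" unfolding N_def by linarith
      define C where "C = ((2 * real N + 1) / x\<^sup>2) powr (real N + 1 / 2)"
      have b: "norm (F z) \<le> C * z powr (real N + s - 1)" if "0 < z" for z
      proof -
        have "F z = (brownian_density x z / z ^ N) * (z powr (real N + s - 1) * exp (- z))"
          using that by (simp add: F_def powr_add powr_diff powr_realpow)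
        also have "norm \<dots> \<le> C * (z powr (real N + s - 1) * 1)"
          unfolding norm_mult C_def using that
          using brownian_density_div_power_le[OF that x, of N] by (intro mult_mono) auto
        finally show ?thesis by simp
      qed
      have "((\<lambda>z. C * z powr (real N + s - 1)) \<longlongrightarrow> C * 0 powr (real N + s - 1)) (at_right 0)"
        using N by (intro tendsto_intros) (auto simp: eventually_at_right_less intro: eventually_at_rightI[of 0 1])
      then have "((\<lambda>z. C * z powr (real N + s - 1)) \<longlongrightarrow> 0) (at_right 0)" by simp
      then have "(F \<longlongrightarrow> 0) (at_right 0)"
        by (rule Lim_null_comparison[rotated])
           (use b in \<open>auto simp: eventually_at_filter intro!: always_eventually\<close>)
      then show ?thesis
        unfolding zero_ereal_def by (simp add: ereal_tendsto_simps)
    qed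
    show "((F \<circ> real_of_ereal) \<longlongrightarrow> 0) (at_left \<infinity>)"
    proof -
      have "((\<lambda>z. 1 / \<bar>x\<bar> * (z powr (s - 1) * exp (- z))) \<longlongrightarrow> 1 / \<bar>x\<bar> * 0) at_top"
        by (intro tendsto_mult tendsto_const) real_asymp
      then have "((\<lambda>z. 1 / \<bar>x\<bar> * (z powr (s - 1) * exp (- z))) \<longlongrightarrow> 0) at_top" by simp
      moreover have "norm (F z) \<le> 1 / \<bar>x\<bar> * (z powr (s - 1) * exp (- z))" if "0 < z" for z
      proof -
        have "norm (F z) = brownian_density x z * (z powr (s - 1) * exp (- z))"
          by (simp add: F_def)
        also have "\<dots> \<le> 1 / \<bar>x\<bar> * (z powr (s - 1) * exp (- z))"
          using that x by (intro mult_right_mono brownian_density_le) auto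
        finally show ?thesis .
      qed
      then have "\<forall>\<^sub>F z in at_top. norm (F z) \<le> 1 / \<bar>x\<bar> * (z powr (s - 1) * exp (- z))"
        by (intro eventually_mono[OF eventually_gt_at_top[of 0]])
      ultimately have "(F \<longlongrightarrow> 0) at_top"
        by (rule Lim_null_comparison[rotated])
      then show ?thesis by (simp add: ereal_tendsto_simps)
    qed
  qed (use iF in auto)
  then have "(LINT z:{0<..}|lborel. h z + r z) = 0"
    by (simp add: interval_lebesgue_integral_0_infty)
  then have "?L + (LINT z:{0<..}|lborel. r z) = 0"
    using set_integral_add(2)[OF ih ir] by (simp add: h_def)
  moreover have "(LINT z:{0<..}|lborel. r z) = (s - 1) * mellin_real x (s - 1) - mellin_real x s"
    unfolding r_def mellin_real_def
    by (subst set_integral_diff(2)) (auto intro!: set_integrable_mult_right mellin_integrable x)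
  ultimately show ?thesis by simp
qed

section \<open>The variance gamma kernel as an entire function of time\<close>

text \<open>For real \<open>w > 0\<close> this is the density at \<open>x\<close> of Brownian motion at an independent gamma time of parameter \<open>w\<close>, the variance gamma density.\<close>

definition vg_entire :: "real \<Rightarrow> complex \<Rightarrow> complex" where
  "vg_entire x w = rGamma w * mellin x w"

definition vg_kernel :: "real \<Rightarrow> nat \<Rightarrow> real \<Rightarrow> real" where
  "vg_kernel x n l = Re ((deriv ^^ n) (vg_entire x) (complex_of_real l))"

lemma vg_kernel_0: "vg_kernel x 0 l = rGamma l * mellin_real x l"
  by (simp add: vg_kernel_def vg_entire_def mellin_of_real rGamma_complex_of_real flip: of_real_mult)

lemma vg_entire_holomorphic: "x \<noteq> 0 \<Longrightarrow> vg_entire x holomorphic_on S"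
  unfolding vg_entire_def by (intro holomorphic_intros mellin_entire)

lemma vg_kernel_deriv:
  assumes x: "x \<noteq> 0"
  shows "(vg_kernel x n has_real_derivative vg_kernel x (Suc n) l) (at l)"
proof -
  have "(deriv ^^ n) (vg_entire x) holomorphic_on UNIV"
    by (rule holomorphic_higher_deriv[OF vg_entire_holomorphic[OF x]]) simp
  then have "((deriv ^^ n) (vg_entire x) has_field_derivative (deriv ^^ Suc n) (vg_entire x) (complex_of_real l))
      (at (complex_of_real l))"
    by (auto intro: holomorphic_derivI)
  then have "((\<lambda>l. (deriv ^^ n) (vg_entire x) (complex_of_real l)) has_vector_derivative
      (deriv ^^ Suc n) (vg_entire x) (complex_of_real l)) (at l)"
    by (rule has_vector_derivative_real_field)
  from bounded_linear.has_vector_derivative[OF bounded_linear_Re this]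
  show ?thesis
    by (simp add: vg_kernel_def[abs_def] has_real_derivative_iff_has_vector_derivative)
qed

lemma vg_kernel_measurable: "x \<noteq> 0 \<Longrightarrow> vg_kernel x n \<in> borel_measurable borel"
proof -
  assume x: "x \<noteq> 0"
  have "continuous_on UNIV (vg_kernel x n)"
    by (rule DERIV_continuous_on, rule has_field_derivative_at_within, rule vg_kernel_deriv[OF x])
  then show ?thesis by (rule borel_measurable_continuous_onI)
qed

text \<open>The quotient \<open>Gamma (Re w) / \<bar>Gamma w\<bar>\<close> does not increase under \<open>w \<mapsto> w + 1\<close>, because \<open>Re w \<le> \<bar>w\<bar>\<close>; hence its maximum over a compact rectangle of width one bounds it on the whole half-strip.\<close>

lemma norm_rGamma_Gamma_Re_bounded:
  "\<exists>C. \<forall>w. 1 \<le> Re w \<and> \<bar>Im w\<bar> \<le> 2 \<longrightarrow> norm (rGamma w) * Gamma (Re w) \<le> C"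
proof -
  define K where "K = cbox (Complex 1 (- 2)) (Complex 2 2)"
  have K: "w \<in> K \<longleftrightarrow> 1 \<le> Re w \<and> Re w \<le> 2 \<and> \<bar>Im w\<bar> \<le> 2" for w
    by (auto simp: K_def in_cbox_complex_iff)
  have "continuous_on K (\<lambda>w. norm (rGamma w) * Gamma (Re w))"
  proof (rule continuous_on_mult)
    show "continuous_on K (\<lambda>w. norm (rGamma w))"
      by (intro continuous_on_norm holomorphic_on_imp_continuous_on holomorphic_rGamma)
    show "continuous_on K (\<lambda>w. Gamma (Re w))"
      by (rule continuous_on_compose2[of "{1..2}" Gamma])
         (auto simp: K intro!: continuous_intros elim!: nonpos_Ints_cases)
  qed
  then have "compact ((\<lambda>w. norm (rGamma w) * Gamma (Re w)) ` K)"
    by (rule compact_continuous_image) (simp add: K_def)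
  then obtain C where C: "\<And>w. w \<in> K \<Longrightarrow> norm (rGamma w) * Gamma (Re w) \<le> C"
    using bounded_imp_bdd_above[OF compact_imp_bounded] by (fastforce simp: bdd_above_def)
  have "norm (rGamma w) * Gamma (Re w) \<le> C"
    if "1 \<le> Re w" "Re w \<le> real n + 2" "\<bar>Im w\<bar> \<le> 2" for n w
    using that
  proof (induction n arbitrary: w)
    case 0 then show ?case using C by (auto simp: K)
  next
    case (Suc n)
    show ?case
    proof (cases "Re w \<le> 2")
      case True then show ?thesis using Suc.prems C by (auto simp: K)
    next
      case False
      define v where "v = w - 1"
      have v: "1 < Re v" "v \<noteq> 0" using False by (auto simp: v_def complex_eq_iff)
      have r: "rGamma w = rGamma v / v"
        using rGamma_plus1[of v] v by (simp add: v_def field_simps)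
      have "Re v \<notin> \<int>\<^sub>\<le>\<^sub>0" using v by (auto elim!: nonpos_Ints_cases)
      then have g: "Gamma (Re w) = Re v * Gamma (Re v)"
        using Gamma_plus1[of "Re v"] v by (simp add: v_def)
      have "norm (rGamma w) * Gamma (Re w) = (Re v / norm v) * (norm (rGamma v) * Gamma (Re v))"
        by (simp add: r g norm_divide)
      also have "\<dots> \<le> 1 * (norm (rGamma v) * Gamma (Re v))"
        using v complex_Re_le_cmod[of v]
        by (intro mult_right_mono) (auto intro!: mult_nonneg_nonneg Gamma_real_nonneg)
      also have "\<dots> \<le> C" using Suc.IH[of v] Suc.prems v by (auto simp: v_def)
      finally show ?thesis .
    qed
  qed
  note bnd = this
  have "norm (rGamma w) * Gamma (Re w) \<le> C" if w: "1 \<le> Re w" "\<bar>Im w\<bar> \<le> 2" for w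
  proof (rule bnd[OF w(1) _ w(2)])
    show "Re w \<le> real (nat \<lceil>Re w - 2\<rceil>) + 2"
      using real_nat_ceiling_ge[of "Re w - 2"] by linarith
  qed
  then show ?thesis by blast
qed

text \<open>Continuity handles the compact part. Further to the right the Mellin integral is at most its value at \<open>Re w\<close>, hence at most \<open>Gamma (Re w) / \<bar>x\<bar>\<close>, and the previous lemma absorbs the Gamma factor.\<close>

lemma vg_entire_bounded_on_strip:
  assumes x: "x \<noteq> 0"
  shows "\<exists>C. \<forall>w. - 2 \<le> Re w \<and> \<bar>Im w\<bar> \<le> 2 \<longrightarrow> norm (vg_entire x w) \<le> C"
proof -
  define K where "K = cbox (Complex (- 2) (- 2)) (Complex 1 2)"
  have K: "w \<in> K \<longleftrightarrow> - 2 \<le> Re w \<and> Re w \<le> 1 \<and> \<bar>Im w\<bar> \<le> 2" for w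
    by (auto simp: K_def in_cbox_complex_iff)
  have "continuous_on K (vg_entire x)"
    by (rule holomorphic_on_imp_continuous_on[OF vg_entire_holomorphic[OF x]])
  then have "bounded (vg_entire x ` K)"
    by (intro compact_imp_bounded compact_continuous_image) (simp_all add: K_def)
  then obtain C1 where C1: "\<And>w. w \<in> K \<Longrightarrow> norm (vg_entire x w) \<le> C1"
    by (auto simp: bounded_iff)
  obtain C2 where C2: "\<And>w. 1 \<le> Re w \<Longrightarrow> \<bar>Im w\<bar> \<le> 2 \<Longrightarrow> norm (rGamma w) * Gamma (Re w) \<le> C2"
    using norm_rGamma_Gamma_Re_bounded by blast
  have "norm (vg_entire x w) \<le> max C1 (C2 / \<bar>x\<bar>)" if w: "- 2 \<le> Re w" "\<bar>Im w\<bar> \<le> 2" for w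
  proof (cases "Re w \<le> 1")
    case True then show ?thesis using C1[of w] w by (auto simp: K)
  next
    case False
    have "norm (vg_entire x w) \<le> norm (rGamma w) * (Gamma (Re w) / \<bar>x\<bar>)"
      unfolding vg_entire_def norm_mult
      using False norm_mellin_le[OF x, of w] mellin_real_le[OF x, of "Re w"]
      by (intro mult_left_mono) auto
    also have "\<dots> = norm (rGamma w) * Gamma (Re w) / \<bar>x\<bar>" by simp
    also have "\<dots> \<le> C2 / \<bar>x\<bar>"
      using False w by (intro divide_right_mono C2) auto
    finally show ?thesis by simp
  qed
  then show ?thesis by blast
qed

text \<open>Cauchy's estimate on discs of radius two, centred on the nonnegative axis. The radius has to exceed one, since the Taylor series will be evaluated at distance one.\<close>

lemma vg_kernel_bounds:
  assumes x: "x \<noteq> 0"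
  shows "\<exists>C. \<forall>n l. 0 \<le> l \<longrightarrow> \<bar>vg_kernel x n l\<bar> \<le> fact n * C / 2 ^ n"
proof -
  obtain C where C: "\<And>w. - 2 \<le> Re w \<Longrightarrow> \<bar>Im w\<bar> \<le> 2 \<Longrightarrow> norm (vg_entire x w) \<le> C"
    using vg_entire_bounded_on_strip[OF x] by blast
  have "\<bar>vg_kernel x n l\<bar> \<le> fact n * C / 2 ^ n" if l: "0 \<le> l" for n l
  proof -
    have "norm ((deriv ^^ n) (vg_entire x) (complex_of_real l)) \<le> fact n * C / 2 ^ n"
    proof (rule Cauchy_inequality)
      show "vg_entire x holomorphic_on ball (complex_of_real l) 2"
        by (rule vg_entire_holomorphic[OF x])
      show "continuous_on (cball (complex_of_real l) 2) (vg_entire x)"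
        by (rule holomorphic_on_imp_continuous_on[OF vg_entire_holomorphic[OF x]])
      fix w assume w: "norm (complex_of_real l - w) = 2"
      show "norm (vg_entire x w) \<le> C"
        using l w abs_Re_le_cmod[of "complex_of_real l - w"] abs_Im_le_cmod[of "complex_of_real l - w"]
        by (intro C) auto
    qed simp
    then show ?thesis
      unfolding vg_kernel_def using abs_Re_le_cmod order_trans by blast
  qed
  then show ?thesis by blast
qed

text \<open>The backward unit shift is the exponential of minus the derivative.\<close>

lemma vg_kernel_shift:
  assumes x: "x \<noteq> 0"
  shows "(\<lambda>n. (- 1) ^ n / fact n * vg_kernel x n l) sums vg_kernel x 0 (l - 1)"
proof -
  have "(\<lambda>n. (deriv ^^ n) (vg_entire x) (complex_of_real l) / fact n * (complex_of_real (l - 1) - complex_of_real l) ^ n)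
      sums vg_entire x (complex_of_real (l - 1))"
    by (rule holomorphic_power_series[OF vg_entire_holomorphic[OF x], of _ _ 2]) (simp add: dist_norm)
  then have "(\<lambda>n. Re ((deriv ^^ n) (vg_entire x) (complex_of_real l) / fact n * (- 1) ^ n))
      sums Re (vg_entire x (complex_of_real (l - 1)))"
    by (intro sums_Re) simp
  moreover have "Re ((deriv ^^ n) (vg_entire x) (complex_of_real l) / fact n * (- 1) ^ n)
      = (- 1) ^ n / fact n * vg_kernel x n l" for n
  proof -
    have "(deriv ^^ n) (vg_entire x) (complex_of_real l) / fact n * (- 1) ^ n =
        complex_of_real ((- 1) ^ n / fact n) * (deriv ^^ n) (vg_entire x) (complex_of_real l)"
      by simp
    moreover have "Re (complex_of_real r * v) = r * Re v" for r v by simp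
    ultimately show ?thesis unfolding vg_kernel_def by (simp only:)
  qed
  ultimately show ?thesis by (simp add: vg_kernel_def)
qed

text \<open>The zeros of \<open>1 / Gamma\<close> make the formulas of this section consistent with the degenerate gamma law at time zero.\<close>

lemma vg_kernel_zeros: "vg_kernel x 0 0 = 0" "vg_kernel x 0 (- 1) = 0"
proof -
  have "rGamma (- 1 :: real) = 0"
    using rGamma_plus1[of "- 1 :: real"] by simp
  then show "vg_kernel x 0 0 = 0" "vg_kernel x 0 (- 1) = 0" by (simp_all add: vg_kernel_0)
qed

lemma vg_kernel_gamma_mean:
  assumes "0 < l"
  shows "(LINT z:{0<..}|lborel. brownian_density x z * gamma_density z l) = vg_kernel x 0 l"
proof -
  have "(LINT z:{0<..}|lborel. brownian_density x z * gamma_density z l)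
      = (LINT z:{0<..}|lborel. rGamma l * (mellin_weight x z * z powr l))"
    by (rule set_lebesgue_integral_cong)
       (auto simp: gamma_density_def mellin_weight_def powr_diff rGamma_inverse_Gamma divide_inverse mult_ac)
  then show ?thesis by (simp add: vg_kernel_0 mellin_real_def)
qed

text \<open>This is the equation behind the theorem: on variance gamma densities half the Laplacian is the identity minus the unit backward shift in gamma time. It follows from \<open>mellin_heat\<close> and \<open>(l - 1) / Gamma l = 1 / Gamma (l - 1)\<close>.\<close>

lemma vg_kernel_gamma_mean_xx:
  assumes l: "0 < l" and x: "x \<noteq> 0"
  shows "(LINT z:{0<..}|lborel. brownian_density_xx x z / 2 * gamma_density z l)
    = vg_kernel x 0 l - vg_kernel x 0 (l - 1)"
proof -
  have "(LINT z:{0<..}|lborel. brownian_density_xx x z / 2 * gamma_density z l)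
      = (LINT z:{0<..}|lborel. rGamma l * (brownian_density_xx x z / 2 * (z powr (l - 1) * exp (- z))))"
    by (rule set_lebesgue_integral_cong)
       (simp_all add: gamma_density_def rGamma_inverse_Gamma inverse_eq_divide)
  also have "\<dots> = rGamma l * (mellin_real x l - (l - 1) * mellin_real x (l - 1))"
    by (simp only: set_integral_mult_right mellin_heat[OF x])
  also have "\<dots> = rGamma l * mellin_real x l - ((l - 1) * rGamma (l - 1 + 1)) * mellin_real x (l - 1)"
    by (simp add: right_diff_distrib)
  finally show ?thesis by (simp only: rGamma_plus1 vg_kernel_0)
qed

section \<open>Brownian motion at a gamma process with random clock\<close>

abbreviation path_space :: "(real \<Rightarrow> real) measure" where
  "path_space \<equiv> PiM {0..} (\<lambda>_. borel)"

lemma independent_processesD: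
  assumes M: "prob_space M" and ind: "independent_processes M X Y Z"
    and J: "j < 3" "J \<subseteq> {..<3}" "j \<notin> J"
  shows "prob_space.indep_var M (PiM {j} (\<lambda>_. path_space)) (\<lambda>w. \<lambda>i\<in>{j}. \<lambda>s\<in>{0..}. ([X, Y, Z] ! i) s w)
           (PiM J (\<lambda>_. path_space)) (\<lambda>w. \<lambda>i\<in>J. \<lambda>s\<in>{0..}. ([X, Y, Z] ! i) s w)"
proof -
  interpret prob_space M by fact
  show ?thesis
    using J ind unfolding independent_processes_def by (intro indep_var_restrict[of _ _ "{..<3}"]) auto
qed

lemma measurable_path_component: "(\<lambda>q. q j) \<in> PiM {j} (\<lambda>_. path_space) \<rightarrow>\<^sub>M path_space"
  by (rule measurable_component_singleton) simp

lemma measurable_path_value: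
  assumes "j \<in> J" "0 \<le> t"
  shows "(\<lambda>r. r j t) \<in> borel_measurable (PiM J (\<lambda>_. path_space))"
proof (rule measurable_compose[where f = "\<lambda>r. r j" and g = "\<lambda>y. y t" and N = path_space])
  show "(\<lambda>r. r j) \<in> PiM J (\<lambda>_. path_space) \<rightarrow>\<^sub>M path_space"
    using assms(1) by (rule measurable_component_singleton)
  show "(\<lambda>y. y t) \<in> borel_measurable path_space"
    by (rule measurable_component_singleton) (use assms(2) in simp)
qed

text \<open>Both clocks, the inverse stable process and the stable process, are instances of \<open>T\<close>.\<close>

locale gamma_time_change = prob_space M for M :: "'w measure" +
  fixes B G T :: "real \<Rightarrow> 'w \<Rightarrow> real" and f :: "real \<Rightarrow> real \<Rightarrow> real"
  assumes BM: "standard_brownian_motion M B"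
    and GS: "gamma_subordinator M G"
    and indep: "independent_processes M B G T"
    and T_nonneg: "\<And>t w. 0 \<le> t \<Longrightarrow> w \<in> space M \<Longrightarrow> 0 \<le> T t w"
    and dens: "density_family M (\<lambda>t w. G (T t w) w) f"
begin

lemma G_facts:
  shows G_measurable: "0 \<le> s \<Longrightarrow> G s \<in> borel_measurable M"
    and G_0: "w \<in> space M \<Longrightarrow> G 0 w = 0"
    and G_nonneg: "w \<in> space M \<Longrightarrow> 0 \<le> s \<Longrightarrow> 0 \<le> G s w"
    and G_rc: "w \<in> space M \<Longrightarrow> 0 \<le> s \<Longrightarrow> continuous (at_right s) (\<lambda>s. G s w)"
    and G_dist: "0 < s \<Longrightarrow> distributed M lborel (G s) (\<lambda>z. ennreal (gamma_density z s))"
proof -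
  have S: "subordinator M G" using GS by (simp add: gamma_subordinator_def)
  show "0 \<le> s \<Longrightarrow> G s \<in> borel_measurable M" "w \<in> space M \<Longrightarrow> G 0 w = 0"
    "w \<in> space M \<Longrightarrow> 0 \<le> s \<Longrightarrow> continuous (at_right s) (\<lambda>s. G s w)"
    using S by (auto simp: subordinator_def)
  show "0 < s \<Longrightarrow> distributed M lborel (G s) (\<lambda>z. ennreal (gamma_density z s))"
    using GS by (simp add: gamma_subordinator_def)
  assume w: "w \<in> space M" "0 \<le> s"
  then have "G 0 w = 0" "mono_on {0..} (\<lambda>t. G t w)" using S by (auto simp: subordinator_def)
  with w show "0 \<le> G s w" using mono_onD[of "{0..}" "\<lambda>t. G t w" 0 s] by auto
qed

lemma T_measurable [measurable]: 
  assumes t: "0 \<le> t"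
  shows "T t \<in> borel_measurable M"
proof -
  have "\<forall>i\<in>{..<3}. (\<lambda>w. \<lambda>s\<in>{0..}. ([B, G, T] ! i) s w) \<in> M \<rightarrow>\<^sub>M path_space"
    using indep unfolding independent_processes_def indep_vars_def by blast
  then have "(\<lambda>w. \<lambda>s\<in>{0..}. ([B, G, T] ! 2) s w) \<in> M \<rightarrow>\<^sub>M path_space"
    by (rule bspec) simp
  from measurable_compose[OF this measurable_component_singleton[of t]] t show ?thesis by simp
qed

lemma
  assumes t: "0 \<le> t"
  shows GT_measurable: "(\<lambda>w. G (T t w) w) \<in> borel_measurable M"
    and nn_integral_GT: "h \<in> borel_measurable borel \<Longrightarrow>
      (\<integral>\<^sup>+w. h (G (T t w) w) \<partial>M) = (\<integral>\<^sup>+w. (\<integral>\<^sup>+w'. h (G (T t w) w') \<partial>M) \<partial>M)"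
proof -
  note i = independent_processesD[OF prob_space_axioms indep, of 1 "{2}", simplified]
  have m: "(\<lambda>r. r 2 t) \<in> borel_measurable (PiM {2::nat} (\<lambda>_. path_space))"
    by (rule measurable_path_value) (use t in auto)
  show "(\<lambda>w. G (T t w) w) \<in> borel_measurable M"
    using measurable_subordinate[OF prob_space_axioms i measurable_path_component _ m] T_nonneg[OF t] G_rc
    by (simp add: t)
  show "(\<integral>\<^sup>+w. h (G (T t w) w) \<partial>M) = (\<integral>\<^sup>+w. (\<integral>\<^sup>+w'. h (G (T t w) w') \<partial>M) \<partial>M)"
    if "h \<in> borel_measurable borel"
    using nn_integral_subordinate[OF prob_space_axioms i measurable_path_component _ m _ _ that] T_nonneg[OF t] G_rc
    by (simp add: t)
qed

lemma B_facts:
  shows B_rc: "w \<in> space M \<Longrightarrow> 0 \<le> s \<Longrightarrow> continuous (at_right s) (\<lambda>s. B s w)"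
    and B_dist: "0 < s \<Longrightarrow> distributed M lborel (B s) (\<lambda>x. ennreal (brownian_density x s))"
proof -
  assume "w \<in> space M" "0 \<le> s"
  then have "continuous_on {0..} (\<lambda>s. B s w)" using BM by (simp add: standard_brownian_motion_def)
  then have "continuous (at s within {0..}) (\<lambda>s. B s w)"
    using \<open>0 \<le> s\<close> by (simp add: continuous_on_eq_continuous_within)
  then show "continuous (at_right s) (\<lambda>s. B s w)"
    by (rule continuous_within_subset) (use \<open>0 \<le> s\<close> in auto)
next
  assume s: "0 < s"
  have d: "distributed M lborel (\<lambda>w. B s w - B 0 w) (\<lambda>x. ennreal (normal_density 0 (sqrt (s - 0)) x))"
    using BM s unfolding standard_brownian_motion_def by blast
  have "(2 * pi * s) powr (- 1 / 2) = 1 / sqrt (2 * pi * s)"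
    using s powr_minus_divide[of "2 * pi * s" "1 / 2"] powr_half_sqrt[of "2 * pi * s"] by simp
  then have e: "normal_density 0 (sqrt (s - 0)) x = brownian_density x s" for x
    using s by (simp add: normal_density_def brownian_density_def)
  have "distr M lborel (\<lambda>w. B s w - B 0 w) = distr M lborel (B s)"
    by (rule distr_cong) (use BM in \<open>auto simp: standard_brownian_motion_def\<close>)
  moreover have "B s \<in> borel_measurable M" using BM s by (simp add: standard_brownian_motion_def)
  ultimately show "distributed M lborel (B s) (\<lambda>x. ennreal (brownian_density x s))"
    using d unfolding e distributed_def by simp
qed

lemma
  assumes t: "0 \<le> t"
  shows BGT_measurable: "(\<lambda>w. B (G (T t w) w) w) \<in> borel_measurable M"
    and nn_integral_BGT: "h \<in> borel_measurable borel \<Longrightarrow>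
      (\<integral>\<^sup>+w. h (B (G (T t w) w) w) \<partial>M) = (\<integral>\<^sup>+w. (\<integral>\<^sup>+w'. h (B (G (T t w) w) w') \<partial>M) \<partial>M)"
proof -
  define R where "R w = restrict (\<lambda>i. \<lambda>s\<in>{0..}. ([B, G, T] ! i) s w) {1, 2::nat}" for w
  define \<tau> where "\<tau> r = path_limit (r 1) (r 2 t)" for r :: "nat \<Rightarrow> real \<Rightarrow> real"
  have i: "indep_var (PiM {0} (\<lambda>_. path_space)) (\<lambda>w. \<lambda>i\<in>{0}. \<lambda>s\<in>{0..}. ([B, G, T] ! i) s w)
      (PiM {1, 2} (\<lambda>_. path_space)) R"
    unfolding R_def by (rule independent_processesD[OF prob_space_axioms indep]) auto
  have m2: "(\<lambda>r. r 2 t) \<in> borel_measurable (PiM {1, 2::nat} (\<lambda>_. path_space))"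
    by (rule measurable_path_value) (use t in auto)
  have m1: "(\<lambda>r. r 1) \<in> PiM {1, 2::nat} (\<lambda>_. path_space) \<rightarrow>\<^sub>M path_space"
    by (rule measurable_component_singleton) simp
  have m: "\<tau> \<in> borel_measurable (PiM {1, 2} (\<lambda>_. path_space))"
    unfolding \<tau>_def
    using measurable_compose[OF measurable_Pair[OF m1 m2] measurable_path_limit] by simp
  have e: "\<tau> (R w) = G (T t w) w" if "w \<in> space M" for w
  proof -
    have "\<tau> (R w) = path_limit (\<lambda>s\<in>{0..}. G s w) (T t w)"
      using t by (simp add: \<tau>_def R_def)
    also have "\<dots> = G (T t w) w"
      by (rule path_limit_right_continuous) (use that t T_nonneg G_rc in auto)
    finally show ?thesis .
  qed
  have e0: "0 \<le> \<tau> (R w)" if "w \<in> space M" for w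
    using that t by (simp add: e G_nonneg T_nonneg)
  have "(\<lambda>w. B (\<tau> (R w)) w) \<in> borel_measurable M"
    by (rule measurable_subordinate[where Y = B, OF prob_space_axioms i measurable_path_component])
       (use m e0 B_rc in simp_all)
  then show "(\<lambda>w. B (G (T t w) w) w) \<in> borel_measurable M"
    by (rule measurable_cong[THEN iffD1, rotated]) (simp add: e)
  assume h: "h \<in> borel_measurable borel"
  have "(\<integral>\<^sup>+w. h (B (\<tau> (R w)) w) \<partial>M) = (\<integral>\<^sup>+w. (\<integral>\<^sup>+w'. h (B (\<tau> (R w)) w') \<partial>M) \<partial>M)"
    by (rule nn_integral_subordinate[where Y = B, OF prob_space_axioms i measurable_path_component])
       (use m e0 B_rc h in simp_all)
  then show "(\<integral>\<^sup>+w. h (B (G (T t w) w) w) \<partial>M) = (\<integral>\<^sup>+w. (\<integral>\<^sup>+w'. h (B (G (T t w) w) w') \<partial>M) \<partial>M)"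
    by (simp add: e cong: nn_integral_cong)
qed

lemma f_facts:
  assumes t: "0 < t"
  shows f_nonneg: "0 \<le> f z t"
    and f_dist: "distributed M lborel (\<lambda>w. G (T t w) w) (\<lambda>z. ennreal (f z t))"
    and f_measurable: "(\<lambda>z. f z t) \<in> borel_measurable borel"
    and f_integrable: "set_integrable lborel {0<..} (\<lambda>z. f z t)"
proof -
  show n: "0 \<le> f z t" for z using dens t by (simp add: density_family_def)
  show d: "distributed M lborel (\<lambda>w. G (T t w) w) (\<lambda>z. ennreal (f z t))"
    using dens t by (simp add: density_family_def)
  show m: "(\<lambda>z. f z t) \<in> borel_measurable borel"
    using distributed_real_measurable[OF n d] by simp
  have "integrable lborel (\<lambda>z. f z t * 1)"
    by (rule distributed_integrable[OF d, THEN iffD2]) (simp_all add: n)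
  then have "integrable lborel (\<lambda>z. f z t)" by simp
  then show "set_integrable lborel {0<..} (\<lambda>z. f z t)"
    unfolding set_integrable_def by (rule integrable_mult_indicator[rotated]) simp
qed

text \<open>Conditioning on the clock. For bounded signed \<open>h\<close> a constant \<open>D\<close> is added, so that the identity for nonnegative functions applies. The kernel \<open>h\<close> is integrated only over \<open>z > 0\<close>; the condition \<open>k 0 = 0\<close> accounts for the value of the gamma process at time zero.\<close>

lemma mixture:
  assumes t: "0 < t" and h: "h \<in> borel_measurable borel" and b: "\<And>z. 0 < z \<Longrightarrow> \<bar>h z\<bar> \<le> C"
    and k: "\<And>l. 0 < l \<Longrightarrow> (LINT z:{0<..}|lborel. h z * gamma_density z l) = k l"
    and k0: "k 0 = 0" and km: "k \<in> borel_measurable borel"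
  shows "integrable M (\<lambda>w. k (T t w))"
    and "(LINT z:{0<..}|lborel. h z * f z t) = (LINT w|M. k (T t w))"
proof -
  define g where "g z = (if 0 < z then h z else 0)" for z
  have gm[measurable]: "g \<in> borel_measurable borel" using h unfolding g_def[abs_def] by simp
  define D where "D = max C 0"
  have gb: "\<bar>g z\<bar> \<le> D" "0 \<le> g z + D" for z
    using b[of z] by (auto simp: g_def D_def)
  have kl: "(LINT w'|M. g (G l w')) = k l" and gi: "integrable M (\<lambda>w'. g (G l w'))" if "0 \<le> l" for l
  proof -
    have [measurable]: "G l \<in> borel_measurable M" by (rule G_measurable[OF that])
    show "integrable M (\<lambda>w'. g (G l w'))"
      by (rule integrable_const_bound[of _ D]) (use gb in auto)
    show "(LINT w'|M. g (G l w')) = k l"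
    proof (cases "l = 0")
      case True
      have "(LINT w'|M. g (G l w')) = (LINT w'|M. 0)"
        by (intro Bochner_Integration.integral_cong refl) (simp add: True G_0 g_def)
      then show ?thesis by (simp add: True k0)
    next
      case False
      then have l: "0 < l" using that by simp
      have "(LINT w'|M. g (G l w')) = (LINT z|lborel. gamma_density z l * g z)"
        by (rule distributed_integral[OF G_dist[OF l], symmetric])
           (use l in \<open>auto simp: gamma_density_def intro!: divide_nonneg_nonneg Gamma_real_nonneg\<close>)
      also have "\<dots> = (LINT z:{0<..}|lborel. h z * gamma_density z l)"
        unfolding set_lebesgue_integral_def
        by (intro Bochner_Integration.integral_cong refl) (auto simp: g_def)
      also have "\<dots> = k l" by (rule k[OF l])
      finally show ?thesis .
    qed
  qed
  have kb: "\<bar>k l\<bar> \<le> D" if "0 \<le> l" for l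
  proof -
    have "\<bar>k l\<bar> \<le> (LINT w'|M. \<bar>g (G l w')\<bar>)"
      unfolding kl[OF that, symmetric] by (rule integral_abs_bound)
    also have "\<dots> \<le> (LINT w'|M. D)"
      by (intro integral_mono integrable_abs gi that) (use gb in auto)
    finally show ?thesis by (simp add: prob_space)
  qed
  have [measurable]: "T t \<in> borel_measurable M" "(\<lambda>w. G (T t w) w) \<in> borel_measurable M"
    using t by (auto intro: T_measurable GT_measurable)
  note km[measurable]
  show ik: "integrable M (\<lambda>w. k (T t w))"
    by (rule integrable_const_bound[of _ D]) (use kb T_nonneg t in auto)
  have kn: "AE w in M. 0 \<le> k (T t w) + D"
  proof (rule AE_I2)
    fix w assume "w \<in> space M"
    then show "0 \<le> k (T t w) + D" using kb[of "T t w"] T_nonneg[of t w] t by linarith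
  qed
  have ig: "integrable M (\<lambda>w. g (G (T t w) w))"
    by (rule integrable_const_bound[of _ D]) (use gb in auto)
  have "ennreal (LINT w|M. g (G (T t w) w) + D) = (\<integral>\<^sup>+w. ennreal (g (G (T t w) w) + D) \<partial>M)"
    by (rule nn_integral_eq_integral[symmetric]) (use ig gb in auto)
  also have "\<dots> = (\<integral>\<^sup>+w. (\<integral>\<^sup>+w'. ennreal (g (G (T t w) w') + D) \<partial>M) \<partial>M)"
    using nn_integral_GT[of t "\<lambda>z. ennreal (g z + D)"] t by simp
  also have "\<dots> = (\<integral>\<^sup>+w. ennreal (k (T t w) + D) \<partial>M)"
  proof (rule nn_integral_cong)
    fix w assume "w \<in> space M"
    then have l: "0 \<le> T t w" using T_nonneg t by auto
    have "(\<integral>\<^sup>+w'. ennreal (g (G (T t w) w') + D) \<partial>M) = ennreal (LINT w'|M. g (G (T t w) w') + D)"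
      by (rule nn_integral_eq_integral) (use gi[OF l] gb in auto)
    also have "(LINT w'|M. g (G (T t w) w') + D) = k (T t w) + D"
      using gi[OF l] kl[OF l] by (simp add: prob_space)
    finally show "(\<integral>\<^sup>+w'. ennreal (g (G (T t w) w') + D) \<partial>M) = ennreal (k (T t w) + D)" .
  qed
  also have "\<dots> = ennreal (LINT w|M. k (T t w) + D)"
  proof (rule nn_integral_eq_integral)
    show "integrable M (\<lambda>w. k (T t w) + D)" using ik by simp
    show "AE w in M. 0 \<le> k (T t w) + D" using kn by simp
  qed
  finally have "(LINT w|M. g (G (T t w) w) + D) = (LINT w|M. k (T t w) + D)"
  proof (rule ennreal_inj[THEN iffD1, rotated 2])
    show "0 \<le> (LINT w|M. g (G (T t w) w) + D)" using gb by (intro integral_nonneg_AE) auto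
    show "0 \<le> (LINT w|M. k (T t w) + D)"
      using kn by (rule integral_nonneg_AE)
  qed
  then have "(LINT w|M. g (G (T t w) w)) = (LINT w|M. k (T t w))"
    using ig ik by simp
  moreover have "(LINT z|lborel. f z t * g z) = (LINT w|M. g (G (T t w) w))"
    by (rule distributed_integral[OF f_dist[OF t]]) (use f_nonneg[OF t] in auto)
  moreover have "(LINT z|lborel. f z t * g z) = (LINT z:{0<..}|lborel. h z * f z t)"
    unfolding set_lebesgue_integral_def
    by (intro Bochner_Integration.integral_cong refl) (auto simp: g_def)
  ultimately show "(LINT z:{0<..}|lborel. h z * f z t) = (LINT w|M. k (T t w))" by simp
qed

lemma AE_GT_pos:
  assumes t: "0 < t"
  shows "AE w in M. 0 < G (T t w) w"
proof -
  have m[measurable]: "(\<lambda>w. G (T t w) w) \<in> borel_measurable M" using t by (simp add: GT_measurable)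
  have "emeasure M ((\<lambda>w. G (T t w) w) -` {0} \<inter> space M) = (\<integral>\<^sup>+z. ennreal (f z t) * indicator {0} z \<partial>lborel)"
    by (rule distributed_emeasure[OF f_dist[OF t]]) simp
  also have "\<dots> = 0"
    using f_measurable[OF t]
    by (subst nn_integral_0_iff_AE) (auto intro!: AE_I'[of "{0}"] simp: indicator_def)
  finally have "AE w in M. G (T t w) w \<noteq> 0"
    by (intro AE_I[of _ _ "(\<lambda>w. G (T t w) w) -` {0} \<inter> space M"]) auto
  then show ?thesis
  proof (rule AE_mp, intro AE_I2 impI)
    fix w assume "w \<in> space M" "G (T t w) w \<noteq> 0"
    then show "0 < G (T t w) w" using G_nonneg[of w "T t w"] T_nonneg[of t w] t by auto
  qed
qed

lemma integrable_brownian_f: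
  assumes t: "0 < t" and x: "x \<noteq> 0"
  shows "set_integrable lborel {0<..} (\<lambda>z. brownian_density x z * f z t)"
  by (rule set_integrable_bounded_mult[OF f_integrable[OF t], of _ "1 / \<bar>x\<bar>"])
     (use x in \<open>auto intro: brownian_density_le\<close>)

text \<open>Given the gamma time \<open>z > 0\<close> the Brownian value has density \<open>brownian_density \<cdot> z\<close>, and Tonelli's theorem turns the mixture of the densities into a density. The point \<open>x = 0\<close>, where the integral may be infinite, is a null set.\<close>

lemma distributed_BGT:
  assumes t: "0 < t"
  shows "distributed M lborel (\<lambda>w. B (G (T t w) w) w) (\<lambda>x. ennreal (subordinated_density f x t))"
  unfolding distributed_def
proof (intro conjI)
  have Bm[measurable]: "(\<lambda>w. B (G (T t w) w) w) \<in> borel_measurable M" using t by (simp add: BGT_measurable)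
  then show "(\<lambda>w. B (G (T t w) w) w) \<in> M \<rightarrow>\<^sub>M lborel" by simp
  note fm[measurable] = f_measurable[OF t]
  have [measurable]: "(\<lambda>(x, z). brownian_density x z) \<in> borel_measurable (borel \<Otimes>\<^sub>M borel)"
    using brownian_density_measurable(1) by (simp add: split_beta' borel_prod)
  have jm: "(\<lambda>(x, z). indicator {0<..} z *\<^sub>R (brownian_density x z * f z t)) \<in> borel_measurable (borel \<Otimes>\<^sub>M lborel)"
    by measurable
  have "(\<lambda>x. subordinated_density f x t) \<in> borel_measurable borel"
    unfolding subordinated_density_def set_lebesgue_integral_def
    by (rule lborel.borel_measurable_lebesgue_integral) (rule jm)
  then show sm: "(\<lambda>x. ennreal (subordinated_density f x t)) \<in> borel_measurable lborel" by simp
  show "distr M lborel (\<lambda>w. B (G (T t w) w) w) = density lborel (\<lambda>x. ennreal (subordinated_density f x t))"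
  proof (rule measure_eqI)
    fix C assume "C \<in> sets (distr M lborel (\<lambda>w. B (G (T t w) w) w))"
    then have C[measurable]: "C \<in> sets borel" by simp
    define q where "q z = (if 0 < z then \<integral>\<^sup>+x. ennreal (brownian_density x z) * indicator C x \<partial>lborel else 0)" for z
    have qm[measurable]: "q \<in> borel_measurable borel"
    proof -
      have "(\<lambda>(z, x). ennreal (brownian_density x z) * indicator C x) \<in> borel_measurable (borel \<Otimes>\<^sub>M lborel)"
        using measurable_compose[OF measurable_Pair[OF measurable_snd measurable_fst] brownian_density_measurable(1)[unfolded borel_prod[symmetric]]]
        by (simp add: split_beta')
      from lborel.borel_measurable_nn_integral[OF this] show ?thesis
        unfolding q_def by simp
    qed
    have "emeasure (distr M lborel (\<lambda>w. B (G (T t w) w) w)) C = (\<integral>\<^sup>+w. indicator C (B (G (T t w) w) w) \<partial>M)"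
      by (subst nn_integral_indicator[symmetric], simp, subst nn_integral_distr) auto
    also have "\<dots> = (\<integral>\<^sup>+w. (\<integral>\<^sup>+w'. indicator C (B (G (T t w) w) w') \<partial>M) \<partial>M)"
      using t by (intro nn_integral_BGT) auto
    also have "\<dots> = (\<integral>\<^sup>+w. q (G (T t w) w) \<partial>M)"
    proof (rule nn_integral_cong_AE, rule AE_mp[OF AE_GT_pos[OF t]], intro AE_I2 impI)
      fix w assume pos: "0 < G (T t w) w"
      have "(\<integral>\<^sup>+w'. indicator C (B (G (T t w) w) w') \<partial>M)
        = (\<integral>\<^sup>+x. ennreal (brownian_density x (G (T t w) w)) * indicator C x \<partial>lborel)"
        by (rule distributed_nn_integral[OF B_dist[OF pos], symmetric]) simp
      then show "(\<integral>\<^sup>+w'. indicator C (B (G (T t w) w) w') \<partial>M) = q (G (T t w) w)"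
        using pos by (simp add: q_def)
    qed
    also have "\<dots> = (\<integral>\<^sup>+z. ennreal (f z t) * q z \<partial>lborel)"
      by (rule distributed_nn_integral[OF f_dist[OF t], symmetric]) simp
    also have "\<dots> = (\<integral>\<^sup>+z. (\<integral>\<^sup>+x. indicator {0<..} z * (ennreal (brownian_density x z * f z t) * indicator C x) \<partial>lborel) \<partial>lborel)"
    proof (rule nn_integral_cong)
      fix z
      show "ennreal (f z t) * q z = (\<integral>\<^sup>+x. indicator {0<..} z * (ennreal (brownian_density x z * f z t) * indicator C x) \<partial>lborel)"
        using f_nonneg[OF t, of z]
        by (auto simp: q_def nn_integral_cmult[symmetric] ennreal_mult'' mult_ac intro!: nn_integral_cong)
    qed
    also have "\<dots> = (\<integral>\<^sup>+x. (\<integral>\<^sup>+z. indicator {0<..} z * (ennreal (brownian_density x z * f z t) * indicator C x) \<partial>lborel) \<partial>lborel)"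
    proof (rule lborel_pair.Fubini')
      show "(\<lambda>(x, z). indicator {0<..} z * (ennreal (brownian_density x z * f z t) * indicator C x)) \<in> borel_measurable (lborel \<Otimes>\<^sub>M lborel)"
        by measurable
    qed
    also have "\<dots> = (\<integral>\<^sup>+x. ennreal (subordinated_density f x t) * indicator C x \<partial>lborel)"
    proof (rule nn_integral_cong_AE)
      have "AE x in lborel. x \<noteq> (0::real)" by (rule AE_lborel_singleton)
      then show "AE x in lborel. (\<integral>\<^sup>+z. indicator {0<..} z * (ennreal (brownian_density x z * f z t) * indicator C x) \<partial>lborel)
         = ennreal (subordinated_density f x t) * indicator C x"
      proof (rule AE_mp, intro AE_I2 impI)
        fix x :: real assume x: "x \<noteq> 0"
        have "(\<integral>\<^sup>+z. indicator {0<..} z * (ennreal (brownian_density x z * f z t) * indicator C x) \<partial>lborel)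
          = (\<integral>\<^sup>+z. ennreal (indicator {0<..} z *\<^sub>R (brownian_density x z * f z t)) * indicator C x \<partial>lborel)"
          by (intro nn_integral_cong) (auto simp: indicator_def)
        also have "\<dots> = (\<integral>\<^sup>+z. ennreal (indicator {0<..} z *\<^sub>R (brownian_density x z * f z t)) \<partial>lborel) * indicator C x"
          by (rule nn_integral_multc) measurable
        also have "(\<integral>\<^sup>+z. ennreal (indicator {0<..} z *\<^sub>R (brownian_density x z * f z t)) \<partial>lborel) = ennreal (subordinated_density f x t)"
          unfolding subordinated_density_def set_lebesgue_integral_def
          by (rule nn_integral_eq_integral)
             (use integrable_brownian_f[OF t x] f_nonneg[OF t] in \<open>auto simp: set_integrable_def\<close>)
        finally show "(\<integral>\<^sup>+z. indicator {0<..} z * (ennreal (brownian_density x z * f z t) * indicator C x) \<partial>lborel)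
          = ennreal (subordinated_density f x t) * indicator C x" .
      qed
    qed
    also have "\<dots> = emeasure (density lborel (\<lambda>x. ennreal (subordinated_density f x t))) C"
      using sm by (simp add: emeasure_density)
    finally show "emeasure (distr M lborel (\<lambda>w. B (G (T t w) w) w)) C = emeasure (density lborel (\<lambda>x. ennreal (subordinated_density f x t))) C" .
  qed simp
qed

lemma subordinated_density_eq:
  assumes t: "0 < t" and x: "x \<noteq> 0"
  shows "integrable M (\<lambda>w. vg_kernel x 0 (T t w))"
    and "subordinated_density f x t = (LINT w|M. vg_kernel x 0 (T t w))"
proof -
  note m = vg_kernel_measurable[OF x, of 0]
  have b: "\<bar>brownian_density x z\<bar> \<le> 1 / \<bar>x\<bar>" if "0 < z" for z
    using brownian_density_le[OF that x] by simp
  note * = mixture[OF t brownian_density_measurable(2) b vg_kernel_gamma_mean vg_kernel_zeros(1) m]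
  show "integrable M (\<lambda>w. vg_kernel x 0 (T t w))" by (rule *(1))
  show "subordinated_density f x t = (LINT w|M. vg_kernel x 0 (T t w))"
    unfolding subordinated_density_def by (rule *(2))
qed

text \<open>The sum is the mean of \<open>vg_kernel x 0 (T t - 1)\<close>: the bounds on the derivatives give a geometric majorant that does not depend on the clock, so the shift formula may be averaged term by term.\<close>

lemma vg_kernel_series:
  assumes t: "0 < t" and x: "x \<noteq> 0"
  shows "twice_differentiable_at (\<lambda>y. subordinated_density f y t) x"
    and "(\<lambda>n. (- 1) ^ n / fact n * (LINT w|M. vg_kernel x n (T t w))) sums
      (subordinated_density f x t - 1 / 2 * deriv (deriv (\<lambda>y. subordinated_density f y t)) x)"
    and "integrable M (\<lambda>w. vg_kernel x n (T t w))"
proof -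
  note m[measurable] = vg_kernel_measurable[OF x]
  have [measurable]: "T t \<in> borel_measurable M" using t by (simp add: T_measurable)
  obtain C where C: "\<And>n l. 0 \<le> l \<Longrightarrow> \<bar>vg_kernel x n l\<bar> \<le> fact n * C / 2 ^ n"
    using vg_kernel_bounds[OF x] by blast
  show td: "twice_differentiable_at (\<lambda>y. subordinated_density f y t) x"
    unfolding subordinated_density_def by (rule twice_differentiable_subordinated(1)[OF f_integrable[OF t] x])
  show i: "integrable M (\<lambda>w. vg_kernel x n (T t w))" for n
    by (rule integrable_const_bound[of _ "fact n * C / 2 ^ n"]) (use C T_nonneg t in auto)
  define b where "b n w = (- 1) ^ n / fact n * vg_kernel x n (T t w)" for n w
  have bC: "norm (b n w) \<le> C * (1 / 2) ^ n" if "w \<in> space M" for n w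
  proof -
    have "norm (b n w) = \<bar>vg_kernel x n (T t w)\<bar> / fact n"
      by (simp add: b_def abs_mult power_abs)
    also have "\<dots> \<le> (fact n * C / 2 ^ n) / fact n"
      using C[of "T t w" n] T_nonneg[of t w] that t by (intro divide_right_mono) auto
    also have "\<dots> = C * (1 / 2) ^ n" by (simp add: power_divide)
    finally show ?thesis .
  qed
  have g: "summable (\<lambda>n. C * (1 / 2) ^ n)" by (intro summable_mult summable_geometric) simp
  have ib: "integrable M (b n)" for n
    unfolding b_def by (intro integrable_mult_right i)
  have "(\<lambda>n. integral\<^sup>L M (b n)) sums (LINT w|M. (\<Sum>n. b n w))"
  proof (rule sums_integral[OF ib])
    show "AE w in M. summable (\<lambda>n. norm (b n w))"
      using bC by (intro AE_I2 summable_comparison_test[OF _ g]) auto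
    show "summable (\<lambda>n. LINT w|M. norm (b n w))"
    proof (rule summable_comparison_test[OF _ g], intro exI allI impI)
      fix n
      have "(LINT w|M. norm (b n w)) \<le> (LINT w|M. C * (1 / 2) ^ n)"
        using ib bC by (intro integral_mono) auto
      moreover have "0 \<le> (LINT w|M. norm (b n w))" by simp
      ultimately show "norm (LINT w|M. norm (b n w)) \<le> C * (1 / 2) ^ n"
        by (simp add: prob_space)
    qed
  qed
  also have "(LINT w|M. (\<Sum>n. b n w)) = (LINT w|M. vg_kernel x 0 (T t w - 1))"
    using sums_unique[OF vg_kernel_shift[OF x]] by (simp add: b_def)
  finally have s: "(\<lambda>n. integral\<^sup>L M (b n)) sums (LINT w|M. vg_kernel x 0 (T t w - 1))" .
  have kb: "\<bar>brownian_density_xx x z / 2\<bar> \<le> (x\<^sup>2 * (5 / x\<^sup>2) powr (5 / 2) + (3 / x\<^sup>2) powr (3 / 2)) / 2"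
    if "0 < z" for z
    using brownian_density_xx_le[OF that x, of x] by simp
  have km: "(\<lambda>l. vg_kernel x 0 l - vg_kernel x 0 (l - 1)) \<in> borel_measurable borel" by measurable
  have z: "vg_kernel x 0 0 - vg_kernel x 0 (0 - 1) = 0" using vg_kernel_zeros[of x] by simp
  have xm: "(\<lambda>z. brownian_density_xx x z / 2) \<in> borel_measurable borel" by measurable
  note * = mixture[OF t xm kb vg_kernel_gamma_mean_xx[OF _ x] z km]
  have "deriv (deriv (\<lambda>y. subordinated_density f y t)) x = (LINT z:{0<..}|lborel. brownian_density_xx x z * f z t)"
    unfolding subordinated_density_def by (rule twice_differentiable_subordinated(2)[OF f_integrable[OF t] x])
  then have "1 / 2 * deriv (deriv (\<lambda>y. subordinated_density f y t)) x
      = (LINT z:{0<..}|lborel. 1 / 2 * (brownian_density_xx x z * f z t))"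
    by (simp only: set_integral_mult_right)
  also have "\<dots> = (LINT z:{0<..}|lborel. brownian_density_xx x z / 2 * f z t)" by simp
  also have "\<dots> = (LINT w|M. vg_kernel x 0 (T t w) - vg_kernel x 0 (T t w - 1))" by (rule *(2))
  finally have d: "1 / 2 * deriv (deriv (\<lambda>y. subordinated_density f y t)) x
    = (LINT w|M. vg_kernel x 0 (T t w) - vg_kernel x 0 (T t w - 1))" .
  have "integrable M (\<lambda>w. vg_kernel x 0 (T t w) - (vg_kernel x 0 (T t w) - vg_kernel x 0 (T t w - 1)))"
    by (intro Bochner_Integration.integrable_diff i *(1))
  then have "integrable M (\<lambda>w. vg_kernel x 0 (T t w - 1))" by simp
  then have "(LINT w|M. vg_kernel x 0 (T t w - 1)) = subordinated_density f x t - 1 / 2 * deriv (deriv (\<lambda>y. subordinated_density f y t)) x"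
    unfolding d subordinated_density_eq(2)[OF t x] using i[of 0] by simp
  moreover have "integral\<^sup>L M (b n) = (- 1) ^ n / fact n * (LINT w|M. vg_kernel x n (T t w))" for n
    unfolding b_def by (rule integral_mult_right_zero)
  ultimately show "(\<lambda>n. (- 1) ^ n / fact n * (LINT w|M. vg_kernel x n (T t w))) sums
      (subordinated_density f x t - 1 / 2 * deriv (deriv (\<lambda>y. subordinated_density f y t)) x)"
    using s by simp
qed

lemma vanishes_at_infinity_density:
  assumes t: "0 < t"
  shows "vanishes_at_infinity (\<lambda>x. subordinated_density f x t)"
  unfolding subordinated_density_def
  by (rule vanishes_at_infinity_subordinated[OF f_integrable[OF t] f_nonneg[OF t]])

text \<open>For \<open>l \<le> 1 / 2\<close> the integrand is at least \<open>c / z\<close> on the unit interval, whose integral from \<open>exp (- N)\<close> to one is \<open>c N\<close>.\<close>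

lemma gamma_inverse_sqrt_moment_infinite:
  assumes l: "0 < l" "l \<le> 1 / 2"
  shows "(\<integral>\<^sup>+z. ennreal (gamma_density z l) * (indicator {0<..} z * ennreal (brownian_density 0 z)) \<partial>lborel) = \<top>"
    (is "?I = _")
proof (rule ccontr)
  assume "?I \<noteq> \<top>"
  then obtain r where r: "?I = ennreal r" "0 \<le> r" by (cases ?I) auto
  define c where "c = exp (- 1) / Gamma l * (2 * pi) powr (- 1 / 2)"
  have c: "0 < c" using l by (auto simp: c_def intro!: mult_pos_pos divide_pos_pos Gamma_real_pos)
  define N where "N = r / c + 1"
  have N: "0 < N" "r < c * N" using c r by (auto simp: N_def field_simps add_pos_nonneg)
  define a where "a = exp (- N)"
  have a: "0 < a" "a < 1" using N by (auto simp: a_def)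
  have pw: "c / z \<le> gamma_density z l * brownian_density 0 z" if z: "a \<le> z" "z \<le> 1" for z
  proof -
    have z0: "0 < z" using z a by simp
    have "1 / z = z powr (- 1 / 2) * z powr (- 1 / 2)"
      using z0 by (simp add: powr_add[symmetric] powr_minus_divide)
    also have "\<dots> \<le> z powr (l - 1) * z powr (- 1 / 2)"
      using l z0 z by (intro mult_right_mono powr_mono') auto
    finally have "c * (1 / z) \<le> c * (z powr (l - 1) * z powr (- 1 / 2))"
      using c by (intro mult_left_mono) auto
    also have "\<dots> = exp (- 1) * (z powr (l - 1) / Gamma l * ((2 * pi) powr (- 1 / 2) * z powr (- 1 / 2)))"
      by (simp add: c_def)
    also have "\<dots> \<le> exp (- z) * (z powr (l - 1) / Gamma l * ((2 * pi) powr (- 1 / 2) * z powr (- 1 / 2)))"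
      using z l by (intro mult_right_mono) (auto intro!: divide_nonneg_nonneg mult_nonneg_nonneg Gamma_real_nonneg)
    also have "\<dots> = gamma_density z l * brownian_density 0 z"
      using z0 by (simp add: gamma_density_def brownian_density_def powr_mult)
    finally show ?thesis by simp
  qed
  have "(\<integral>\<^sup>+z. ennreal (c / z) * indicator {a..1} z \<partial>lborel) = ennreal (c * ln 1 - c * ln a)"
  proof (rule nn_integral_FTC_Icc)
    fix z :: real assume z: "z \<in> {a..1}"
    then show "((\<lambda>z. c * ln z) has_real_derivative c / z) (at z)"
      using a by (auto intro!: derivative_eq_intros)
    show "0 \<le> c / z" using z a c by auto
  qed (use a in auto)
  also have "c * ln 1 - c * ln a = c * N" by (simp add: a_def)
  finally have "ennreal (c * N) = (\<integral>\<^sup>+z. ennreal (c / z) * indicator {a..1} z \<partial>lborel)" by simp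
  also have "\<dots> \<le> ?I"
  proof (rule nn_integral_mono)
    fix z
    show "ennreal (c / z) * indicator {a..1} z \<le> ennreal (gamma_density z l) * (indicator {0<..} z * ennreal (brownian_density 0 z))"
    proof (cases "z \<in> {a..1}")
      case True
      then have "0 < z" using a by auto
      moreover have "0 \<le> gamma_density z l"
        using l by (auto simp: gamma_density_def intro!: divide_nonneg_nonneg Gamma_real_nonneg)
      ultimately show ?thesis
        using True pw[of z] by (simp add: ennreal_mult'[symmetric] ennreal_leI)
    qed simp
  qed
  finally show False using r N c by (simp add: ennreal_le_iff)
qed

lemma not_finite_at_0:
  assumes t: "0 < t" and p: "emeasure M {w \<in> space M. 0 < T t w \<and> T t w \<le> 1 / 2} \<noteq> 0"
  shows "\<not> subordinated_density_finite f 0 t"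
proof
  assume "subordinated_density_finite f 0 t"
  then have i: "integrable lborel (\<lambda>z. indicator {0<..} z *\<^sub>R (brownian_density 0 z * f z t))"
    by (simp add: subordinated_density_finite_def set_integrable_def)
  have [measurable]: "T t \<in> borel_measurable M" using t by (simp add: T_measurable)
  let ?h = "\<lambda>z. indicator {0<..} z * ennreal (brownian_density 0 z)"
  let ?E = "{w \<in> space M. 0 < T t w \<and> T t w \<le> 1 / 2}"
  have "(\<integral>\<^sup>+z. ennreal (f z t) * ?h z \<partial>lborel) = (\<integral>\<^sup>+z. ennreal (indicator {0<..} z *\<^sub>R (brownian_density 0 z * f z t)) \<partial>lborel)"
    using f_nonneg[OF t] by (intro nn_integral_cong) (auto simp: indicator_def ennreal_mult'' mult.commute)
  also have "\<dots> < \<top>"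
    by (subst nn_integral_eq_integral[OF i]) (use f_nonneg[OF t] in auto)
  finally have fin: "(\<integral>\<^sup>+z. ennreal (f z t) * ?h z \<partial>lborel) < \<top>" .
  have "\<top> = \<top> * emeasure M ?E" using p by (simp add: ennreal_top_mult)
  also have "\<dots> = (\<integral>\<^sup>+w. \<top> * indicator ?E w \<partial>M)"
    by (rule nn_integral_cmult_indicator[symmetric]) measurable
  also have "\<dots> \<le> (\<integral>\<^sup>+w. (\<integral>\<^sup>+w'. ?h (G (T t w) w') \<partial>M) \<partial>M)"
  proof (rule nn_integral_mono)
    fix w assume "w \<in> space M"
    show "\<top> * indicator ?E w \<le> (\<integral>\<^sup>+w'. ?h (G (T t w) w') \<partial>M)"
    proof (cases "w \<in> ?E")
      case True
      then have l: "0 < T t w" "T t w \<le> 1 / 2" by auto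
      have "(\<integral>\<^sup>+w'. ?h (G (T t w) w') \<partial>M) = (\<integral>\<^sup>+z. ennreal (gamma_density z (T t w)) * ?h z \<partial>lborel)"
        by (rule distributed_nn_integral[OF G_dist[OF l(1)], symmetric]) simp
      also have "\<dots> = \<top>" by (rule gamma_inverse_sqrt_moment_infinite[OF l])
      finally show ?thesis by simp
    qed simp
  qed
  also have "\<dots> = (\<integral>\<^sup>+w. ?h (G (T t w) w) \<partial>M)"
    using t by (intro nn_integral_GT[symmetric]) auto
  also have "\<dots> = (\<integral>\<^sup>+z. ennreal (f z t) * ?h z \<partial>lborel)"
    by (rule distributed_nn_integral[OF f_dist[OF t], symmetric]) simp
  finally show False using fin by simp
qed

end

section \<open>Stable subordinators and their inverses\<close>

text \<open>Only the part of the Gamma integral over \<open>{R..R + 1}\<close> is used.\<close>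

lemma Gamma_lower_bound:
  assumes R: "0 < R" and y: "0 \<le> (y::real)"
  shows "R powr y * exp (- (R + 1)) \<le> Gamma (y + 1)"
proof -
  have "R powr y * exp (- (R + 1)) = (LINT z:{R..R+1}|lborel. R powr y * exp (- (R + 1)))"
    by (simp add: set_lebesgue_integral_def)
  also have "\<dots> \<le> (LINT z:{0<..}|lborel. z powr (y + 1 - 1) * exp (- (1 * z)))"
    unfolding set_lebesgue_integral_def
  proof (rule integral_mono)
    show "integrable lborel (\<lambda>z. indicator {0<..} z *\<^sub>R (z powr (y + 1 - 1) * exp (- (1 * z))))"
      using set_integrable_powr_exp[of "y + 1" 1] y by (simp add: set_integrable_def)
    fix z
    show "indicator {R..R+1} z *\<^sub>R (R powr y * exp (- (R + 1)))
        \<le> indicator {0<..} z *\<^sub>R (z powr (y + 1 - 1) * exp (- (1 * z)))"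
    proof (cases "z \<in> {R..R+1}")
      case True
      then have "R powr y * exp (- (R + 1)) \<le> z powr y * exp (- z)"
        using R y by (intro mult_mono powr_mono2) auto
      then show ?thesis using True R by simp
    qed (auto simp: indicator_def)
  qed simp
  also have "\<dots> = Gamma (y + 1)"
    using LINT_powr_exp[of "y + 1" 1] y by simp
  finally show ?thesis .
qed

text \<open>Taking \<open>R^\<nu> = 2 x + 1\<close> in the lower bound for the Gamma function leaves a geometric series with ratio below \<open>1 / 2\<close>.\<close>

lemma summable_mittag_leffler:
  assumes "0 < \<nu>" "0 \<le> x"
  shows "summable (\<lambda>n. x ^ n / Gamma (\<nu> * real n + 1))"
proof -
  define R where "R = (2 * x + 1) powr (1 / \<nu>)"
  have R: "0 < R" "R powr \<nu> = 2 * x + 1" using assms by (simp_all add: R_def powr_powr)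
  have g: "summable (\<lambda>n. exp (R + 1) * (x / (2 * x + 1)) ^ n)"
    using assms by (intro summable_mult summable_geometric) (simp add: divide_less_eq)
  show ?thesis
  proof (rule summable_comparison_test[OF _ g], intro exI allI impI)
    fix n
    have Rn: "R powr (\<nu> * real n) = (2 * x + 1) ^ n"
      using R assms by (simp add: powr_powr[symmetric] powr_realpow)
    have lb: "(2 * x + 1) ^ n * exp (- (R + 1)) \<le> Gamma (\<nu> * real n + 1)"
      using Gamma_lower_bound[OF R(1), of "\<nu> * real n"] assms by (simp add: Rn)
    have pos: "0 < (2 * x + 1) ^ n * exp (- (R + 1))" using assms by simp
    have Gp: "0 < Gamma (\<nu> * real n + 1)" by (rule less_le_trans[OF pos lb])
    then have "norm (x ^ n / Gamma (\<nu> * real n + 1)) = x ^ n / Gamma (\<nu> * real n + 1)"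
      using assms by simp
    also have "\<dots> \<le> x ^ n / ((2 * x + 1) ^ n * exp (- (R + 1)))"
      using assms by (intro divide_left_mono mult_pos_pos lb pos Gp) auto
    also have "\<dots> = exp (R + 1) * (x / (2 * x + 1)) ^ n"
      unfolding exp_minus power_divide by (simp add: field_simps)
    finally show "norm (x ^ n / Gamma (\<nu> * real n + 1)) \<le> exp (R + 1) * (x / (2 * x + 1)) ^ n" .
  qed
qed

lemma has_bochner_integral_beta:
  fixes a b t :: real
  assumes a: "0 < a" and b: "0 < b" and t: "0 < t"
  shows "has_bochner_integral lborel (\<lambda>s. indicator {0<..<t} s *\<^sub>R ((t - s) powr (b - 1) * s powr (a - 1)))
     (t powr (a + b - 1) * Beta a b)"
proof -
  let ?f = "\<lambda>y::real. indicator {0..1} y *\<^sub>R (y powr (a - 1) * (1 - y) powr (b - 1))"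
  have i: "set_integrable lborel {0..1} (\<lambda>y. y powr (a - 1) * (1 - y) powr (b - 1))"
    by (rule integrable_Beta[OF a b])
  have "(LINT y:{0..1}|lborel. y powr (a - 1) * (1 - y) powr (b - 1)) = Beta a b"
    using set_borel_integral_eq_integral(2)[OF i] has_integral_Beta_real[OF a b]
    by (simp add: integral_unique)
  then have "has_bochner_integral lborel ?f (Beta a b)"
    using i by (simp add: has_bochner_integral_iff set_integrable_def set_lebesgue_integral_def)
  then have "has_bochner_integral lborel (\<lambda>s. ?f (0 + 1 / t * s)) (Beta a b /\<^sub>R \<bar>1 / t\<bar>)"
    using t lborel_has_bochner_integral_real_affine_iff[of "1 / t" ?f "Beta a b" 0] by simp
  then have "has_bochner_integral lborel (\<lambda>s. t powr (a + b - 2) * ?f (0 + 1 / t * s))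
     (t powr (a + b - 2) * (Beta a b /\<^sub>R \<bar>1 / t\<bar>))"
    by (rule has_bochner_integral_mult_right)
  moreover have "t powr (a + b - 2) * ?f (0 + 1 / t * s)
     = indicator {0<..<t} s *\<^sub>R ((t - s) powr (b - 1) * s powr (a - 1))" for s
  proof (cases "0 < s \<and> s < t")
    case True
    have e: "1 - s / t = (t - s) / t" using t by (simp add: field_simps)
    have "t powr (a + b - 2) = t powr (a - 1) * t powr (b - 1)"
      by (simp add: powr_add[symmetric])
    then show ?thesis using True t
      by (simp add: e powr_divide indicator_def)
  next
    case False
    then have "s < 0 \<or> s = 0 \<or> s = t \<or> t < s" by auto
    then show ?thesis using t by (auto simp: indicator_def divide_le_eq zero_le_divide_iff)
  qed
  moreover have "t powr (a + b - 2) * (Beta a b /\<^sub>R \<bar>1 / t\<bar>) = t powr (a + b - 1) * Beta a b"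
  proof -
    have "t powr (a + b - 1) = t powr (a + b - 2) * t"
      using t powr_add[of t "a + b - 2" 1] by simp
    then show ?thesis using t by simp
  qed
  ultimately show ?thesis by (simp only:)
qed

locale stable_process = prob_space M for M :: "'w measure" +
  fixes \<alpha> :: real and A :: "real \<Rightarrow> 'w \<Rightarrow> real"
  assumes \<alpha>: "0 < \<alpha>" "\<alpha> < 1" and stable: "stable_subordinator M \<alpha> A"
begin

lemma
  shows A_measurable: "0 \<le> s \<Longrightarrow> A s \<in> borel_measurable M"
    and A_mono: "w \<in> space M \<Longrightarrow> 0 \<le> s \<Longrightarrow> s \<le> r \<Longrightarrow> A s w \<le> A r w"
    and A_nonneg: "w \<in> space M \<Longrightarrow> 0 \<le> s \<Longrightarrow> 0 \<le> A s w"
    and A_laplace: "0 \<le> s \<Longrightarrow> 0 < k \<Longrightarrow> (LINT w|M. exp (- k * A s w)) = exp (- (k powr \<alpha>) * s)"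
proof -
  have S: "subordinator M A" using stable by (simp add: stable_subordinator_def)
  show "0 \<le> s \<Longrightarrow> A s \<in> borel_measurable M" using S by (simp add: subordinator_def)
  have 0: "w \<in> space M \<Longrightarrow> A 0 w = 0" using S by (simp add: subordinator_def)
  show m: "A s w \<le> A r w" if "w \<in> space M" "0 \<le> s" "s \<le> r" for s r
    using S that unfolding subordinator_def by (auto intro: mono_onD[of "{0..}"])
  show "w \<in> space M \<Longrightarrow> 0 \<le> s \<Longrightarrow> 0 \<le> A s w" using m[of 0 s] 0 by simp
  show "0 \<le> s \<Longrightarrow> 0 < k \<Longrightarrow> (LINT w|M. exp (- k * A s w)) = exp (- (k powr \<alpha>) * s)"
    using stable unfolding stable_subordinator_def by blast
qed

lemma exp_A_integrable:
  assumes "0 \<le> s" "0 \<le> k"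
  shows "integrable M (\<lambda>w. exp (- k * A s w))"
proof (rule integrable_const_bound[of _ 1])
  show "AE w in M. norm (exp (- k * A s w)) \<le> 1"
    using A_nonneg assms by (intro AE_I2) auto
  show "(\<lambda>w. exp (- k * A s w)) \<in> borel_measurable M"
    using A_measurable[OF assms(1)] by measurable
qed

lemma prob_A_le:
  assumes "0 \<le> s" "0 < k"
  shows "measure M {w \<in> space M. A s w \<le> c} \<le> exp (k * c - k powr \<alpha> * s)"
proof -
  have [measurable]: "A s \<in> borel_measurable M" by (rule A_measurable[OF assms(1)])
  have "measure M {w \<in> space M. A s w \<le> c} = (LINT w|M. indicator {w \<in> space M. A s w \<le> c} w)"
    by simp
  also have "\<dots> \<le> (LINT w|M. exp (k * c) * exp (- k * A s w))"
  proof (rule integral_mono)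
    show "integrable M (\<lambda>w. exp (k * c) * exp (- k * A s w))"
      using exp_A_integrable assms by (intro integrable_mult_right) auto
    show "integrable M (indicat_real {w \<in> space M. A s w \<le> c})"
      by (rule integrable_real_indicator) (auto simp: emeasure_eq_measure)
    fix w
    show "indicat_real {w \<in> space M. A s w \<le> c} w \<le> exp (k * c) * exp (- k * A s w)"
    proof (cases "A s w \<le> c")
      case True
      then have "k * A s w \<le> k * c" using assms by (intro mult_left_mono) auto
      then show ?thesis by (auto simp: exp_add[symmetric] indicator_def)
    qed simp
  qed
  also have "\<dots> = exp (k * c - k powr \<alpha> * s)"
    using A_laplace[OF assms] by (simp add: exp_diff exp_minus divide_inverse)
  finally show ?thesis .
qed

lemma prob_eq_0I:
  assumes "\<And>n::nat. measure M E \<le> exp (C - real n)"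
  shows "measure M E = 0"
proof -
  have "(\<lambda>n. exp (C - real n)) \<longlonglongrightarrow> 0" by real_asymp
  then have "measure M E \<le> 0"
    by (rule tendsto_lowerbound) (use assms in auto)
  then show ?thesis using measure_nonneg[of M E] by linarith
qed

lemma AE_A_pos:
  assumes s: "0 < s"
  shows "AE w in M. 0 < A s w"
proof -
  have [measurable]: "A s \<in> borel_measurable M" using s by (simp add: A_measurable)
  have "measure M {w \<in> space M. A s w \<le> 0} = 0"
  proof (rule prob_eq_0I[where C = 0])
    fix n :: nat
    define k where "k = ((real n + 1) / s) powr (1 / \<alpha>)"
    have "0 < k" "k powr \<alpha> = (real n + 1) / s" using s \<alpha> by (auto simp: k_def powr_powr)
    with prob_A_le[of s k 0] s
    have "measure M {w \<in> space M. A s w \<le> 0} \<le> exp (- (real n + 1))" by simp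
    also have "\<dots> \<le> exp (0 - real n)" by simp
    finally show "measure M {w \<in> space M. A s w \<le> 0} \<le> exp (0 - real n)" .
  qed
  then have "AE w in M. \<not> A s w \<le> 0"
    by (intro AE_I[of _ _ "{w \<in> space M. A s w \<le> 0}"]) (auto simp: emeasure_eq_measure)
  then show ?thesis by (auto elim: eventually_mono)
qed

lemma AE_A_unbounded: "AE w in M. \<exists>n::nat. t < A (real n) w"
proof -
  have [measurable]: "A (real n) \<in> borel_measurable M" for n by (simp add: A_measurable)
  have "measure M {w \<in> space M. \<forall>n::nat. A (real n) w \<le> t} = 0"
  proof (rule prob_eq_0I[where C = t])
    fix n :: nat
    have "measure M {w \<in> space M. \<forall>n::nat. A (real n) w \<le> t} \<le> measure M {w \<in> space M. A (real n) w \<le> t}"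
      by (intro finite_measure_mono) auto
    also have "\<dots> \<le> exp (t - real n)" using prob_A_le[of "real n" 1 t] by simp
    finally show "measure M {w \<in> space M. \<forall>n::nat. A (real n) w \<le> t} \<le> exp (t - real n)" .
  qed
  then have "AE w in M. \<not> (\<forall>n::nat. A (real n) w \<le> t)"
    by (intro AE_I[of _ _ "{w \<in> space M. \<forall>n::nat. A (real n) w \<le> t}"]) (auto simp: emeasure_eq_measure)
  then show ?thesis by (auto elim!: eventually_mono simp: not_le)
qed

text \<open>Otherwise the Laplace transform would decay at least like \<open>exp (- c k)\<close>, whereas \<open>k^\<alpha>\<close> grows more slowly than \<open>k\<close>.\<close>

lemma prob_A_small_pos:
  assumes s: "0 < s" and c: "0 < c"
  shows "\<not> (AE w in M. c < A s w)"
proof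
  assume ae: "AE w in M. c < A s w"
  define k where "k = (2 * s / c) powr (1 / (1 - \<alpha>))"
  have k: "0 < k" "k powr (1 - \<alpha>) = 2 * s / c" using s c \<alpha> by (auto simp: k_def powr_powr)
  have kk: "k = k powr \<alpha> * (2 * s / c)"
    using k by (simp add: k(2)[symmetric] powr_add[symmetric])
  have "(LINT w|M. exp (- k * A s w)) \<le> (LINT w|M. exp (- (k * c)))"
    using ae k s by (intro integral_mono_AE exp_A_integrable) (auto elim!: eventually_mono)
  then have "exp (- (k powr \<alpha>) * s) \<le> exp (- (k * c))"
    using A_laplace[of s k] k s by (simp add: prob_space)
  then have "k * c \<le> k powr \<alpha> * s" by simp
  also have "k * c = 2 * (k powr \<alpha> * s)" by (subst kk) (use c in simp)
  finally show False using s k by simp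
qed

text \<open>Otherwise the Laplace transform would be at least \<open>exp (- c k)\<close>, which fails for small \<open>k\<close>, where \<open>k^\<alpha>\<close> exceeds \<open>c k\<close>.\<close>

lemma prob_A_large_pos:
  assumes c: "0 < c"
  shows "\<not> (AE w in M. A 1 w < c)"
proof
  assume ae: "AE w in M. A 1 w < c"
  define k where "k = (1 / (2 * c)) powr (1 / (1 - \<alpha>))"
  have k: "0 < k" "k powr (1 - \<alpha>) = 1 / (2 * c)" using c \<alpha> by (auto simp: k_def powr_powr)
  have kk: "k = k powr \<alpha> * (1 / (2 * c))"
    using k by (simp add: k(2)[symmetric] powr_add[symmetric])
  have "(LINT w|M. exp (- (k * c))) \<le> (LINT w|M. exp (- k * A 1 w))"
    using ae k by (intro integral_mono_AE exp_A_integrable) (auto elim!: eventually_mono)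
  then have "exp (- (k * c)) \<le> exp (- (k powr \<alpha>))"
    using A_laplace[of 1 k] k by (simp add: prob_space)
  then have "k powr \<alpha> \<le> k * c" by simp
  also have "k * c = k powr \<alpha> / 2" by (subst kk) (use c in simp)
  finally show False using k by simp
qed

lemma A_scaling:
  assumes z: "0 < z"
  shows "distr M borel (A z) = distr M borel (\<lambda>w. z powr (1 / \<alpha>) * A 1 w)"
proof (rule laplace_determinacy)
  have [measurable]: "A z \<in> borel_measurable M" "A 1 \<in> borel_measurable M"
    using z by (auto simp: A_measurable)
  show "real_distribution (distr M borel (A z))" "real_distribution (distr M borel (\<lambda>w. z powr (1 / \<alpha>) * A 1 w))"
    by (auto intro!: real_distribution_distr)
  show "AE x in distr M borel (A z). 0 \<le> x"
    using z A_nonneg by (subst AE_distr_iff) auto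
  show "AE x in distr M borel (\<lambda>w. z powr (1 / \<alpha>) * A 1 w). 0 \<le> x"
    using A_nonneg by (subst AE_distr_iff) auto
  fix k :: real assume k: "0 < k"
  have e: "(k * z powr (1 / \<alpha>)) powr \<alpha> = k powr \<alpha> * z"
    using k z \<alpha> by (simp add: powr_mult powr_powr)
  have "(LINT x|distr M borel (\<lambda>w. z powr (1 / \<alpha>) * A 1 w). exp (- k * x)) = (LINT w|M. exp (- (k * z powr (1 / \<alpha>)) * A 1 w))"
    by (subst integral_distr) (auto simp: mult_ac)
  also have "\<dots> = exp (- (k powr \<alpha>) * z)"
    using k z by (subst A_laplace) (auto simp: e)
  finally show "(LINT x|distr M borel (A z). exp (- k * x)) = (LINT x|distr M borel (\<lambda>w. z powr (1 / \<alpha>) * A 1 w). exp (- k * x))"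
    using A_laplace[of z k] k z by (subst integral_distr) auto
qed

text \<open>The inverse process at time one has the law of this variable.\<close>

definition inv_A :: "'w \<Rightarrow> real" where
  "inv_A w = A 1 w powr (- \<alpha>)"

lemma inv_A_measurable [measurable]: "inv_A \<in> borel_measurable M"
  unfolding inv_A_def[abs_def] using A_measurable[of 1] by measurable

lemma inv_A_nonneg: "0 \<le> inv_A w"
  by (simp add: inv_A_def)

lemma inverse_process_nonneg: "0 \<le> inverse_process A t w"
  unfolding inverse_process_def by (auto intro!: cInf_greatest)

lemma inverse_process_less:
  assumes w: "w \<in> space M" and z: "0 < z" and lt: "inverse_process A t w < z"
    and ex: "\<exists>n::nat. t < A (real n) w"
  shows "t < A z w"
proof -
  obtain n :: nat where n: "t < A (real n) w" using ex by blast
  then have ne: "{z. 0 \<le> z \<and> t < A z w} \<noteq> {}" by (auto intro: exI[of _ "real n"])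
  then have "Inf {z. 0 \<le> z \<and> t < A z w} < z"
    using lt by (auto simp: inverse_process_def split: if_splits)
  from cInf_lessD[OF ne this] obtain y where "0 \<le> y" "t < A y w" "y < z" by auto
  then show ?thesis using A_mono[OF w, of y z] by simp
qed

lemma inverse_process_le:
  assumes "0 \<le> z" "t < A z w"
  shows "inverse_process A t w \<le> z"
proof -
  have "bdd_below {z. 0 \<le> z \<and> t < A z w}" by (auto intro: bdd_belowI[of _ 0])
  with assms show ?thesis
    unfolding inverse_process_def by (auto intro!: cInf_lower)
qed

lemma powr_quotient_less_iff:
  assumes "0 < y" "0 < z" "0 < t"
  shows "t powr \<alpha> * y powr (- \<alpha>) < z \<longleftrightarrow> t < z powr (1 / \<alpha>) * y"
proof -
  have "t powr \<alpha> * y powr (- \<alpha>) = (t / y) powr \<alpha>"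
    using assms by (simp add: powr_divide powr_minus_divide)
  moreover have "z = (z powr (1 / \<alpha>)) powr \<alpha>" using assms \<alpha> by (simp add: powr_powr)
  moreover have "(t / y) powr \<alpha> < (z powr (1 / \<alpha>)) powr \<alpha> \<longleftrightarrow> t / y < z powr (1 / \<alpha>)"
  proof
    assume "t / y < z powr (1 / \<alpha>)"
    then show "(t / y) powr \<alpha> < (z powr (1 / \<alpha>)) powr \<alpha>"
      using assms \<alpha> by (intro powr_less_mono2) auto
  next
    assume l: "(t / y) powr \<alpha> < (z powr (1 / \<alpha>)) powr \<alpha>"
    show "t / y < z powr (1 / \<alpha>)"
    proof (rule ccontr)
      assume "\<not> t / y < z powr (1 / \<alpha>)"
      then have "(z powr (1 / \<alpha>)) powr \<alpha> \<le> (t / y) powr \<alpha>"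
        using \<alpha> by (intro powr_mono2) auto
      with l show False by simp
    qed
  qed
  ultimately show ?thesis using assms by (simp add: divide_less_eq)
qed

text \<open>Let \<open>L\<close> be the inverse process at \<open>t\<close>. Up to null sets the event \<open>A z > t\<close> lies between \<open>L < z\<close> and \<open>L \<le> z\<close>, and by scaling its probability is that of \<open>t^\<alpha> A 1^(-\<alpha>) < z\<close>. Hence the distribution functions agree after moving the argument by an arbitrarily small amount, and right-continuity removes the gap.\<close>

lemma inverse_process_distr:
  assumes t: "0 < t" and m[measurable]: "inverse_process A t \<in> borel_measurable M"
  shows "distr M borel (inverse_process A t) = distr M borel (\<lambda>w. t powr \<alpha> * inv_A w)"
proof (rule cdf_unique)
  let ?L = "inverse_process A t" and ?S = "\<lambda>w. t powr \<alpha> * inv_A w"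
  have Am[measurable]: "A z \<in> borel_measurable M" if "0 < z" for z
    using that by (simp add: A_measurable)
  show d1: "real_distribution (distr M borel ?L)" and d2: "real_distribution (distr M borel ?S)"
    by (auto intro!: real_distribution_distr)
  interpret L: real_distribution "distr M borel ?L" by (rule d1)
  interpret S: real_distribution "distr M borel ?S" by (rule d2)
  have cL: "cdf (distr M borel ?L) z = measure M {w \<in> space M. ?L w \<le> z}" for z
    by (simp add: cdf_def measure_distr vimage_def Int_def conj_commute)
  have cS: "cdf (distr M borel ?S) z = measure M {w \<in> space M. ?S w \<le> z}" for z
    by (simp add: cdf_def measure_distr vimage_def Int_def conj_commute)
  have sc: "measure M {w \<in> space M. t < A z w} = measure M {w \<in> space M. t < z powr (1 / \<alpha>) * A 1 w}"
    if z: "0 < z" for z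
  proof -
    have "measure (distr M borel (A z)) {t<..} = measure (distr M borel (\<lambda>w. z powr (1 / \<alpha>) * A 1 w)) {t<..}"
      by (simp add: A_scaling[OF z])
    then show ?thesis
      using z by (simp add: measure_distr vimage_def Int_def conj_commute)
  qed
  have LS: "cdf (distr M borel ?L) z \<le> cdf (distr M borel ?S) z'" if zz: "z < z'" for z z'
  proof (cases "0 \<le> z")
    case False
    then have "z < ?L w" for w using inverse_process_nonneg[of t w] by linarith
    then have e: "{w \<in> space M. ?L w \<le> z} = {}" by (auto simp: not_le)
    show ?thesis unfolding cL cS e by simp
  next
    case True
    then have z': "0 < z'" using zz by simp
    have "measure M {w \<in> space M. ?L w \<le> z} \<le> measure M {w \<in> space M. t < A z' w}"
    proof (rule finite_measure_mono_AE)
      show "AE w in M. w \<in> {w \<in> space M. ?L w \<le> z} \<longrightarrow> w \<in> {w \<in> space M. t < A z' w}"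
        using AE_A_unbounded[of t]
        by eventually_elim (use inverse_process_less[OF _ z'] zz in force)
    qed (use z' in measurable)
    also have "\<dots> \<le> measure M {w \<in> space M. ?S w \<le> z'}"
      unfolding sc[OF z']
    proof (rule finite_measure_mono_AE)
      show "AE w in M. w \<in> {w \<in> space M. t < z' powr (1 / \<alpha>) * A 1 w} \<longrightarrow> w \<in> {w \<in> space M. ?S w \<le> z'}"
        using AE_A_pos[of 1, simplified]
        by eventually_elim (use powr_quotient_less_iff[OF _ z' t] in \<open>auto simp: inv_A_def less_imp_le\<close>)
    qed measurable
    finally show ?thesis by (simp add: cL cS)
  qed
  have SL: "cdf (distr M borel ?S) z \<le> cdf (distr M borel ?L) z'" if zz: "z < z'" for z z'
  proof (cases "0 \<le> z")
    case False
    have "0 \<le> ?S w" for w using inv_A_nonneg[of w] by simp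
    then have "z < ?S w" for w using False by (meson not_le less_le_trans)
    then have e: "{w \<in> space M. ?S w \<le> z} = {}" by (auto simp: not_le)
    show ?thesis unfolding cL cS e by simp
  next
    case True
    then have z': "0 < z'" using zz by simp
    have "measure M {w \<in> space M. ?S w \<le> z} \<le> measure M {w \<in> space M. t < z' powr (1 / \<alpha>) * A 1 w}"
    proof (rule finite_measure_mono_AE)
      show "AE w in M. w \<in> {w \<in> space M. ?S w \<le> z} \<longrightarrow> w \<in> {w \<in> space M. t < z' powr (1 / \<alpha>) * A 1 w}"
        using AE_A_pos[of 1, simplified]
        by eventually_elim
          (auto simp: inv_A_def powr_quotient_less_iff[OF _ z' t, symmetric] intro: le_less_trans[OF _ zz])
    qed measurable
    also have "\<dots> \<le> measure M {w \<in> space M. ?L w \<le> z'}"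
      unfolding sc[OF z', symmetric] using z'
      by (intro finite_measure_mono) (auto intro!: inverse_process_le)
    finally show ?thesis by (simp add: cL cS)
  qed
  show "cdf (distr M borel ?L) = cdf (distr M borel ?S)"
  proof (rule ext, rule antisym)
    fix z
    show "cdf (distr M borel ?L) z \<le> cdf (distr M borel ?S) z"
    proof (rule tendsto_lowerbound)
      show "(cdf (distr M borel ?S) \<longlongrightarrow> cdf (distr M borel ?S) z) (at_right z)"
        using S.cdf_is_right_cont by (simp add: continuous_within)
      show "\<forall>\<^sub>F z' in at_right z. cdf (distr M borel ?L) z \<le> cdf (distr M borel ?S) z'"
        by (rule eventually_at_rightI[of z "z + 1"]) (auto intro: LS)
    qed simp
    show "cdf (distr M borel ?S) z \<le> cdf (distr M borel ?L) z"
    proof (rule tendsto_lowerbound)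
      show "(cdf (distr M borel ?L) \<longlongrightarrow> cdf (distr M borel ?L) z) (at_right z)"
        using L.cdf_is_right_cont by (simp add: continuous_within)
      show "\<forall>\<^sub>F z' in at_right z. cdf (distr M borel ?S) z \<le> cdf (distr M borel ?L) z'"
        by (rule eventually_at_rightI[of z "z + 1"]) (auto intro: SL)
    qed simp
  qed
qed

end

section \<open>Moments of the inverse stable law\<close>

text \<open>Substitute \<open>k = y^(1/\<alpha>)\<close> in the Gamma integral.\<close>

lemma LINT_powr_exp_powr:
  fixes \<alpha> p c :: real
  assumes \<alpha>: "0 < \<alpha>" and p: "0 < p" and c: "0 < c"
  shows "set_integrable lborel {0<..} (\<lambda>k. k powr (\<alpha> * p - 1) * exp (- (c * k powr \<alpha>)))"
    and "(LINT k:{0<..}|lborel. k powr (\<alpha> * p - 1) * exp (- (c * k powr \<alpha>))) = Gamma p / (\<alpha> * c powr p)"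
proof -
  let ?f = "\<lambda>k. k powr (\<alpha> * p - 1) * exp (- (c * k powr \<alpha>))"
  let ?g = "\<lambda>y::real. y powr (1 / \<alpha>)" and ?g' = "\<lambda>y::real. 1 / \<alpha> * y powr (1 / \<alpha> - 1)"
  have e: "?f (?g y) * ?g' y = 1 / \<alpha> * (y powr (p - 1) * exp (- (c * y)))" if "0 < y" for y
  proof -
    have "(?g y) powr (\<alpha> * p - 1) * y powr (1 / \<alpha> - 1) = y powr (p - 1)"
    proof -
      have x: "1 / \<alpha> * (\<alpha> * p - 1) + (1 / \<alpha> - 1) = p - 1" using \<alpha> by (simp add: field_simps)
      show ?thesis unfolding powr_powr powr_add[symmetric] x ..
    qed
    moreover have "(?g y) powr \<alpha> = y" using that \<alpha> by (simp add: powr_powr)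
    ultimately show ?thesis by (simp add: mult_ac)
  qed
  have i: "set_integrable lborel {0<..} (\<lambda>y. 1 / \<alpha> * (y powr (p - 1) * exp (- (c * y))))"
    by (rule set_integrable_mult_right) (rule set_integrable_powr_exp[OF p c])
  have E: "einterval 0 \<infinity> = {0<..}" by (simp add: zero_ereal_def)
  have i': "set_integrable lborel (einterval 0 \<infinity>) (\<lambda>y. ?f (?g y) * ?g' y)"
    unfolding E by (rule set_integrable_eq_on[OF i], rule e[symmetric]) simp
  have "((\<lambda>y::real. y powr (1 / \<alpha>)) \<longlongrightarrow> 0 powr (1 / \<alpha>)) (at_right 0)"
    using \<alpha> by (intro tendsto_intros) (auto simp: eventually_at_right_less intro: eventually_at_rightI[of 0 1])
  then have l0: "((ereal \<circ> ?g \<circ> real_of_ereal) \<longlongrightarrow> 0) (at_right 0)"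
    unfolding zero_ereal_def by (simp add: ereal_tendsto_simps)
  have "filterlim (\<lambda>y::real. y powr (1 / \<alpha>)) at_top at_top"
    using \<alpha> by real_asymp
  then have l1: "((ereal \<circ> ?g \<circ> real_of_ereal) \<longlongrightarrow> \<infinity>) (at_left \<infinity>)"
    by (simp add: ereal_tendsto_simps)
  have D: "DERIV ?g y :> ?g' y" "isCont ?g' y" "isCont ?f (?g y)" if "0 < ereal y" "ereal y < \<infinity>" for y
    using that \<alpha> by (auto intro!: derivative_eq_intros continuous_intros)
  have N: "0 \<le> ?f (?g y)" "0 \<le> ?g' y" for y using \<alpha> by auto
  note sub = interval_integral_substitution_nonneg[of 0 \<infinity> ?g ?g' ?f 0 \<infinity>, OF _ D(1) D(3) D(2) N(1) N(2) l0 l1 i']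
  have "set_integrable lborel (einterval 0 \<infinity>) ?f" using sub(1) by simp
  then show "set_integrable lborel {0<..} ?f" by (simp only: E)
  have "(LBINT k=0..\<infinity>. ?f k) = (LBINT y=0..\<infinity>. ?f (?g y) * ?g' y)" using sub(2) by simp
  then have "(LINT k:{0<..}|lborel. ?f k) = (LINT y:{0<..}|lborel. ?f (?g y) * ?g' y)"
    by (simp only: interval_lebesgue_integral_0_infty)
  also have "\<dots> = (LINT y:{0<..}|lborel. 1 / \<alpha> * (y powr (p - 1) * exp (- (c * y))))"
    by (rule set_lebesgue_integral_cong, simp, intro allI impI, rule e) simp
  also have "\<dots> = Gamma p / (\<alpha> * c powr p)"
    by (simp only: set_integral_mult_right LINT_powr_exp[OF p c]) simp
  finally show "(LINT k:{0<..}|lborel. ?f k) = Gamma p / (\<alpha> * c powr p)" .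
qed

context stable_process
begin

text \<open>Write \<open>a^(-p) Gamma p\<close> as the integral of \<open>k^(p-1) e^(-k a)\<close>; the expectation then only involves the Laplace transform of the stable law.\<close>

lemma nn_moment_inv_A:
  "(\<integral>\<^sup>+w. ennreal (inv_A w ^ n) \<partial>M) = ennreal (fact n / Gamma (\<alpha> * real n + 1))"
proof (cases "n = 0")
  case True then show ?thesis by (simp add: emeasure_space_1)
next
  case False
  define p where "p = \<alpha> * real n"
  have p: "0 < p" using False \<alpha> by (simp add: p_def)
  have [measurable]: "A 1 \<in> borel_measurable M" by (simp add: A_measurable)
  let ?h = "\<lambda>k. indicator {0<..} k * k powr (p - 1) :: real"
  have "ennreal (inv_A w ^ n) * ennreal (Gamma p) = (\<integral>\<^sup>+k. ennreal (?h k * exp (- (A 1 w * k))) \<partial>lborel)"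
    if w: "0 < A 1 w" for w
  proof -
    have "(\<integral>\<^sup>+k. ennreal (indicator {0<..} k *\<^sub>R (k powr (p - 1) * exp (- (A 1 w * k)))) \<partial>lborel)
      = ennreal (LINT k|lborel. indicator {0<..} k *\<^sub>R (k powr (p - 1) * exp (- (A 1 w * k))))"
      by (rule nn_integral_eq_integral) 
         (use set_integrable_powr_exp[OF p w] in \<open>auto simp: set_integrable_def\<close>)
    also have "(LINT k|lborel. indicator {0<..} k *\<^sub>R (k powr (p - 1) * exp (- (A 1 w * k)))) = Gamma p / A 1 w powr p"
      using LINT_powr_exp[OF p w] by (simp add: set_lebesgue_integral_def)
    also have "Gamma p / A 1 w powr p = inv_A w ^ n * Gamma p"
    proof -
      have "inv_A w ^ n = A 1 w powr (- p)"
        using w by (simp add: inv_A_def p_def powr_realpow[symmetric] powr_powr)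
      then show ?thesis by (simp add: powr_minus_divide)
    qed
    also have "ennreal (inv_A w ^ n * Gamma p) = ennreal (inv_A w ^ n) * ennreal (Gamma p)"
      using inv_A_nonneg by (intro ennreal_mult') simp
    finally show ?thesis by (simp add: mult.assoc)
  qed
  then have "(\<integral>\<^sup>+w. ennreal (inv_A w ^ n) * ennreal (Gamma p) \<partial>M)
     = (\<integral>\<^sup>+w. (\<integral>\<^sup>+k. ennreal (?h k * exp (- (A 1 w * k))) \<partial>lborel) \<partial>M)"
    using AE_A_pos[of 1] by (intro nn_integral_cong_AE) (auto elim!: eventually_mono)
  also have "\<dots> = (\<integral>\<^sup>+k. (\<integral>\<^sup>+w. ennreal (?h k * exp (- (A 1 w * k))) \<partial>M) \<partial>lborel)"
  proof -
    interpret pair_sigma_finite lborel M ..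
    show ?thesis by (rule Fubini') measurable
  qed
  also have "\<dots> = (\<integral>\<^sup>+k. ennreal (indicator {0<..} k *\<^sub>R (k powr (\<alpha> * real n - 1) * exp (- (k powr \<alpha>)))) \<partial>lborel)"
  proof (rule nn_integral_cong)
    fix k :: real
    show "(\<integral>\<^sup>+w. ennreal (?h k * exp (- (A 1 w * k))) \<partial>M)
        = ennreal (indicator {0<..} k *\<^sub>R (k powr (\<alpha> * real n - 1) * exp (- (k powr \<alpha>))))"
    proof (cases "0 < k")
      case True
      have "(\<integral>\<^sup>+w. ennreal (?h k * exp (- (A 1 w * k))) \<partial>M) = ennreal (LINT w|M. ?h k * exp (- k * A 1 w))"
        using exp_A_integrable[of 1 k] True
        by (subst nn_integral_eq_integral[symmetric]) (auto simp: mult_ac)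
      also have "(LINT w|M. ?h k * exp (- k * A 1 w)) = ?h k * exp (- (k powr \<alpha>))"
        using A_laplace[of 1 k] True by simp
      finally show ?thesis using True by (simp add: p_def)
    qed simp
  qed
  also have "\<dots> = ennreal (LINT k:{0<..}|lborel. k powr (\<alpha> * real n - 1) * exp (- (k powr \<alpha>)))"
    unfolding set_lebesgue_integral_def
    by (rule nn_integral_eq_integral)
       (use LINT_powr_exp_powr(1)[OF \<alpha>(1), of "real n" 1] False in \<open>auto simp: set_integrable_def\<close>)
  also have "\<dots> = ennreal (Gamma (real n) / \<alpha>)"
    using LINT_powr_exp_powr(2)[OF \<alpha>(1), of "real n" 1] False by simp
  finally have "(\<integral>\<^sup>+w. ennreal (inv_A w ^ n) * ennreal (Gamma p) \<partial>M) = ennreal (Gamma (real n) / \<alpha>)" .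
  then have *: "(\<integral>\<^sup>+w. ennreal (inv_A w ^ n) \<partial>M) * ennreal (Gamma p) = ennreal (Gamma (real n) / \<alpha>)"
    by (subst (asm) nn_integral_multc) measurable
  have Gp: "0 < Gamma p" using p by (rule Gamma_real_pos)
  have "Gamma (real n) / \<alpha> = fact n / Gamma (p + 1) * Gamma p"
  proof -
    have "p \<notin> \<int>\<^sub>\<le>\<^sub>0" using p by (auto elim!: nonpos_Ints_cases)
    then have "Gamma (p + 1) = p * Gamma p" by (rule Gamma_plus1)
    moreover have "fact n = real n * Gamma (real n)"
      using False Gamma_fact[of "n - 1", where 'a = real] by (cases n) (auto simp: algebra_simps)
    ultimately have "fact n / Gamma (p + 1) * Gamma p = real n * Gamma (real n) / p"
      using Gp by simp
    then show ?thesis using False by (simp add: p_def)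
  qed
  with * have "(\<integral>\<^sup>+w. ennreal (inv_A w ^ n) \<partial>M) * ennreal (Gamma p) = ennreal (fact n / Gamma (p + 1)) * ennreal (Gamma p)"
    using Gp by (simp add: ennreal_mult''[symmetric])
  then have "ennreal (Gamma p) * (\<integral>\<^sup>+w. ennreal (inv_A w ^ n) \<partial>M) = ennreal (Gamma p) * ennreal (fact n / Gamma (p + 1))"
    by (simp only: mult.commute)
  then show ?thesis
    using Gp unfolding ennreal_mult_cancel_left p_def by simp 
qed

lemma
  shows moment_inv_A_integrable: "integrable M (\<lambda>w. inv_A w ^ n)"
    and moment_inv_A: "(LINT w|M. inv_A w ^ n) = fact n / Gamma (\<alpha> * real n + 1)"
proof -
  have "0 < Gamma (\<alpha> * real n + 1)" using \<alpha> by (intro Gamma_real_pos) (simp add: add_nonneg_pos)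
  then have "has_bochner_integral M (\<lambda>w. inv_A w ^ n) (fact n / Gamma (\<alpha> * real n + 1))"
    by (intro has_bochner_integral_nn_integral nn_moment_inv_A) (auto simp: inv_A_nonneg)
  then show "integrable M (\<lambda>w. inv_A w ^ n)" "(LINT w|M. inv_A w ^ n) = fact n / Gamma (\<alpha> * real n + 1)"
    by (simp_all add: has_bochner_integral_iff)
qed

text \<open>Weight of the Caputo kernel after the substitution: \<open>\<alpha> s^(\<alpha>-1)\<close> is the derivative of the time scale \<open>s^\<alpha>\<close>.\<close>

definition caputo_weight :: "real \<Rightarrow> real \<Rightarrow> real" where
  "caputo_weight t s = indicator {0<..<t} s * (\<alpha> / Gamma (1 - \<alpha>) * ((t - s) powr (- \<alpha>) * s powr (\<alpha> - 1)))"

lemma caputo_weight_measurable [measurable]: "caputo_weight t \<in> borel_measurable borel"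
  by (simp add: caputo_weight_def[abs_def])

lemma caputo_weight_nonneg: "0 \<le> caputo_weight t s"
  using \<alpha> by (auto simp: caputo_weight_def indicator_def intro!: mult_nonneg_nonneg divide_nonneg_nonneg Gamma_real_nonneg)

lemma nn_integral_caputo_weight:
  assumes t: "0 < t"
  shows "(\<integral>\<^sup>+s. ennreal (caputo_weight t s * s powr (\<alpha> * real n)) \<partial>lborel) * (\<integral>\<^sup>+w. ennreal (inv_A w ^ Suc n) \<partial>M)
    = ennreal (t powr (\<alpha> * real n) * (fact n / Gamma (\<alpha> * real n + 1)))"
proof -
  define a where "a = \<alpha> * real (Suc n)"
  have a: "0 < a" using \<alpha> by (simp add: a_def)
  have b: "0 < 1 - \<alpha>" using \<alpha> by simp
  have pos: "0 < Gamma a" "0 < Gamma (1 - \<alpha>)" "0 < Gamma (a + 1)"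
    using a b by (auto intro!: Gamma_real_pos)
  have hb: "has_bochner_integral lborel
     (\<lambda>s. \<alpha> / Gamma (1 - \<alpha>) * (indicator {0<..<t} s *\<^sub>R ((t - s) powr (1 - \<alpha> - 1) * s powr (a - 1))))
     (\<alpha> / Gamma (1 - \<alpha>) * (t powr (a + (1 - \<alpha>) - 1) * Beta a (1 - \<alpha>)))"
    by (rule has_bochner_integral_mult_right) (rule has_bochner_integral_beta[OF a b t])
  have eq: "\<alpha> / Gamma (1 - \<alpha>) * (indicator {0<..<t} s *\<^sub>R ((t - s) powr (1 - \<alpha> - 1) * s powr (a - 1)))
     = caputo_weight t s * s powr (\<alpha> * real n)" for s
  proof -
    have "s powr (a - 1) = s powr (\<alpha> - 1) * s powr (\<alpha> * real n)"
      by (simp add: a_def powr_add[symmetric] algebra_simps)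
    then show ?thesis by (simp add: caputo_weight_def)
  qed
  have e: "a + (1 - \<alpha>) - 1 = \<alpha> * real n" by (simp add: a_def algebra_simps)
  have "(\<integral>\<^sup>+s. ennreal (caputo_weight t s * s powr (\<alpha> * real n)) \<partial>lborel)
     = ennreal (LINT s|lborel. caputo_weight t s * s powr (\<alpha> * real n))"
    by (rule nn_integral_eq_integral)
       (use hb[unfolded eq] caputo_weight_nonneg in \<open>auto simp: has_bochner_integral_iff\<close>)
  also have "(LINT s|lborel. caputo_weight t s * s powr (\<alpha> * real n))
     = \<alpha> / Gamma (1 - \<alpha>) * (t powr (\<alpha> * real n) * Beta a (1 - \<alpha>))"
    using hb[unfolded eq e] by (simp add: has_bochner_integral_iff)
  also have "ennreal \<dots> * (\<integral>\<^sup>+w. ennreal (inv_A w ^ Suc n) \<partial>M)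
     = ennreal (\<alpha> / Gamma (1 - \<alpha>) * (t powr (\<alpha> * real n) * Beta a (1 - \<alpha>)) * (fact (Suc n) / Gamma (a + 1)))"
    unfolding nn_moment_inv_A a_def[symmetric]
    by (rule ennreal_mult''[symmetric]) (use pos in \<open>auto intro!: divide_nonneg_nonneg\<close>)
  also have "\<alpha> / Gamma (1 - \<alpha>) * (t powr (\<alpha> * real n) * Beta a (1 - \<alpha>)) * (fact (Suc n) / Gamma (a + 1))
     = t powr (\<alpha> * real n) * (fact n / Gamma (\<alpha> * real n + 1))"
  proof -
    have "a \<notin> \<int>\<^sub>\<le>\<^sub>0" using a by (auto elim!: nonpos_Ints_cases)
    then have g: "Gamma (a + 1) = a * Gamma a" by (rule Gamma_plus1)
    have bt: "Beta a (1 - \<alpha>) = Gamma a * Gamma (1 - \<alpha>) / Gamma (\<alpha> * real n + 1)"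
      by (simp add: Beta_def a_def algebra_simps)
    have f: "fact (Suc n) = real (Suc n) * fact n" by simp
    have "\<alpha> * (Gamma a * fact (Suc n)) = fact n * Gamma (a + 1)"
      unfolding g f by (simp add: a_def)
    then have "\<alpha> * Gamma a * fact (Suc n) / Gamma (a + 1) = fact n"
      using pos by (simp add: field_simps)
    moreover have "\<alpha> / Gamma (1 - \<alpha>) * (t powr (\<alpha> * real n) * Beta a (1 - \<alpha>)) * (fact (Suc n) / Gamma (a + 1))
       = t powr (\<alpha> * real n) * ((\<alpha> * Gamma a * fact (Suc n) / Gamma (a + 1)) / Gamma (\<alpha> * real n + 1))"
      unfolding bt using pos(2) by (simp add: mult_ac del: fact_Suc)
    ultimately show ?thesis by (simp only:)
  qed
  finally show ?thesis .
qed

text \<open>The law of \<open>s^\<alpha> \<Lambda>\<close> under the size-biased law of \<open>\<Lambda>\<close>, with \<open>s\<close> distributed according to the Caputo weight.\<close>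

definition caputo_mixture :: "real \<Rightarrow> real measure" where
  "caputo_mixture t = distr (density (lborel \<Otimes>\<^sub>M M) (\<lambda>(s, w). ennreal (caputo_weight t s * inv_A w)))
     borel (\<lambda>(s, w). s powr \<alpha> * inv_A w)"

lemma nn_integral_caputo_mixture:
  assumes [measurable]: "h \<in> borel_measurable borel"
  shows "(\<integral>\<^sup>+x. h x \<partial>caputo_mixture t)
     = (\<integral>\<^sup>+s. (\<integral>\<^sup>+w. ennreal (caputo_weight t s * inv_A w) * h (s powr \<alpha> * inv_A w) \<partial>M) \<partial>lborel)"
proof -
  have w: "(\<lambda>(s, w). ennreal (caputo_weight t s * inv_A w)) \<in> borel_measurable (lborel \<Otimes>\<^sub>M M)"
    by measurable
  have v: "(\<lambda>(s, w). s powr \<alpha> * inv_A w) \<in> borel_measurable (lborel \<Otimes>\<^sub>M M)"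
    by measurable
  have "(\<integral>\<^sup>+x. h x \<partial>caputo_mixture t)
     = (\<integral>\<^sup>+p. h (case p of (s, w) \<Rightarrow> s powr \<alpha> * inv_A w)
         \<partial>density (lborel \<Otimes>\<^sub>M M) (\<lambda>(s, w). ennreal (caputo_weight t s * inv_A w)))"
    unfolding caputo_mixture_def by (rule nn_integral_distr) (use v in simp_all)
  also have "\<dots> = (\<integral>\<^sup>+p. (case p of (s, w) \<Rightarrow> ennreal (caputo_weight t s * inv_A w)) *
       h (case p of (s, w) \<Rightarrow> s powr \<alpha> * inv_A w) \<partial>(lborel \<Otimes>\<^sub>M M))"
    by (rule nn_integral_density[OF w]) measurable
  also have "\<dots> = (\<integral>\<^sup>+s. (\<integral>\<^sup>+w. ennreal (caputo_weight t s * inv_A w) * h (s powr \<alpha> * inv_A w) \<partial>M) \<partial>lborel)"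
    by (subst nn_integral_fst[symmetric]) (auto intro!: nn_integral_cong)
  finally show ?thesis .
qed

lemma nn_moment_caputo_mixture:
  assumes t: "0 < t"
  shows "(\<integral>\<^sup>+x. ennreal (x ^ n) \<partial>caputo_mixture t)
    = ennreal (t powr (\<alpha> * real n) * (fact n / Gamma (\<alpha> * real n + 1)))"
proof -
  have "(\<integral>\<^sup>+x. ennreal (x ^ n) \<partial>caputo_mixture t)
     = (\<integral>\<^sup>+s. (\<integral>\<^sup>+w. ennreal (caputo_weight t s * inv_A w) * ennreal ((s powr \<alpha> * inv_A w) ^ n) \<partial>M) \<partial>lborel)"
    by (rule nn_integral_caputo_mixture) measurable
  also have "\<dots> = (\<integral>\<^sup>+s. (\<integral>\<^sup>+w. ennreal (caputo_weight t s * s powr (\<alpha> * real n)) * ennreal (inv_A w ^ Suc n) \<partial>M) \<partial>lborel)"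
  proof (intro nn_integral_cong)
    fix s w
    show "ennreal (caputo_weight t s * inv_A w) * ennreal ((s powr \<alpha> * inv_A w) ^ n)
      = ennreal (caputo_weight t s * s powr (\<alpha> * real n)) * ennreal (inv_A w ^ Suc n)"
    proof (cases "0 < s")
      case True
      have "(s powr \<alpha>) ^ n = s powr (\<alpha> * real n)"
        using True by (simp add: powr_realpow[symmetric] powr_powr)
      then show ?thesis using caputo_weight_nonneg[of t s] inv_A_nonneg[of w]
        by (simp add: ennreal_mult'[symmetric] power_mult_distrib mult_ac)
    qed (simp add: caputo_weight_def)
  qed
  also have "\<dots> = (\<integral>\<^sup>+s. ennreal (caputo_weight t s * s powr (\<alpha> * real n)) \<partial>lborel) * (\<integral>\<^sup>+w. ennreal (inv_A w ^ Suc n) \<partial>M)"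
    by (subst nn_integral_cmult, measurable, subst nn_integral_multc) auto
  finally show ?thesis unfolding nn_integral_caputo_weight[OF t] .
qed

text \<open>Both laws have the moments \<open>t^(\<alpha> n) n! / Gamma (\<alpha> n + 1)\<close>; these grow slowly enough to determine the law.\<close>

lemma caputo_mixture_eq:
  assumes t: "0 < t"
  shows "caputo_mixture t = distr M borel (\<lambda>w. t powr \<alpha> * inv_A w)"
proof -
  let ?S = "distr M borel (\<lambda>w. t powr \<alpha> * inv_A w)" and ?N = "caputo_mixture t"
  have sN: "sets ?N = sets borel" "space ?N = UNIV" by (simp_all add: caputo_mixture_def)
  have N: "real_distribution ?N"
  proof -
    have "emeasure ?N (space ?N) = (\<integral>\<^sup>+x. ennreal (x ^ 0) \<partial>?N)" by simp
    also have "\<dots> = 1" using t by (subst nn_moment_caputo_mixture[OF t]) simp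
    finally have "prob_space ?N" by (rule prob_spaceI)
    then show ?thesis
      by (simp add: real_distribution_def real_distribution_axioms_def sN)
  qed
  have S: "real_distribution ?S" by (auto intro!: real_distribution_distr)
  interpret S: real_distribution ?S by (rule S)
  have c: "0 \<le> t powr (\<alpha> * real n) * (fact n / Gamma (\<alpha> * real n + 1))" for n
  proof -
    have "0 < Gamma (\<alpha> * real n + 1)" using \<alpha> by (intro Gamma_real_pos) (simp add: add_nonneg_pos)
    then show ?thesis by simp
  qed
  have N0: "AE x in ?N. 0 \<le> x"
    unfolding caputo_mixture_def
    by (subst AE_distr_iff, measurable) (auto simp: inv_A_nonneg split_beta' intro!: AE_I2)
  have S0: "AE x in ?S. 0 \<le> x"
    by (subst AE_distr_iff) (auto simp: inv_A_nonneg)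
  have mN: "has_bochner_integral ?N (\<lambda>x. x ^ n) (t powr (\<alpha> * real n) * (fact n / Gamma (\<alpha> * real n + 1)))" for n
  proof (rule has_bochner_integral_nn_integral)
    show "(\<lambda>x. x ^ n) \<in> borel_measurable ?N" by (subst measurable_cong_sets[OF sN(1) refl]) simp
    show "AE x in ?N. 0 \<le> x ^ n" using N0 by eventually_elim simp
  qed (rule c, rule nn_moment_caputo_mixture[OF t])
  have mS: "has_bochner_integral ?S (\<lambda>x. x ^ n) (t powr (\<alpha> * real n) * (fact n / Gamma (\<alpha> * real n + 1)))" for n
  proof (rule has_bochner_integral_distr)
    have "(t powr \<alpha>) ^ n = t powr (\<alpha> * real n)"
      using t by (simp add: powr_realpow[symmetric] powr_powr)
    then have "(\<lambda>w. (t powr \<alpha> * inv_A w) ^ n) = (\<lambda>w. t powr (\<alpha> * real n) * inv_A w ^ n)"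
      by (simp add: power_mult_distrib)
    then show "has_bochner_integral M (\<lambda>w. (t powr \<alpha> * inv_A w) ^ n) (t powr (\<alpha> * real n) * (fact n / Gamma (\<alpha> * real n + 1)))"
      using moment_inv_A[of n] moment_inv_A_integrable[of n]
      by (auto simp: has_bochner_integral_iff)
  qed measurable
  show ?thesis
  proof (rule moment_determinacy[OF N S _ _ _ N0 S0])
    show "integrable ?N (\<lambda>x. x ^ n)" "integrable ?S (\<lambda>x. x ^ n)" for n
      using mN[of n] mS[of n] by (auto simp: has_bochner_integral_iff)
    show "(LINT x|?N. x ^ n) = (LINT x|?S. x ^ n)" for n
      using mN[of n] mS[of n] by (simp add: has_bochner_integral_iff)
    fix s :: real assume s: "0 \<le> s"
    have "s ^ n / fact n * (LINT x|?N. x ^ n) = (s * t powr \<alpha>) ^ n / Gamma (\<alpha> * real n + 1)" for n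
    proof -
      have "(t powr \<alpha>) ^ n = t powr (\<alpha> * real n)"
        using t by (simp add: powr_realpow[symmetric] powr_powr)
      then show ?thesis using mN[of n]
        by (simp add: has_bochner_integral_iff power_mult_distrib)
    qed
    then show "summable (\<lambda>n. s ^ n / fact n * (LINT x|?N. x ^ n))"
      using summable_mittag_leffler[of \<alpha> "s * t powr \<alpha>"] s \<alpha> by simp
  qed
qed

end

section \<open>The Caputo derivative: orders below one\<close>

context stable_process
begin

lemma
  assumes t: "0 < t" and hm[measurable]: "h \<in> borel_measurable borel"
    and b: "\<And>x. 0 \<le> x \<Longrightarrow> \<bar>h x\<bar> \<le> C"
  shows integrable_caputo_mixture:
      "integrable lborel (\<lambda>s. LINT w|M. caputo_weight t s * inv_A w * h (s powr \<alpha> * inv_A w))"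
    and integral_caputo_mixture:
      "(LINT s|lborel. LINT w|M. caputo_weight t s * inv_A w * h (s powr \<alpha> * inv_A w))
        = (LINT w|M. h (t powr \<alpha> * inv_A w))"
proof -
  interpret P: pair_sigma_finite lborel M ..
  let ?W = "\<lambda>p. caputo_weight t (fst p) * inv_A (snd p)" and ?V = "\<lambda>p. fst p powr \<alpha> * inv_A (snd p)"
  have mix: "caputo_mixture t = distr (density (lborel \<Otimes>\<^sub>M M) (\<lambda>p. ennreal (?W p))) borel ?V"
    by (simp add: caputo_mixture_def split_beta')
  have Vm: "?V \<in> borel_measurable (density (lborel \<Otimes>\<^sub>M M) (\<lambda>p. ennreal (?W p)))" by measurable
  have W0: "AE p in lborel \<Otimes>\<^sub>M M. 0 \<le> ?W p"
    using caputo_weight_nonneg inv_A_nonneg by auto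
  have hS: "integrable M (\<lambda>w. h (t powr \<alpha> * inv_A w))"
    by (rule integrable_const_bound[of _ C]) (auto intro!: AE_I2 b mult_nonneg_nonneg inv_A_nonneg)
  then have "integrable (distr M borel (\<lambda>w. t powr \<alpha> * inv_A w)) h"
    by (subst integrable_distr_eq) auto
  then have "integrable (caputo_mixture t) h" by (simp add: caputo_mixture_eq[OF t])
  then have "integrable (density (lborel \<Otimes>\<^sub>M M) (\<lambda>p. ennreal (?W p))) (\<lambda>p. h (?V p))"
    unfolding mix by (subst (asm) integrable_distr_eq) (use Vm in auto)
  then have i: "integrable (lborel \<Otimes>\<^sub>M M) (\<lambda>p. ?W p * h (?V p))"
    by (subst (asm) integrable_real_density) (use W0 in \<open>auto\<close>)
  show "integrable lborel (\<lambda>s. LINT w|M. caputo_weight t s * inv_A w * h (s powr \<alpha> * inv_A w))"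
    using P.integrable_fst'[OF i] by simp
  have "(LINT s|lborel. LINT w|M. caputo_weight t s * inv_A w * h (s powr \<alpha> * inv_A w)) = (LINT p|(lborel \<Otimes>\<^sub>M M). ?W p * h (?V p))"
    using P.integral_fst'[OF i] by simp
  also have "\<dots> = (LINT p|density (lborel \<Otimes>\<^sub>M M) (\<lambda>p. ennreal (?W p)). h (?V p))"
    by (subst integral_real_density) (use W0 in auto)
  also have "\<dots> = (LINT x|caputo_mixture t. h x)"
    unfolding mix by (subst integral_distr) (use Vm in auto)
  also have "\<dots> = (LINT w|M. h (t powr \<alpha> * inv_A w))"
    unfolding caputo_mixture_eq[OF t] by (subst integral_distr) auto
  finally show "(LINT s|lborel. LINT w|M. caputo_weight t s * inv_A w * h (s powr \<alpha> * inv_A w))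
        = (LINT w|M. h (t powr \<alpha> * inv_A w))" .
qed

text \<open>Differentiating \<open>g (s^\<alpha> \<Lambda>)\<close> in \<open>s\<close> produces the factor \<open>\<alpha> s^(\<alpha>-1) \<Lambda>\<close>, so the Caputo integral is the mean of \<open>g'\<close> under the mixture of the previous section.\<close>

lemma caputo_of_mean:
  assumes t: "0 < t"
    and g: "\<And>l. (g has_real_derivative g' l) (at l)" and g'm[measurable]: "g' \<in> borel_measurable borel"
    and b: "\<And>l. 0 \<le> l \<Longrightarrow> \<bar>g l\<bar> \<le> C" "\<And>l. 0 \<le> l \<Longrightarrow> \<bar>g' l\<bar> \<le> C"
    and u: "\<And>s. 0 < s \<Longrightarrow> u s = (LINT w|M. g (s powr \<alpha> * inv_A w))"
  shows "caputo_exists \<alpha> u t" and "caputo \<alpha> u t = (LINT w|M. g' (t powr \<alpha> * inv_A w))"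
proof -
  have [measurable]: "g \<in> borel_measurable borel"
    by (intro borel_measurable_continuous_onI) (auto intro!: DERIV_continuous_on g simp: has_field_derivative_at_within)
  have C0: "0 \<le> C" using b(1)[of 0] by linarith
  have inv1: "integrable M inv_A" using moment_inv_A_integrable[of 1] by simp
  define v where "v s = (LINT w|M. \<alpha> * s powr (\<alpha> - 1) * inv_A w * g' (s powr \<alpha> * inv_A w))" for s
  have du: "(u has_real_derivative v s) (at s)" if s: "0 < s" for s
  proof -
    have "((\<lambda>s. LINT w|M. g (s powr \<alpha> * inv_A w)) has_real_derivative v s) (at s)"
      unfolding v_def
    proof (rule has_real_derivative_under_integral[of s "s / 2" "2 * s" M "\<lambda>y w. g (y powr \<alpha> * inv_A w)"
          "\<lambda>y w. \<alpha> * y powr (\<alpha> - 1) * inv_A w * g' (y powr \<alpha> * inv_A w)" 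
          "\<lambda>w. \<alpha> * (s / 2) powr (\<alpha> - 1) * C * inv_A w"])
      show "s \<in> {s / 2<..<2 * s}" using s by simp
      show "integrable M (\<lambda>w. \<alpha> * (s / 2) powr (\<alpha> - 1) * C * inv_A w)"
        by (intro integrable_mult_right inv1)
      fix y assume "y \<in> {s / 2<..<2 * s}"
      then have y: "0 < y" "s / 2 \<le> y" using s by auto
      show "integrable M (\<lambda>w. g (y powr \<alpha> * inv_A w))"
        by (rule integrable_const_bound[of _ C]) (auto intro!: AE_I2 b mult_nonneg_nonneg inv_A_nonneg)
      fix w
      have "((\<lambda>y. y powr \<alpha> * inv_A w) has_real_derivative (\<alpha> * y powr (\<alpha> - 1)) * inv_A w) (at y)"
        using y by (auto intro!: derivative_eq_intros)
      from DERIV_chain2[OF g this]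
      show "((\<lambda>y. g (y powr \<alpha> * inv_A w)) has_real_derivative \<alpha> * y powr (\<alpha> - 1) * inv_A w * g' (y powr \<alpha> * inv_A w)) (at y)"
        by (simp add: mult_ac)
      have "y powr (\<alpha> - 1) \<le> (s / 2) powr (\<alpha> - 1)"
        using y s \<alpha> by (intro powr_mono2') auto
      then have "\<alpha> * y powr (\<alpha> - 1) * inv_A w * \<bar>g' (y powr \<alpha> * inv_A w)\<bar> \<le> \<alpha> * (s / 2) powr (\<alpha> - 1) * inv_A w * C"
        using \<alpha> C0 by (intro mult_mono b(2)) (auto simp: inv_A_nonneg)
      then show "\<bar>\<alpha> * y powr (\<alpha> - 1) * inv_A w * g' (y powr \<alpha> * inv_A w)\<bar> \<le> \<alpha> * (s / 2) powr (\<alpha> - 1) * C * inv_A w"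
        using \<alpha> inv_A_nonneg[of w] by (simp add: abs_mult mult_ac)
    qed
    then show ?thesis
      by (rule has_field_derivative_transform_within_open[of _ _ _ "{0<..}"]) (use s u in auto)
  qed
  have Gp: "0 < Gamma (1 - \<alpha>)" using \<alpha> by (intro Gamma_real_pos) simp
  have eq: "indicator {0<..<t} s *\<^sub>R ((t - s) powr (- \<alpha>) * deriv u s)
      = Gamma (1 - \<alpha>) * (LINT w|M. caputo_weight t s * inv_A w * g' (s powr \<alpha> * inv_A w))" for s
  proof (cases "s \<in> {0<..<t}")
    case True
    then have "deriv u s = v s" by (intro DERIV_imp_deriv du) simp
    then have "(t - s) powr (- \<alpha>) * deriv u s = (LINT w|M. (t - s) powr (- \<alpha>) * (\<alpha> * s powr (\<alpha> - 1) * inv_A w * g' (s powr \<alpha> * inv_A w)))"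
      by (simp only: v_def integral_mult_right_zero)
    also have "\<dots> = (LINT w|M. Gamma (1 - \<alpha>) * (caputo_weight t s * inv_A w * g' (s powr \<alpha> * inv_A w)))"
      using True Gp by (intro Bochner_Integration.integral_cong refl) (simp add: caputo_weight_def)
    finally show ?thesis using True by simp
  qed (simp add: caputo_weight_def)
  note m = integrable_caputo_mixture[OF t g'm b(2)] integral_caputo_mixture[OF t g'm b(2)]
  show "caputo_exists \<alpha> u t"
    unfolding caputo_exists_def set_integrable_def eq
    using m(1) by (auto simp: real_differentiable_def intro!: exI du)
  have "caputo \<alpha> u t = 1 / Gamma (1 - \<alpha>) * (LINT s|lborel. Gamma (1 - \<alpha>) * (LINT w|M. caputo_weight t s * inv_A w * g' (s powr \<alpha> * inv_A w)))"
    unfolding caputo_def set_lebesgue_integral_def eq ..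
  also have "\<dots> = (LINT w|M. g' (t powr \<alpha> * inv_A w))"
    using Gp m(2) by simp
  finally show "caputo \<alpha> u t = (LINT w|M. g' (t powr \<alpha> * inv_A w))" .
qed

lemma inverse_process_small_pos:
  assumes t: "0 < t" and m[measurable]: "inverse_process A t \<in> borel_measurable M"
  shows "emeasure M {w \<in> space M. 0 < inverse_process A t w \<and> inverse_process A t w \<le> 1 / 2} \<noteq> 0"
proof
  let ?S = "\<lambda>w. t powr \<alpha> * inv_A w"
  have [measurable]: "A 1 \<in> borel_measurable M" by (simp add: A_measurable)
  assume 0: "emeasure M {w \<in> space M. 0 < inverse_process A t w \<and> inverse_process A t w \<le> 1 / 2} = 0"
  have "emeasure (distr M borel (inverse_process A t)) {0<..1/2} = emeasure (distr M borel ?S) {0<..1/2}"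
    by (simp add: inverse_process_distr[OF t m])
  then have "emeasure M {w \<in> space M. ?S w \<in> {0<..1/2}} = 0"
    using 0 by (simp add: emeasure_distr vimage_def Int_def conj_commute)
  then have "AE w in M. \<not> (?S w \<in> {0<..1/2})"
    by (intro AE_I[of _ _ "{w \<in> space M. ?S w \<in> {0<..1/2}}"]) auto
  then have "AE w in M. A 1 w < 1 + t / ((1 / 2) powr (1 / \<alpha>))"
    using AE_A_pos[of 1, simplified]
  proof eventually_elim
    fix w assume w: "?S w \<notin> {0<..1/2}" and A: "0 < A 1 w"
    have "0 < ?S w" using t A by (simp add: inv_A_def)
    with w have "\<not> ?S w < 1 / 2" by auto
    then have "\<not> t < (1 / 2) powr (1 / \<alpha>) * A 1 w"
      using powr_quotient_less_iff[OF A _ t, of "1 / 2"] by (simp add: inv_A_def)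
    then have "A 1 w \<le> t / ((1 / 2) powr (1 / \<alpha>))" by (simp add: field_simps)
    then show "A 1 w < 1 + t / ((1 / 2) powr (1 / \<alpha>))" by linarith
  qed
  moreover have "0 < 1 + t / ((1 / 2) powr (1 / \<alpha>))" using t by (simp add: add_pos_nonneg)
  ultimately show False using prob_A_large_pos by blast
qed

end

text \<open>The iterated Caputo derivatives are the means of the derivatives of the kernel, by induction with \<open>caputo_of_mean\<close>.\<close>

lemma fractional_gamma_below_one:
  fixes M :: "'w measure"
  assumes "prob_space M" "standard_brownian_motion M B" "gamma_subordinator M G"
    and \<nu>: "0 < \<nu>" "\<nu> < 1" and st: "stable_subordinator M \<nu> A"
    and ind: "independent_processes M B G (inverse_process A)"
    and dens: "density_family M (\<lambda>t \<omega>. G (inverse_process A t \<omega>) \<omega>) f"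
  shows "\<forall>t>0. distributed M lborel (\<lambda>\<omega>. B (G (inverse_process A t \<omega>) \<omega>) \<omega>)
             (\<lambda>x. ennreal (subordinated_density f x t))"
    and "\<forall>x\<ge>0. \<forall>t>1. subordinated_density_finite f x t \<longrightarrow>
             twice_differentiable_at (\<lambda>y. subordinated_density f y t) x \<and>
             caputo_shift_exists \<nu> (- 1) (\<lambda>s. subordinated_density f x s) t \<and>
             1 / 2 * deriv (deriv (\<lambda>y. subordinated_density f y t)) x =
               subordinated_density f x t
               - caputo_shift \<nu> (- 1) (\<lambda>s. subordinated_density f x s) t"
    and "\<forall>t>1. vanishes_at_infinity (\<lambda>x. subordinated_density f x t)"
proof -
  interpret stable_process M \<nu> A
    using assms by (simp add: stable_process_def stable_process_axioms_def)
  interpret gamma_time_change M B G "inverse_process A" f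
    using assms inverse_process_nonneg by (simp add: gamma_time_change_def gamma_time_change_axioms_def)
  show "\<forall>t>0. distributed M lborel (\<lambda>\<omega>. B (G (inverse_process A t \<omega>) \<omega>) \<omega>)
             (\<lambda>x. ennreal (subordinated_density f x t))"
    using distributed_BGT by blast
  show "\<forall>t>1. vanishes_at_infinity (\<lambda>x. subordinated_density f x t)"
    using vanishes_at_infinity_density by simp
  show "\<forall>x\<ge>0. \<forall>t>1. subordinated_density_finite f x t \<longrightarrow>
             twice_differentiable_at (\<lambda>y. subordinated_density f y t) x \<and>
             caputo_shift_exists \<nu> (- 1) (\<lambda>s. subordinated_density f x s) t \<and>
             1 / 2 * deriv (deriv (\<lambda>y. subordinated_density f y t)) x =
               subordinated_density f x t
               - caputo_shift \<nu> (- 1) (\<lambda>s. subordinated_density f x s) t"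
  proof (intro allI impI)
    fix x t :: real assume x0: "0 \<le> x" and t1: "1 < t" and fin: "subordinated_density_finite f x t"
    have t: "0 < t" using t1 by simp
    have "x \<noteq> 0"
      using not_finite_at_0[OF t inverse_process_small_pos[OF t]] T_measurable[of t] t fin by auto
    note x = this
    define u where "u s = subordinated_density f x s" for s
    note km[measurable] = vg_kernel_measurable[OF x]
    obtain C where C: "\<And>n l. 0 \<le> l \<Longrightarrow> \<bar>vg_kernel x n l\<bar> \<le> fact n * C / 2 ^ n"
      using vg_kernel_bounds[OF x] by blast
    have law: "(LINT w|M. vg_kernel x n (inverse_process A s w)) = (LINT w|M. vg_kernel x n (s powr \<nu> * inv_A w))"
      if s: "0 < s" for s n
    proof -
      have [measurable]: "inverse_process A s \<in> borel_measurable M" using T_measurable s by simp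
      have "(LINT l|distr M borel (inverse_process A s). vg_kernel x n l) = (LINT l|distr M borel (\<lambda>w. s powr \<nu> * inv_A w). vg_kernel x n l)"
        using s by (subst inverse_process_distr) auto
      then show ?thesis by (simp add: integral_distr)
    qed
    have step: "caputo_exists \<nu> v s \<and> caputo \<nu> v s = (LINT w|M. vg_kernel x (Suc n) (s powr \<nu> * inv_A w))"
      if s: "0 < s" and v: "\<And>s. 0 < s \<Longrightarrow> v s = (LINT w|M. vg_kernel x n (s powr \<nu> * inv_A w))" for s v n
    proof -
      let ?C = "max (fact n * C / 2 ^ n) (fact (Suc n) * C / 2 ^ Suc n)"
      have b: "\<bar>vg_kernel x n l\<bar> \<le> ?C" "\<bar>vg_kernel x (Suc n) l\<bar> \<le> ?C" if "0 \<le> l" for l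
        using C[OF that, of n] C[OF that, of "Suc n"] by linarith+
      note r = caputo_of_mean[OF s vg_kernel_deriv[OF x] km b v]
      show ?thesis using r by blast
    qed
    have it: "(caputo \<nu> ^^ n) u s = (LINT w|M. vg_kernel x n (s powr \<nu> * inv_A w))" if "0 < s" for s n
      using that
    proof (induction n arbitrary: s)
      case 0 then show ?case
        using subordinated_density_eq(2)[OF _ x, of s] law[of s 0] by (simp add: u_def)
    next
      case (Suc n) then show ?case using step[of s "(caputo \<nu> ^^ n) u" n] by simp
    qed
    have ex: "caputo_exists \<nu> ((caputo \<nu> ^^ n) u) s" if "0 < s" for s n
      using step[OF that, of "(caputo \<nu> ^^ n) u" n] it by blast
    have "(\<lambda>n. (- 1) ^ n / fact n * (caputo \<nu> ^^ n) u t) sums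
        (subordinated_density f x t - 1 / 2 * deriv (deriv (\<lambda>y. subordinated_density f y t)) x)"
      using vg_kernel_series(2)[OF t x] by (simp only: law[OF t] it[OF t])
    then have sm: "summable (\<lambda>n. (- 1) ^ n / fact n * (caputo \<nu> ^^ n) u t)"
      and se: "caputo_shift \<nu> (- 1) u t = subordinated_density f x t - 1 / 2 * deriv (deriv (\<lambda>y. subordinated_density f y t)) x"
      by (simp_all only: sums_iff caputo_shift_def)
    have "twice_differentiable_at (\<lambda>y. subordinated_density f y t) x" by (rule vg_kernel_series(1)[OF t x])
    moreover have "caputo_shift_exists \<nu> (- 1) u t"
      using ex sm by (simp add: caputo_shift_exists_def)
    moreover have "(\<lambda>s. subordinated_density f x s) = u" by (simp add: u_def fun_eq_iff)
    ultimately show "twice_differentiable_at (\<lambda>y. subordinated_density f y t) x \<and>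
             caputo_shift_exists \<nu> (- 1) (\<lambda>s. subordinated_density f x s) t \<and>
             1 / 2 * deriv (deriv (\<lambda>y. subordinated_density f y t)) x =
               subordinated_density f x t
               - caputo_shift \<nu> (- 1) (\<lambda>s. subordinated_density f x s) t"
      using se by simp
  qed
qed

section \<open>Laplace integrals and the right-sided Riemann--Liouville derivative\<close>

lemma has_bochner_integral_shifted_gamma:
  assumes p: "- 1 < p" and l: "0 < (l::real)"
  shows "has_bochner_integral lborel (\<lambda>s. indicator {t<..} s *\<^sub>R ((s - t) powr p * exp (- (l * s))))
    (exp (- (l * t)) * (Gamma (p + 1) / l powr (p + 1)))"
proof -
  let ?f = "\<lambda>r. indicator {0<..} r *\<^sub>R (r powr (p + 1 - 1) * exp (- (l * r)))"
  have "has_bochner_integral lborel ?f (Gamma (p + 1) / l powr (p + 1))"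
    using set_integrable_powr_exp[of "p + 1" l] LINT_powr_exp[of "p + 1" l] p l
    by (simp add: has_bochner_integral_iff set_integrable_def set_lebesgue_integral_def)
  then have "has_bochner_integral lborel (\<lambda>s. ?f (- t + 1 * s)) (Gamma (p + 1) / l powr (p + 1))"
    using lborel_has_bochner_integral_real_affine_iff[of 1 ?f "Gamma (p + 1) / l powr (p + 1)" "- t"] by simp
  then have "has_bochner_integral lborel (\<lambda>s. exp (- (l * t)) * ?f (- t + 1 * s)) (exp (- (l * t)) * (Gamma (p + 1) / l powr (p + 1)))"
    by (rule has_bochner_integral_mult_right)
  moreover have "exp (- (l * t)) * ?f (- t + 1 * s) = indicator {t<..} s *\<^sub>R ((s - t) powr p * exp (- (l * s)))" for s
  proof -
    have "exp (- (l * t)) * exp (- (l * (s - t))) = exp (- (l * s))"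
      by (simp add: exp_add[symmetric] algebra_simps)
    then show ?thesis by (auto simp: indicator_def mult_ac)
  qed
  ultimately show ?thesis by (simp only:)
qed

lemma rl_order_bounds:
  assumes "1 < \<nu>" "\<nu> \<notin> \<nat>"
  shows "\<nu> < real (rl_order \<nu>)" "real (rl_order \<nu>) < \<nu> + 1"
proof -
  have c: "real (rl_order \<nu>) = of_int \<lceil>\<nu>\<rceil>" using assms by (simp add: rl_order_def)
  have "real (rl_order \<nu>) \<noteq> \<nu>"
    using assms(2) of_nat_in_Nats[of "rl_order \<nu>", where 'a = real] by metis
  then show "\<nu> < real (rl_order \<nu>)" "real (rl_order \<nu>) < \<nu> + 1" unfolding c by linarith+
qed

lemma has_bochner_integral_tail_kernel:
  fixes \<beta> l t p q :: real
  assumes b: "0 < \<beta>" "\<beta> < 1" and l: "0 < l"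
  shows "has_bochner_integral lborel (\<lambda>s. indicator {t<..} s *\<^sub>R (((s * p) + q) * exp (- (s * l)) / (s - t) powr \<beta>))
     (Gamma (1 - \<beta>) * ((p * t + q) * l powr (\<beta> - 1) + p * (1 - \<beta>) * l powr (\<beta> - 2)) * exp (- (t * l)))"
proof -
  have Gb: "Gamma (1 - \<beta> + 1) = (1 - \<beta>) * Gamma (1 - \<beta>)"
    using b by (intro Gamma_plus1) (auto elim!: nonpos_Ints_cases)
  show ?thesis
  proof -
    have "has_bochner_integral lborel (\<lambda>s. (p * t + q) * (indicator {t<..} s *\<^sub>R ((s - t) powr (- \<beta>) * exp (- (l * s)))) + p * (indicator {t<..} s *\<^sub>R ((s - t) powr (1 - \<beta>) * exp (- (l * s)))))
      ((p * t + q) * (exp (- (l * t)) * (Gamma (- \<beta> + 1) / l powr (- \<beta> + 1))) + p * (exp (- (l * t)) * (Gamma (1 - \<beta> + 1) / l powr (1 - \<beta> + 1))))"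
      using b l by (intro has_bochner_integral_add has_bochner_integral_mult_right has_bochner_integral_shifted_gamma) auto
    moreover have "(p * t + q) * (indicator {t<..} s *\<^sub>R ((s - t) powr (- \<beta>) * exp (- (l * s)))) + p * (indicator {t<..} s *\<^sub>R ((s - t) powr (1 - \<beta>) * exp (- (l * s))))
       = indicator {t<..} s *\<^sub>R (((s * p) + q) * exp (- (s * l)) / (s - t) powr \<beta>)" for s
    proof (cases "t < s")
      case True
      have 1: "(s - t) powr (1 - \<beta>) = (s - t) / (s - t) powr \<beta>" using True by (simp add: powr_diff)
      have 2: "(s - t) powr (- \<beta>) = 1 / (s - t) powr \<beta>" by (rule powr_minus_divide)
      show ?thesis using True unfolding 1 2 by (simp add: field_simps)
    qed simp
    moreover have "(p * t + q) * (exp (- (l * t)) * (Gamma (- \<beta> + 1) / l powr (- \<beta> + 1))) + p * (exp (- (l * t)) * (Gamma (1 - \<beta> + 1) / l powr (1 - \<beta> + 1)))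
       = Gamma (1 - \<beta>) * ((p * t + q) * l powr (\<beta> - 1) + p * (1 - \<beta>) * l powr (\<beta> - 2)) * exp (- (t * l))"
    proof -
      have 1: "l powr (\<beta> - 1) = 1 / l powr (- \<beta> + 1)" "l powr (\<beta> - 2) = 1 / l powr (1 - \<beta> + 1)"
        using powr_minus_divide[of l "- \<beta> + 1"] powr_minus_divide[of l "1 - \<beta> + 1"] by simp_all
      have 2: "- \<beta> + 1 = 1 - \<beta>" by simp
      show ?thesis unfolding 1 Gb unfolding 2 by (simp add: algebra_simps)
    qed
    ultimately show ?thesis by (simp only:)
  qed
qed

text \<open>The sign near the origin is used only to recover absolute integrability of \<open>S\<close> from the convergence of a tail integral.\<close>

locale laplace_family =
  fixes S :: "real \<Rightarrow> real" and c \<delta> :: real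
  assumes S_measurable [measurable]: "S \<in> borel_measurable borel"
    and S_bound: "\<And>l. \<bar>S l\<bar> \<le> c"
    and \<delta>: "0 < \<delta>" and S_nonneg: "\<And>l. 0 < l \<Longrightarrow> l < \<delta> \<Longrightarrow> 0 \<le> S l"
begin

text \<open>Formally \<open>w a t l\<close> is \<open>- S l\<close> times the \<open>l\<close>-derivative of \<open>l^a e^(-t l)\<close>. On \<open>l^a e^(-t l)\<close> a right-sided derivative in \<open>t\<close> of order \<open>b\<close> multiplies by \<open>l^b\<close>, hence it maps \<open>w a\<close> to \<open>w (a + b)\<close>.\<close>

definition w :: "real \<Rightarrow> real \<Rightarrow> real \<Rightarrow> real" where
  "w a t l = S l * ((t * l powr a - a * l powr (a - 1)) * exp (- (t * l)))"

definition W :: "real \<Rightarrow> real \<Rightarrow> real" where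
  "W a t = (LINT l:{0<..}|lborel. w a t l)"

text \<open>This makes both summands of \<open>w a t\<close> integrable. At \<open>a = 0\<close> the second summand has the factor zero, so that \<open>W 0\<close> exists although \<open>strong 0\<close> may fail; hence the alternative \<open>a = 0\<close> in the lemmas below.\<close>

definition strong :: "real \<Rightarrow> bool" where
  "strong a \<longleftrightarrow> - 1 < a \<and>
     (\<forall>t>0. set_integrable lborel {0<..} (\<lambda>l. S l * (l powr (a - 1) * exp (- (t * l)))))"

lemma c_nonneg: "0 \<le> c"
  using S_bound[of 0] by linarith

lemma S_powr_integrable:
  assumes "- 1 < a" "0 < t"
  shows "set_integrable lborel {0<..} (\<lambda>l. S l * (l powr a * exp (- (t * l))))"
  using set_integrable_bounded_mult[OF set_integrable_powr_exp[of "a + 1" t], of S c] assms S_bound by simp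

lemma strong_pos: "0 < a \<Longrightarrow> strong a"
  unfolding strong_def using S_powr_integrable[of "a - 1"] by simp

lemma w_split: "w a t l = t * (S l * (l powr a * exp (- (t * l)))) - a * (S l * (l powr (a - 1) * exp (- (t * l))))"
  by (simp add: w_def algebra_simps)

lemma w_integrable:
  assumes a: "a = 0 \<or> strong a" and t: "0 < t"
  shows "set_integrable lborel {0<..} (w a t)"
proof -
  have 1: "set_integrable lborel {0<..} (\<lambda>l. t * (S l * (l powr a * exp (- (t * l)))))"
    using a t by (intro set_integrable_mult_right S_powr_integrable) (auto simp: strong_def)
  have 2: "set_integrable lborel {0<..} (\<lambda>l. a * (S l * (l powr (a - 1) * exp (- (t * l)))))"
  proof (cases "a = 0")
    case False
    then show ?thesis using a t by (intro set_integrable_mult_right) (auto simp: strong_def)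
  qed (simp add: set_integrable_def)
  show ?thesis unfolding w_split[abs_def] by (rule set_integral_diff(1)[OF 1 2])
qed

lemma W_deriv:
  assumes a: "a = 0 \<or> strong a" and t: "0 < t"
  shows "(W a has_real_derivative - W (a + 1) t) (at t)"
proof -
  have a1: "- 1 < a" using a by (auto simp: strong_def)
  let ?D = "\<lambda>l. c * ((2 * t) * (l powr (a + 2 - 1) * exp (- (t / 2 * l))) + \<bar>a + 1\<bar> * (l powr (a + 1 - 1) * exp (- (t / 2 * l))))"
  have "((\<lambda>t. LINT l:{0<..}|lborel. w a t l) has_real_derivative (LINT l:{0<..}|lborel. - w (a + 1) t l)) (at t)"
  proof (rule has_real_derivative_under_set_integral[of t "t / 2" "2 * t", where D = ?D])
    show "t \<in> {t / 2<..<2 * t}" using t by simp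
    show "set_integrable lborel {0<..} ?D"
      using a1 t by (intro set_integrable_mult_right set_integral_add(1) set_integrable_powr_exp) auto
    fix y assume "y \<in> {t / 2<..<2 * t}"
    then have y: "0 < y" "t / 2 \<le> y" "y \<le> 2 * t" using t by auto
    show "set_integrable lborel {0<..} (w a y)" by (rule w_integrable[OF a y(1)])
    fix l :: real assume "l \<in> {0<..}"
    then have l: "0 < l" by simp
    have p: "l powr (a + 1) = l * l powr a" "l powr a = l * l powr (a - 1)" "a + 1 - 1 = a"
      using l powr_mult_base[of l a] powr_mult_base[of l "a - 1"] by (simp_all add: add.commute)
    show "((\<lambda>y. w a y l) has_real_derivative - w (a + 1) y l) (at y)"
      unfolding w_def
      by (auto intro!: derivative_eq_intros simp: p(1,3)) (simp add: p(2) algebra_simps)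
    have e: "exp (- (y * l)) \<le> exp (- (t / 2 * l))" using y l by simp
    have "\<bar>w (a + 1) y l\<bar> = \<bar>S l\<bar> * (\<bar>y * l powr (a + 1) - (a + 1) * l powr a\<bar> * exp (- (y * l)))"
      by (simp add: w_def abs_mult p(3))
    also have "\<dots> \<le> c * ((2 * t * l powr (a + 1) + \<bar>a + 1\<bar> * l powr a) * exp (- (t / 2 * l)))"
    proof (intro mult_mono S_bound e c_nonneg)
      have "\<bar>y * l powr (a + 1) - (a + 1) * l powr a\<bar> \<le> \<bar>y * l powr (a + 1)\<bar> + \<bar>(a + 1) * l powr a\<bar>"
        by (rule abs_triangle_ineq4)
      also have "\<dots> \<le> 2 * t * l powr (a + 1) + \<bar>a + 1\<bar> * l powr a"
        using y by (intro add_mono) (auto simp: abs_mult intro!: mult_right_mono)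
      finally show "\<bar>y * l powr (a + 1) - (a + 1) * l powr a\<bar> \<le> 2 * t * l powr (a + 1) + \<bar>a + 1\<bar> * l powr a" .
    qed (use t in auto)
    also have "\<dots> = ?D l" by (simp add: algebra_simps)
    finally show "\<bar>- w (a + 1) y l\<bar> \<le> ?D l" by simp
  qed
  moreover have "(LINT l:{0<..}|lborel. - w (a + 1) t l) = - W (a + 1) t"
    unfolding W_def by (simp add: set_lebesgue_integral_def)
  ultimately show ?thesis unfolding W_def[abs_def] by simp
qed

lemma deriv_funpow_W:
  assumes a: "a = 0 \<or> strong a" and v: "\<And>t. 0 < t \<Longrightarrow> v t = C * W a t" and t: "0 < t"
  shows "(deriv ^^ k) v t = C * ((- 1) ^ k * W (a + real k) t)"
    and "(deriv ^^ k) v differentiable (at t)"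
proof -
  have a1: "- 1 < a" using a by (auto simp: strong_def)
  have ad: "a + real k = 0 \<or> strong (a + real k)" for k
  proof (cases k)
    case (Suc j) then show ?thesis using a1 by (intro disjI2 strong_pos) simp
  qed (use a in simp)
  have D: "((deriv ^^ k) v has_real_derivative C * ((- 1) ^ Suc k * W (a + real (Suc k)) t)) (at t)"
    if "0 < t" "\<And>t. 0 < t \<Longrightarrow> (deriv ^^ k) v t = C * ((- 1) ^ k * W (a + real k) t)" for k t
  proof -
    have "((\<lambda>t. C * ((- 1) ^ k * W (a + real k) t)) has_real_derivative C * ((- 1) ^ k * - W (a + real k + 1) t)) (at t)"
      by (intro DERIV_cmult W_deriv ad that)
    then have "((\<lambda>t. C * ((- 1) ^ k * W (a + real k) t)) has_real_derivative C * ((- 1) ^ Suc k * W (a + real (Suc k)) t)) (at t)"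
      by (simp add: add_ac)
    then show ?thesis
      by (rule has_field_derivative_transform_within_open[of _ _ _ "{0<..}"]) (use that in auto)
  qed
  have *: "(deriv ^^ k) v t = C * ((- 1) ^ k * W (a + real k) t)" if "0 < t" for k t
    using that
  proof (induction k arbitrary: t)
    case 0 then show ?case using v by simp
  next
    case (Suc k)
    have "deriv ((deriv ^^ k) v) t = C * ((- 1) ^ Suc k * W (a + real (Suc k)) t)"
      by (rule DERIV_imp_deriv[OF D[OF Suc.prems Suc.IH]])
    then show ?case by simp
  qed
  show "(deriv ^^ k) v t = C * ((- 1) ^ k * W (a + real k) t)" by (rule *[OF t])
  show "(deriv ^^ k) v differentiable (at t)"
    using D[OF t *] by (auto simp: real_differentiable_def)
qed

text \<open>By Fubini's theorem the tail integral acts on the exponentials, where it is a shifted Gamma integral.\<close>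

lemma tail:
  assumes a: "a = 0 \<or> strong a" and b: "0 < \<beta>" "\<beta> < 1" and ab: "strong (a + \<beta> - 1)" and t: "0 < t"
  shows "set_integrable lborel {t<..} (\<lambda>s. W a s / (s - t) powr \<beta>)"
    and "(LINT s:{t<..}|lborel. W a s / (s - t) powr \<beta>) = Gamma (1 - \<beta>) * W (a + \<beta> - 1) t"
proof -
  have a1: "- 1 < a" using a by (auto simp: strong_def)
  define F where "F l s = indicator {0<..} l *\<^sub>R (indicator {t<..} s *\<^sub>R (w a s l / (s - t) powr \<beta>))" for l s
  note key = has_bochner_integral_tail_kernel[OF b]
  have Gp: "0 < Gamma (1 - \<beta>)" using b by (intro Gamma_real_pos) simp
  have pw: "l powr (a + \<beta> - 1) = l powr a * l powr (\<beta> - 1)" "l powr (a + \<beta> - 1 - 1) = l powr (a - 1) * l powr (\<beta> - 1)"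
     "l powr (a + \<beta> - 1 - 1) = l powr a * l powr (\<beta> - 2)" for l
    by (simp_all add: powr_add[symmetric] algebra_simps)
  have Fs: "has_bochner_integral lborel (F l) (indicator {0<..} l *\<^sub>R (Gamma (1 - \<beta>) * w (a + \<beta> - 1) t l))" for l
  proof (cases "0 < l")
    case True
    have 1: "S l * (Gamma (1 - \<beta>) * ((l powr a * t + - a * l powr (a - 1)) * l powr (\<beta> - 1) + l powr a * (1 - \<beta>) * l powr (\<beta> - 2)) * exp (- (t * l)))
      = Gamma (1 - \<beta>) * w (a + \<beta> - 1) t l"
    proof -
      have "(l powr a * t + - a * l powr (a - 1)) * l powr (\<beta> - 1) + l powr a * (1 - \<beta>) * l powr (\<beta> - 2)
        = t * (l powr a * l powr (\<beta> - 1)) - a * (l powr (a - 1) * l powr (\<beta> - 1)) + (1 - \<beta>) * (l powr a * l powr (\<beta> - 2))"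
        by (simp add: algebra_simps)
      also have "\<dots> = t * l powr (a + \<beta> - 1) - (a + \<beta> - 1) * l powr (a + \<beta> - 1 - 1)"
        unfolding pw(1)[symmetric] pw(2)[symmetric] pw(3)[symmetric] by (simp add: algebra_simps)
      finally show ?thesis by (simp add: w_def mult_ac)
    qed
    have 2: "S l * (indicator {t<..} s *\<^sub>R ((s * l powr a + - a * l powr (a - 1)) * exp (- (s * l)) / (s - t) powr \<beta>)) = F l s" for s
      using True by (simp add: F_def w_def indicator_def)
    have "has_bochner_integral lborel (\<lambda>s. S l * (indicator {t<..} s *\<^sub>R ((s * l powr a + - a * l powr (a - 1)) * exp (- (s * l)) / (s - t) powr \<beta>)))
      (S l * (Gamma (1 - \<beta>) * ((l powr a * t + - a * l powr (a - 1)) * l powr (\<beta> - 1) + l powr a * (1 - \<beta>) * l powr (\<beta> - 2)) * exp (- (t * l))))"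
      by (rule has_bochner_integral_mult_right[OF key[OF True]])
    then show ?thesis unfolding 1 2 using True by simp
  next
    case False
    then have "F l = (\<lambda>_. 0)" by (auto simp: F_def fun_eq_iff)
    then show ?thesis using False has_bochner_integral_zero[of lborel, where 'b = real] by simp
  qed
  let ?G = "\<lambda>l. indicator {0<..} l *\<^sub>R (Gamma (1 - \<beta>) * (t * \<bar>S l * (l powr (a + \<beta> - 1) * exp (- (t * l)))\<bar> + (\<bar>a\<bar> + (1 - \<beta>)) * \<bar>S l * (l powr (a + \<beta> - 1 - 1) * exp (- (t * l)))\<bar>))"
  have Gi: "integrable lborel ?G"
  proof -
    have "set_integrable lborel {0<..} (\<lambda>l. Gamma (1 - \<beta>) * (t * \<bar>S l * (l powr (a + \<beta> - 1) * exp (- (t * l)))\<bar> + (\<bar>a\<bar> + (1 - \<beta>)) * \<bar>S l * (l powr (a + \<beta> - 1 - 1) * exp (- (t * l)))\<bar>))"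
    proof (intro set_integrable_mult_right set_integral_add(1) set_integrable_abs)
      show "set_integrable lborel {0<..} (\<lambda>l. S l * (l powr (a + \<beta> - 1) * exp (- (t * l))))"
        using ab t by (intro S_powr_integrable) (simp_all add: strong_def)
      show "set_integrable lborel {0<..} (\<lambda>l. S l * (l powr (a + \<beta> - 1 - 1) * exp (- (t * l))))"
        using ab t by (simp add: strong_def)
    qed
    then show ?thesis by (simp add: set_integrable_def)
  qed
  have Fm[measurable]: "case_prod F \<in> borel_measurable (lborel \<Otimes>\<^sub>M lborel)"
    unfolding F_def w_def by measurable
  have nF: "(LINT s|lborel. norm (F l s)) \<le> ?G l" for l
  proof (cases "0 < l")
    case True
    have i: "has_bochner_integral lborel (\<lambda>s. \<bar>S l\<bar> * (indicator {t<..} s *\<^sub>R ((s * l powr a + \<bar>a\<bar> * l powr (a - 1)) * exp (- (s * l)) / (s - t) powr \<beta>)))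
      (\<bar>S l\<bar> * (Gamma (1 - \<beta>) * ((l powr a * t + \<bar>a\<bar> * l powr (a - 1)) * l powr (\<beta> - 1) + l powr a * (1 - \<beta>) * l powr (\<beta> - 2)) * exp (- (t * l))))"
      by (rule has_bochner_integral_mult_right[OF key[OF True]])
    have "(LINT s|lborel. norm (F l s)) \<le> (LINT s|lborel. \<bar>S l\<bar> * (indicator {t<..} s *\<^sub>R ((s * l powr a + \<bar>a\<bar> * l powr (a - 1)) * exp (- (s * l)) / (s - t) powr \<beta>)))"
    proof (rule integral_mono)
      show "integrable lborel (\<lambda>s. norm (F l s))"
        using Fs[of l] by (auto simp: has_bochner_integral_iff)
      show "integrable lborel (\<lambda>s. \<bar>S l\<bar> * (indicator {t<..} s *\<^sub>R ((s * l powr a + \<bar>a\<bar> * l powr (a - 1)) * exp (- (s * l)) / (s - t) powr \<beta>)))"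
        using i by (simp only: has_bochner_integral_iff)
      fix s
      show "norm (F l s) \<le> \<bar>S l\<bar> * (indicator {t<..} s *\<^sub>R ((s * l powr a + \<bar>a\<bar> * l powr (a - 1)) * exp (- (s * l)) / (s - t) powr \<beta>))"
      proof (cases "t < s")
        case s: True
        have "\<bar>s * l powr a - a * l powr (a - 1)\<bar> \<le> \<bar>s * l powr a\<bar> + \<bar>a * l powr (a - 1)\<bar>" by (rule abs_triangle_ineq4)
        also have "\<dots> = s * l powr a + \<bar>a\<bar> * l powr (a - 1)" using s t by (simp add: abs_mult)
        finally have "\<bar>S l\<bar> * (\<bar>s * l powr a - a * l powr (a - 1)\<bar> * exp (- (s * l)) / (s - t) powr \<beta>) \<le> \<bar>S l\<bar> * ((s * l powr a + \<bar>a\<bar> * l powr (a - 1)) * exp (- (s * l)) / (s - t) powr \<beta>)"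
          by (intro mult_left_mono divide_right_mono mult_right_mono) auto
        then show ?thesis using s True by (simp add: F_def w_def abs_mult)
      qed (simp add: F_def)
    qed
    also have "\<dots> = \<bar>S l\<bar> * (Gamma (1 - \<beta>) * ((l powr a * t + \<bar>a\<bar> * l powr (a - 1)) * l powr (\<beta> - 1) + l powr a * (1 - \<beta>) * l powr (\<beta> - 2)) * exp (- (t * l)))"
      using i by (simp only: has_bochner_integral_iff)
    also have "(l powr a * t + \<bar>a\<bar> * l powr (a - 1)) * l powr (\<beta> - 1) + l powr a * (1 - \<beta>) * l powr (\<beta> - 2)
        = t * (l powr a * l powr (\<beta> - 1)) + \<bar>a\<bar> * (l powr (a - 1) * l powr (\<beta> - 1)) + (1 - \<beta>) * (l powr a * l powr (\<beta> - 2))"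
        by (simp add: algebra_simps)
    also have "\<dots> = t * l powr (a + \<beta> - 1) + (\<bar>a\<bar> + (1 - \<beta>)) * l powr (a + \<beta> - 1 - 1)"
        unfolding pw(1)[symmetric] pw(2)[symmetric] pw(3)[symmetric] by (simp add: algebra_simps)
    finally show ?thesis using True by (simp add: abs_mult algebra_simps)
  qed (simp add: F_def)
  have Fi: "integrable (lborel \<Otimes>\<^sub>M lborel) (case_prod F)"
  proof (rule lborel_pair.Fubini_integrable[OF Fm])
    show "AE l in lborel. integrable lborel (\<lambda>s. case_prod F (l, s))"
      using Fs by (auto simp: has_bochner_integral_iff)
    show "integrable lborel (\<lambda>l. LINT s|lborel. norm (case_prod F (l, s)))"
    proof (rule Bochner_Integration.integrable_bound[OF Gi])
      show "(\<lambda>l. LINT s|lborel. norm (case_prod F (l, s))) \<in> borel_measurable lborel" by measurable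
      have "norm (LINT s|lborel. norm (case_prod F (l, s))) \<le> norm (?G l)" for l
      proof -
        have "0 \<le> (LINT s|lborel. norm (F l s))" by simp
        then show ?thesis using nF[of l] by simp
      qed
      then show "AE l in lborel. norm (LINT s|lborel. norm (case_prod F (l, s))) \<le> norm (?G l)" by simp
    qed
  qed
  have Fl: "(LINT l|lborel. F l s) = indicator {t<..} s *\<^sub>R (W a s / (s - t) powr \<beta>)" for s
  proof (cases "t < s")
    case True
    then have "(LINT l|lborel. F l s) = (LINT l|lborel. (indicator {0<..} l *\<^sub>R w a s l) / (s - t) powr \<beta>)"
      by (simp add: F_def)
    also have "\<dots> = W a s / (s - t) powr \<beta>"
      unfolding W_def set_lebesgue_integral_def by (rule integral_divide_zero)
    finally show ?thesis using True by simp
  qed (simp add: F_def)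
  show "set_integrable lborel {t<..} (\<lambda>s. W a s / (s - t) powr \<beta>)"
    using lborel_pair.integrable_snd[OF Fi] unfolding set_integrable_def Fl .
  have "(LINT s:{t<..}|lborel. W a s / (s - t) powr \<beta>) = (LINT s|lborel. LINT l|lborel. F l s)"
    unfolding set_lebesgue_integral_def Fl ..
  also have "\<dots> = (LINT l|lborel. LINT s|lborel. F l s)" by (rule lborel_pair.Fubini_integral[OF Fi])
  also have "\<dots> = (LINT l|lborel. Gamma (1 - \<beta>) * (indicator {0<..} l *\<^sub>R w (a + \<beta> - 1) t l))"
    using Fs by (intro Bochner_Integration.integral_cong refl) (auto simp: has_bochner_integral_iff)
  also have "\<dots> = Gamma (1 - \<beta>) * W (a + \<beta> - 1) t"
    unfolding W_def set_lebesgue_integral_def by (rule integral_mult_right_zero)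
  finally show "(LINT s:{t<..}|lborel. W a s / (s - t) powr \<beta>) = Gamma (1 - \<beta>) * W (a + \<beta> - 1) t" .
qed

text \<open>Adding \<open>c\<close> to \<open>S\<close> away from the origin makes it nonnegative and changes \<open>W 0 s\<close> by the harmless \<open>c e^(-s d)\<close>. Then Tonelli's theorem applies to the convergent tail integral and gives integrability against \<open>l^(\<beta>-2) e^(-t l)\<close>.\<close>

lemma strong_of_tail:
  assumes b: "0 < \<beta>" "\<beta> < 1" and t: "0 < t"
    and h: "set_integrable lborel {t<..} (\<lambda>s. W 0 s / (s - t) powr \<beta>)"
  shows "strong (\<beta> - 1)"
proof -
  \<comment> \<open>strictly below \<open>\<delta>\<close>, so that \<open>S\<close> is nonnegative also at \<open>d\<close> itself\<close>
  define d where "d = \<delta> / 2"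
  have d: "0 < d" "d < \<delta>" using \<delta> by (auto simp: d_def)
  define S' where "S' l = S l + c * indicator {d<..} l" for l
  have S'0: "0 \<le> S' l" if "0 < l" for l
  proof (cases "d < l")
    case True then show ?thesis using S_bound[of l] by (simp add: S'_def)
  next
    case False then show ?thesis using that d S_nonneg[of l] by (simp add: S'_def)
  qed
  have [measurable]: "S' \<in> borel_measurable borel" by (simp add: S'_def[abs_def])
  have Gp: "0 < Gamma (1 - \<beta>)" using b by (intro Gamma_real_pos) simp
  have W': "has_bochner_integral lborel (\<lambda>l. indicator {0<..} l *\<^sub>R (S' l * (s * exp (- (s * l))))) (W 0 s + c * exp (- (s * d)))"
    if s: "0 < s" for s
  proof -
    have 1: "has_bochner_integral lborel (\<lambda>l. indicator {0<..} l *\<^sub>R w 0 s l) (W 0 s)"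
      using w_integrable[of 0 s] s by (simp add: has_bochner_integral_iff W_def set_integrable_def set_lebesgue_integral_def)
    have 2: "has_bochner_integral lborel (\<lambda>l. c * s * (indicator {d<..} l *\<^sub>R ((l - d) powr 0 * exp (- (s * l)))))
        (c * s * (exp (- (s * d)) * (Gamma (0 + 1) / s powr (0 + 1))))"
      using s by (intro has_bochner_integral_mult_right has_bochner_integral_shifted_gamma) auto
    have 3: "indicator {0<..} l *\<^sub>R w 0 s l + c * s * (indicator {d<..} l *\<^sub>R ((l - d) powr 0 * exp (- (s * l))))
        = indicator {0<..} l *\<^sub>R (S' l * (s * exp (- (s * l))))" for l
      using d by (auto simp: w_def S'_def indicator_def algebra_simps)
    have 4: "c * s * (exp (- (s * d)) * (Gamma (0 + 1) / s powr (0 + 1))) = c * exp (- (s * d))"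
      using s by simp
    show ?thesis using has_bochner_integral_add[OF 1 2] unfolding 3 4 .
  qed
  define H where "H s = indicator {t<..} s *\<^sub>R ((W 0 s + c * exp (- (s * d))) / (s - t) powr \<beta>)" for s
  have Hi: "integrable lborel H"
  proof -
    have 1: "integrable lborel (\<lambda>s. indicator {t<..} s *\<^sub>R (W 0 s / (s - t) powr \<beta>))"
      using h by (simp add: set_integrable_def)
    have 2: "integrable lborel (\<lambda>s. c * (indicator {t<..} s *\<^sub>R ((s * 0 + 1) * exp (- (s * d)) / (s - t) powr \<beta>)))"
      using has_bochner_integral_tail_kernel[OF b d(1), of t 0 1]
      by (intro integrable_mult_right) (simp only: has_bochner_integral_iff)
    have 3: "indicator {t<..} s *\<^sub>R (W 0 s / (s - t) powr \<beta>) + c * (indicator {t<..} s *\<^sub>R ((s * 0 + 1) * exp (- (s * d)) / (s - t) powr \<beta>)) = H s" for s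
      by (simp add: H_def indicator_def add_divide_distrib)
    show ?thesis using Bochner_Integration.integrable_add[OF 1 2] unfolding 3 .
  qed
  define F where "F s l = ennreal (indicator {0<..} l * S' l) * ennreal (indicator {t<..} s *\<^sub>R ((s * 1 + 0) * exp (- (s * l)) / (s - t) powr \<beta>))" for s l
  have Fm: "case_prod F \<in> borel_measurable (lborel \<Otimes>\<^sub>M lborel)"
    unfolding F_def by measurable
  have Fs: "(\<integral>\<^sup>+l. F s l \<partial>lborel) = ennreal (H s)" for s
  proof (cases "t < s")
    case True
    then have s: "0 < s" using t by simp
    have "(\<integral>\<^sup>+l. F s l \<partial>lborel) = (\<integral>\<^sup>+l. ennreal (1 / (s - t) powr \<beta> * (indicator {0<..} l *\<^sub>R (S' l * (s * exp (- (s * l)))))) \<partial>lborel)"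
      using True s S'0 by (intro nn_integral_cong) (auto simp: F_def indicator_def ennreal_mult'[symmetric] mult_ac)
    also have "\<dots> = ennreal (LINT l|lborel. 1 / (s - t) powr \<beta> * (indicator {0<..} l *\<^sub>R (S' l * (s * exp (- (s * l))))))"
      using W'[OF s] S'0 s
      by (intro nn_integral_eq_integral integrable_mult_right) (auto simp: has_bochner_integral_iff indicator_def)
    also have "(LINT l|lborel. 1 / (s - t) powr \<beta> * (indicator {0<..} l *\<^sub>R (S' l * (s * exp (- (s * l)))))) = H s"
      using W'[OF s] True by (simp only: has_bochner_integral_iff integral_mult_right_zero) (simp add: H_def)
    finally show ?thesis .
  qed (simp add: F_def H_def)
  have H0: "0 \<le> H s" for s
  proof (cases "t < s")
    case True
    then have s: "0 < s" using t by simp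
    have "0 \<le> (LINT l|lborel. indicator {0<..} l *\<^sub>R (S' l * (s * exp (- (s * l)))))"
      using S'0 s by (intro integral_nonneg_AE) (auto simp: indicator_def)
    then show ?thesis using W'[OF s] True by (simp add: H_def has_bochner_integral_iff)
  qed (simp add: H_def)
  have "(\<integral>\<^sup>+l. (\<integral>\<^sup>+s. F s l \<partial>lborel) \<partial>lborel) = (\<integral>\<^sup>+s. (\<integral>\<^sup>+l. F s l \<partial>lborel) \<partial>lborel)"
    by (rule lborel_pair.Fubini'[OF Fm])
  also have "\<dots> = ennreal (LINT s|lborel. H s)"
    unfolding Fs using H0 by (intro nn_integral_eq_integral Hi) auto
  finally have fin: "(\<integral>\<^sup>+l. (\<integral>\<^sup>+s. F s l \<partial>lborel) \<partial>lborel) < \<top>" by simp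
  let ?k = "\<lambda>l. Gamma (1 - \<beta>) * (1 - \<beta>) * (S' l * (l powr (\<beta> - 1 - 1) * exp (- (t * l))))"
  have le: "ennreal (indicator {0<..} l *\<^sub>R ?k l) \<le> (\<integral>\<^sup>+s. F s l \<partial>lborel)" for l
  proof (cases "0 < l")
    case True
    note k = has_bochner_integral_tail_kernel[OF b True, of t 1 0]
    have "(\<integral>\<^sup>+s. F s l \<partial>lborel) = ennreal (S' l) * (\<integral>\<^sup>+s. ennreal (indicator {t<..} s *\<^sub>R ((s * 1 + 0) * exp (- (s * l)) / (s - t) powr \<beta>)) \<partial>lborel)"
      unfolding F_def using True by (subst nn_integral_cmult) auto
    also have "(\<integral>\<^sup>+s. ennreal (indicator {t<..} s *\<^sub>R ((s * 1 + 0) * exp (- (s * l)) / (s - t) powr \<beta>)) \<partial>lborel)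
        = ennreal (LINT s|lborel. indicator {t<..} s *\<^sub>R ((s * 1 + 0) * exp (- (s * l)) / (s - t) powr \<beta>))"
      using k t by (intro nn_integral_eq_integral) (auto simp: has_bochner_integral_iff indicator_def)
    also have "(LINT s|lborel. indicator {t<..} s *\<^sub>R ((s * 1 + 0) * exp (- (s * l)) / (s - t) powr \<beta>))
        = Gamma (1 - \<beta>) * ((1 * t + 0) * l powr (\<beta> - 1) + 1 * (1 - \<beta>) * l powr (\<beta> - 2)) * exp (- (t * l))"
      using k by (simp only: has_bochner_integral_iff)
    finally have e: "(\<integral>\<^sup>+s. F s l \<partial>lborel) = ennreal (S' l) * ennreal (Gamma (1 - \<beta>) * ((1 * t + 0) * l powr (\<beta> - 1) + 1 * (1 - \<beta>) * l powr (\<beta> - 2)) * exp (- (t * l)))" .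
    have "ennreal (?k l) = ennreal (S' l) * ennreal (Gamma (1 - \<beta>) * ((1 - \<beta>) * l powr (\<beta> - 2)) * exp (- (t * l)))"
      using S'0[OF True] by (simp add: ennreal_mult'[symmetric] mult_ac)
    also have "\<dots> \<le> (\<integral>\<^sup>+s. F s l \<partial>lborel)"
      unfolding e using b t Gp
      by (intro mult_left_mono ennreal_leI mult_right_mono) (auto intro!: mult_left_mono)
    finally show ?thesis using True by simp
  qed simp
  have "integrable lborel (\<lambda>l. indicator {0<..} l *\<^sub>R ?k l)"
  proof (rule integrableI_nonneg)
    show "AE l in lborel. 0 \<le> indicator {0<..} l *\<^sub>R ?k l"
      using b Gp S'0 by (auto simp: indicator_def)
    show "(\<integral>\<^sup>+l. ennreal (indicator {0<..} l *\<^sub>R ?k l) \<partial>lborel) < \<infinity>"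
      using order_le_less_trans[OF nn_integral_mono[OF le] fin] by simp
  qed measurable
  then have ki: "integrable lborel (\<lambda>l. (1 / (Gamma (1 - \<beta>) * (1 - \<beta>))) * (indicator {0<..} l *\<^sub>R ?k l))"
    by (rule integrable_mult_right)
  have ke: "(1 / (Gamma (1 - \<beta>) * (1 - \<beta>))) * (indicator {0<..} l *\<^sub>R ?k l)
      = indicator {0<..} l *\<^sub>R (S' l * (l powr (\<beta> - 1 - 1) * exp (- (t * l))))" for l
  proof -
    have "Gamma (1 - \<beta>) \<noteq> 0" by (rule less_imp_neq[OF Gp, symmetric])
    then show ?thesis using b by simp
  qed
  have S'i: "set_integrable lborel {0<..} (\<lambda>l. S' l * (l powr (\<beta> - 1 - 1) * exp (- (t * l))))"
    using ki unfolding ke set_integrable_def .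
  have "set_integrable lborel {0<..} (\<lambda>l. S l * (l powr (\<beta> - 1 - 1) * exp (- (r * l))))" if r: "0 < r" for r
  proof -
    let ?g = "\<lambda>l. exp (t * d) * (S' l * (l powr (\<beta> - 1 - 1) * exp (- (t * l)))) + c * d powr (\<beta> - 2) * (l powr (1 - 1) * exp (- (r * l)))"
    have "set_integrable lborel {0<..} ?g"
      by (intro set_integral_add(1) set_integrable_mult_right S'i set_integrable_powr_exp r) simp
    then have gi: "integrable lborel (\<lambda>l. indicator {0<..} l *\<^sub>R ?g l)" by (simp only: set_integrable_def)
    show ?thesis unfolding set_integrable_def
    proof (rule Bochner_Integration.integrable_bound[OF gi])
      show "AE l in lborel. norm (indicator {0<..} l *\<^sub>R (S l * (l powr (\<beta> - 1 - 1) * exp (- (r * l))))) \<le> norm (indicator {0<..} l *\<^sub>R ?g l)"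
      proof (rule AE_I2)
        fix l :: real
        show "norm (indicator {0<..} l *\<^sub>R (S l * (l powr (\<beta> - 1 - 1) * exp (- (r * l))))) \<le> norm (indicator {0<..} l *\<^sub>R ?g l)"
        proof (cases "0 < l")
          case True
          have n1: "0 \<le> exp (t * d) * (S' l * (l powr (\<beta> - 1 - 1) * exp (- (t * l))))"
            using S'0[OF True] by simp
          have n2: "0 \<le> c * d powr (\<beta> - 2) * (l powr (1 - 1) * exp (- (r * l)))"
            using c_nonneg by simp
          have "\<bar>S l\<bar> * (l powr (\<beta> - 1 - 1) * exp (- (r * l))) \<le> ?g l"
          proof (cases "d < l")
            case dl: True
            have "l powr (\<beta> - 1 - 1) \<le> d powr (\<beta> - 2)"
              using powr_mono2'[of "\<beta> - 2" d l] b d dl by simp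
            then have "\<bar>S l\<bar> * (l powr (\<beta> - 1 - 1) * exp (- (r * l))) \<le> c * (d powr (\<beta> - 2) * exp (- (r * l)))"
              by (intro mult_mono S_bound c_nonneg) auto
            also have "\<dots> = c * d powr (\<beta> - 2) * (l powr (1 - 1) * exp (- (r * l)))" using True by simp
            finally show ?thesis using n1 by linarith
          next
            case False
            have "1 \<le> exp (t * d) * exp (- (t * l))"
              using False t by (simp add: exp_add[symmetric])
            moreover have "exp (- (r * l)) \<le> 1" using r True by simp
            ultimately have e: "exp (- (r * l)) \<le> exp (t * d) * exp (- (t * l))" by linarith
            have "\<bar>S l\<bar> = S' l" using False d S_nonneg[OF True] by (simp add: S'_def)
            then have "\<bar>S l\<bar> * (l powr (\<beta> - 1 - 1) * exp (- (r * l))) \<le> S' l * (l powr (\<beta> - 1 - 1) * (exp (t * d) * exp (- (t * l))))"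
              using S'0[OF True] e by (auto intro!: mult_left_mono)
            also have "\<dots> = exp (t * d) * (S' l * (l powr (\<beta> - 1 - 1) * exp (- (t * l))))" by (simp add: mult_ac)
            finally show ?thesis using n2 by linarith
          qed
          then show ?thesis using True n1 n2 by (simp add: abs_mult)
        qed simp
      qed
    qed measurable
  qed
  then show ?thesis using b by (simp add: strong_def)
qed

text \<open>A fractional tail integral lowers the index by \<open>m - \<nu>\<close>, where \<open>m\<close> is the order, and \<open>m\<close> derivatives raise it by \<open>m\<close>.\<close>

lemma rl_right_W:
  assumes \<nu>: "1 < \<nu>" and a: "a = 0 \<or> strong a"
    and ab: "\<nu> \<notin> \<nat> \<Longrightarrow> strong (a + (1 + \<nu> - real (rl_order \<nu>)) - 1)"
    and v: "\<And>t. 0 < t \<Longrightarrow> v t = W a t" and t: "0 < t"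
  shows "rl_right \<nu> v t = W (a + \<nu>) t" and "rl_right_exists \<nu> v t"
proof -
  define m where "m = rl_order \<nu>"
  have near: "\<forall>\<^sub>F r in nhds t. 0 < r"
    using eventually_nhds_in_open[of "{0<..}" t] t by simp
  have v1: "\<And>t. 0 < t \<Longrightarrow> v t = 1 * W a t" using v by simp
  have "rl_right \<nu> v t = W (a + \<nu>) t \<and> rl_right_exists \<nu> v t"
  proof (cases "\<nu> \<in> \<nat>")
    case True
    then have m: "real m = \<nu>" by (auto simp: m_def rl_order_def elim!: Nats_cases)
    have "rl_right \<nu> v t = (- 1) ^ m * (deriv ^^ m) v t" using True by (simp add: rl_right_def m_def)
    also have "(deriv ^^ m) v t = 1 * ((- 1) ^ m * W (a + real m) t)"
      by (rule deriv_funpow_W(1)[OF a v1 t])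
    also have "(- 1) ^ m * (1 * ((- 1) ^ m * W (a + real m) t)) = W (a + \<nu>) t"
      unfolding m by (simp add: power_mult_distrib[symmetric])
    finally have 1: "rl_right \<nu> v t = W (a + \<nu>) t" .
    have "\<forall>\<^sub>F r in nhds t. (deriv ^^ k) v differentiable (at r)" for k
      using near by eventually_elim (rule deriv_funpow_W(2)[OF a v1])
    with 1 True show ?thesis by (simp add: rl_right_exists_def)
  next
    case False
    define \<beta> where "\<beta> = 1 + \<nu> - real (rl_order \<nu>)"
    have "\<nu> < real m" "real m < \<nu> + 1" using rl_order_bounds[OF \<nu> False] by (auto simp: m_def)
    then have b: "0 < \<beta>" "\<beta> < 1" by (auto simp: \<beta>_def m_def)
    have sb: "strong (a + \<beta> - 1)" using ab[OF False] by (simp add: \<beta>_def)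
    have G: "1 - \<beta> = real m - \<nu>" by (simp add: \<beta>_def m_def)
    have Gp: "0 < Gamma (1 - \<beta>)" using b by (intro Gamma_real_pos) simp
    have ti: "rl_tail_converges \<nu> v r" and te: "rl_tail \<nu> v r = Gamma (1 - \<beta>) * W (a + \<beta> - 1) r" if r: "0 < r" for r
    proof -
      have e: "W a s / (s - r) powr \<beta> = v s / (s - r) powr (1 + \<nu> - real (rl_order \<nu>))" if "s \<in> {r<..}" for s
        using that r v[of s] by (simp add: \<beta>_def)
      show "rl_tail_converges \<nu> v r"
        unfolding rl_tail_converges_def by (rule set_integrable_eq_on[OF tail(1)[OF a b sb r] e])
      have "rl_tail \<nu> v r = (LINT s:{r<..}|lborel. W a s / (s - r) powr \<beta>)"
        unfolding rl_tail_def by (rule set_lebesgue_integral_cong) (use e in auto)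
      also have "\<dots> = Gamma (1 - \<beta>) * W (a + \<beta> - 1) r" by (rule tail(2)[OF a b sb r])
      finally show "rl_tail \<nu> v r = Gamma (1 - \<beta>) * W (a + \<beta> - 1) r" .
    qed
    have sb': "a + \<beta> - 1 = 0 \<or> strong (a + \<beta> - 1)" using sb by simp
    have ex: "a + \<beta> - 1 + real m = a + \<nu>" by (simp add: \<beta>_def m_def)
    have "rl_right \<nu> v t = 1 / Gamma (1 - \<beta>) * ((- 1) ^ m * (deriv ^^ m) (rl_tail \<nu> v) t)"
      using False by (simp add: rl_right_def m_def[symmetric] G)
    also have "(deriv ^^ m) (rl_tail \<nu> v) t = Gamma (1 - \<beta>) * ((- 1) ^ m * W (a + \<beta> - 1 + real m) t)"
      by (rule deriv_funpow_W(1)[OF sb' te t])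
    also have "1 / Gamma (1 - \<beta>) * ((- 1) ^ m * (Gamma (1 - \<beta>) * ((- 1) ^ m * W (a + \<beta> - 1 + real m) t))) = W (a + \<nu>) t"
      unfolding ex using Gp by (simp add: power_mult_distrib[symmetric])
    finally have 1: "rl_right \<nu> v t = W (a + \<nu>) t" .
    have "\<forall>\<^sub>F r in nhds t. (deriv ^^ k) (rl_tail \<nu> v) differentiable (at r)" for k
      using near by eventually_elim (rule deriv_funpow_W(2)[OF sb' te])
    moreover have "\<forall>\<^sub>F r in nhds t. rl_tail_converges \<nu> v r"
      using near by eventually_elim (rule ti)
    ultimately show ?thesis using 1 False by (simp add: rl_right_exists_def)
  qed
  then show "rl_right \<nu> v t = W (a + \<nu>) t" "rl_right_exists \<nu> v t" by blast+
qed

text \<open>Only the first step needs the convergence of a tail integral as a hypothesis; from then on the index \<open>\<nu> n + \<beta> - 1\<close> is positive.\<close>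

lemma rl_right_iterates:
  assumes \<nu>: "1 < \<nu>" and v: "\<And>t. 0 < t \<Longrightarrow> v t = W 0 t" and t: "0 < t"
    and h: "\<nu> \<notin> \<nat> \<Longrightarrow> rl_tail_converges \<nu> v t" and s: "0 < s"
  shows "(rl_right \<nu> ^^ n) v s = W (\<nu> * real n) s" and "rl_right_exists \<nu> ((rl_right \<nu> ^^ n) v) s"
proof -
  define \<beta> where "\<beta> = 1 + \<nu> - real (rl_order \<nu>)"
  have sb: "strong (\<nu> * real n + \<beta> - 1)" if nn: "\<nu> \<notin> \<nat>" for n
  proof -
    have b: "0 < \<beta>" "\<beta> < 1" using rl_order_bounds[OF \<nu> nn] by (auto simp: \<beta>_def)
    show ?thesis
    proof (cases "n = 0")
      case True
      have e: "v s / (s - t) powr (1 + \<nu> - real (rl_order \<nu>)) = W 0 s / (s - t) powr \<beta>" if "s \<in> {t<..}" for s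
        using that t v[of s] by (simp add: \<beta>_def)
      have "set_integrable lborel {t<..} (\<lambda>s. W 0 s / (s - t) powr \<beta>)"
        using h[OF nn] unfolding rl_tail_converges_def by (rule set_integrable_eq_on) (rule e)
      then show ?thesis using strong_of_tail[OF b t] True by simp
    next
      case False
      then have "1 \<le> real n" by simp
      then have "\<nu> * 1 \<le> \<nu> * real n" using \<nu> by (intro mult_left_mono) auto
      then show ?thesis using b \<nu> by (intro strong_pos) linarith
    qed
  qed
  have a: "\<nu> * real n = 0 \<or> strong (\<nu> * real n)" for n
    using \<nu> strong_pos[of "\<nu> * real n"] by (cases "n = 0") auto
  have step: "rl_right \<nu> y s = W (\<nu> * real (Suc n)) s \<and> rl_right_exists \<nu> y s"
    if "0 < s" "\<And>s. 0 < s \<Longrightarrow> y s = W (\<nu> * real n) s" for y s n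
  proof -
    have e: "\<nu> * real (Suc n) = \<nu> * real n + \<nu>" by (simp add: algebra_simps)
    show ?thesis unfolding e
      using rl_right_W[OF \<nu> a sb[unfolded \<beta>_def] that(2,1)] by blast
  qed
  have it: "(rl_right \<nu> ^^ n) v s = W (\<nu> * real n) s" if "0 < s" for n s
    using that
  proof (induction n arbitrary: s)
    case 0 then show ?case using v by simp
  next
    case (Suc n) then show ?case using step[of s "(rl_right \<nu> ^^ n) v" n] by simp
  qed
  show "(rl_right \<nu> ^^ n) v s = W (\<nu> * real n) s" by (rule it[OF s])
  show "rl_right_exists \<nu> ((rl_right \<nu> ^^ n) v) s" using step[OF s it] by blast
qed

end

section \<open>The variance gamma kernel as a Laplace integral\<close>

lemma LINT_substitution_halfline:
  fixes f g g' :: "real \<Rightarrow> real"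
  assumes g: "\<And>x. 0 < x \<Longrightarrow> (g has_real_derivative g' x) (at x)"
    and f: "\<And>x. 0 < x \<Longrightarrow> isCont f (g x)" and g': "\<And>x. 0 < x \<Longrightarrow> isCont g' x"
    and nn: "\<And>x. 0 \<le> x \<Longrightarrow> 0 \<le> g' x"
    and l0: "(g \<longlongrightarrow> 0) (at_right 0)" and l1: "filterlim g at_top at_top"
    and i1: "set_integrable lborel {0<..} (\<lambda>x. g' x * f (g x))"
    and i2: "set_integrable lborel {0<..} f"
  shows "(LINT y:{0<..}|lborel. f y) = (LINT x:{0<..}|lborel. g' x * f (g x))"
proof -
  have E: "einterval 0 \<infinity> = {0<..}" by (simp add: zero_ereal_def)
  have "(LBINT y=0..\<infinity>. f y) = (LBINT x=0..\<infinity>. g' x *\<^sub>R f (g x))"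
  proof (rule interval_integral_substitution_integrable)
    show "((ereal \<circ> g \<circ> real_of_ereal) \<longlongrightarrow> 0) (at_right 0)"
      using l0 unfolding zero_ereal_def by (simp add: ereal_tendsto_simps)
    show "((ereal \<circ> g \<circ> real_of_ereal) \<longlongrightarrow> \<infinity>) (at_left \<infinity>)"
      using l1 by (simp add: ereal_tendsto_simps)
    show "set_integrable lborel (einterval 0 \<infinity>) (\<lambda>x. g' x *\<^sub>R f (g x))" using i1 by (simp add: E)
    show "set_integrable lborel (einterval 0 \<infinity>) f" using i2 by (simp add: E)
  qed (use g f g' nn in auto)
  then show ?thesis by (simp add: interval_lebesgue_integral_0_infty)
qed

text \<open>Differentiate the characteristic function of the standard normal law and halve the integral of an even function.\<close>

lemma gaussian_sine_moment:
  "has_bochner_integral lborel (\<lambda>y. indicator {0<..} y *\<^sub>R (y * sin (t * y) * std_normal_density y)) (t / 2 * exp (- (t\<^sup>2) / 2))"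
proof -
  have C: "(LINT y|lborel. std_normal_density y * cos (t * y)) = exp (- (t\<^sup>2) / 2)" for t
  proof -
    have i: "integrable std_normal_distribution (\<lambda>y. iexp (t * y))"
    proof -
      interpret real_distribution std_normal_distribution by (rule real_dist_normal_dist)
      show ?thesis by (rule integrable_const_bound[of _ 1]) auto
    qed
    have "exp (- (t\<^sup>2) / 2) = Re (char std_normal_distribution t)"
      by (simp add: char_std_normal_distribution)
    also have "\<dots> = (LINT y|std_normal_distribution. Re (iexp (t * y)))"
      unfolding char_def by (rule integral_Re[OF i, symmetric])
    also have "\<dots> = (LINT y|lborel. std_normal_density y * cos (t * y))"
      by (subst integral_density) (auto simp: normal_density_nonneg Re_exp)
    finally show ?thesis by simp
  qed
  let ?G = "\<lambda>y. - (y * sin (t * y) * std_normal_density y)"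
  have mb: "integrable lborel (\<lambda>y. std_normal_density y * \<bar>y\<bar>)"
    using integrable_std_normal_moment_abs[of 1] by simp
  have m0: "integrable lborel (\<lambda>y. std_normal_density y)"
    using integrable_std_normal_moment[of 0] by simp
  have ti: "t \<in> {t - 1<..<t + 1}" by simp
  have ci: "integrable lborel (\<lambda>y. std_normal_density y * cos (r * y))" for r
    by (rule Bochner_Integration.integrable_bound[OF m0]) (auto simp: abs_mult normal_density_nonneg intro!: mult_left_le)
  have der: "((\<lambda>r. std_normal_density y * cos (r * y)) has_real_derivative - (y * sin (r * y) * std_normal_density y)) (at r)" for r y
    by (auto intro!: derivative_eq_intros)
  have bnd: "\<bar>- (y * sin (r * y) * std_normal_density y)\<bar> \<le> std_normal_density y * \<bar>y\<bar>" for r y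
  proof -
    have "\<bar>y\<bar> * \<bar>sin (r * y)\<bar> * std_normal_density y \<le> \<bar>y\<bar> * 1 * std_normal_density y"
      by (intro mult_right_mono mult_left_mono) (auto simp: normal_density_nonneg)
    then show ?thesis by (simp add: abs_mult normal_density_nonneg mult.commute)
  qed
  have Gi: "integrable lborel ?G"
    by (rule integrable_derivative_under_integral[OF ti ci der bnd mb])
  have "((\<lambda>r. LINT y|lborel. std_normal_density y * cos (r * y)) has_real_derivative integral\<^sup>L lborel ?G) (at t)"
    by (rule has_real_derivative_under_integral[OF ti ci der bnd mb])
  moreover have "((\<lambda>r. LINT y|lborel. std_normal_density y * cos (r * y)) has_real_derivative - (t * exp (- (t\<^sup>2) / 2))) (at t)"
    unfolding C by (auto intro!: derivative_eq_intros)
  ultimately have Gv: "integral\<^sup>L lborel ?G = - (t * exp (- (t\<^sup>2) / 2))" by (rule DERIV_unique)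
  let ?g = "\<lambda>y. y * sin (t * y) * std_normal_density y"
  have gi: "integrable lborel ?g" using Gi by simp
  define I where "I = (LINT y|lborel. indicator {0..} y *\<^sub>R ?g y)"
  have hi: "has_bochner_integral lborel (\<lambda>y. indicator {0..} y *\<^sub>R ?g y) I"
    unfolding I_def by (rule has_bochner_integral_integrable, rule integrable_mult_indicator[OF _ gi]) simp
  then have "has_bochner_integral lborel ?g (2 *\<^sub>R I)"
    by (rule has_bochner_integral_even_function) (simp add: normal_density_def)
  then have "2 * I = t * exp (- (t\<^sup>2) / 2)"
    using Gv by (simp add: has_bochner_integral_iff)
  then have "I = t / 2 * exp (- (t\<^sup>2) / 2)" by simp
  moreover have "indicator {0..} y *\<^sub>R ?g y = indicator {0<..} y *\<^sub>R ?g y" for y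
    by (auto simp: indicator_def)
  ultimately show ?thesis using hi by (simp only:)
qed

lemma brownian_density_sine:
  assumes z: "0 < z"
  shows "has_bochner_integral lborel (\<lambda>y. indicator {0<..} y *\<^sub>R (sin (x * y) * (z * y * exp (- (z * y\<^sup>2 / 2))))) (pi * x * brownian_density x z)"
proof -
  let ?f = "\<lambda>y. indicator {0<..} y *\<^sub>R (y * sin (x / sqrt z * y) * std_normal_density y)"
  have sz: "0 < sqrt z" "sqrt z * sqrt z = z" using z by simp_all
  have "has_bochner_integral lborel (\<lambda>y. ?f (0 + sqrt z * y)) ((x / sqrt z / 2 * exp (- ((x / sqrt z)\<^sup>2) / 2)) /\<^sub>R \<bar>sqrt z\<bar>)"
    using gaussian_sine_moment[of "x / sqrt z"] lborel_has_bochner_integral_real_affine_iff[of "sqrt z" ?f _ 0] z by simp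
  then have "has_bochner_integral lborel (\<lambda>y. sqrt (2 * pi) * sqrt z * ?f (0 + sqrt z * y))
     (sqrt (2 * pi) * sqrt z * ((x / sqrt z / 2 * exp (- ((x / sqrt z)\<^sup>2) / 2)) /\<^sub>R \<bar>sqrt z\<bar>))"
    by (rule has_bochner_integral_mult_right)
  moreover have "sqrt (2 * pi) * sqrt z * ?f (0 + sqrt z * y) = indicator {0<..} y *\<^sub>R (sin (x * y) * (z * y * exp (- (z * y\<^sup>2 / 2))))" for y
  proof (cases "0 < y")
    case True
    have "x / sqrt z * (sqrt z * y) = x * y" using sz by simp
    moreover have "std_normal_density (sqrt z * y) = exp (- (z * y\<^sup>2 / 2)) / sqrt (2 * pi)"
      using z by (simp add: std_normal_density_def power_mult_distrib)
    ultimately show ?thesis using True sz by (simp add: zero_less_mult_iff)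
  next
    case False then show ?thesis using sz by (simp add: zero_less_mult_iff)
  qed
  moreover have "sqrt (2 * pi) * sqrt z * ((x / sqrt z / 2 * exp (- ((x / sqrt z)\<^sup>2) / 2)) /\<^sub>R \<bar>sqrt z\<bar>) = pi * x * brownian_density x z"
  proof -
    have b: "brownian_density x z = exp (- (x\<^sup>2) / (2 * z)) / (sqrt (2 * pi) * sqrt z)"
      using z powr_minus_divide[of "2 * pi * z" "1 / 2"] powr_half_sqrt[of "2 * pi * z"]
      by (simp add: brownian_density_def real_sqrt_mult)
    have e: "(x / sqrt z)\<^sup>2 / 2 = x\<^sup>2 / (2 * z)" using z by (simp add: power_divide)
    have gen: "r * x / (2 * q) = P * x / (r * q)" if "0 < r" "r * r = 2 * P" for r P q :: real
    proof -
      have P: "P = r * r / 2" using that by simp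
      show ?thesis unfolding P using that(1) by simp
    qed
    have "sqrt (2 * pi) * x / (2 * sqrt z) = pi * x / (sqrt (2 * pi) * sqrt z)"
      by (rule gen) simp_all
    then show ?thesis using sz e unfolding b by (simp add: field_simps)
  qed
  ultimately show ?thesis by (simp only:)
qed

text \<open>Average the sine representation of the Gaussian kernel over the gamma law. The factor \<open>z y\<close> makes the double integral absolutely convergent, unlike the cosine representation.\<close>

lemma vg_kernel_sine_xi:
  assumes x: "0 < x" and l: "0 < l"
  defines "f \<equiv> \<lambda>y. sin (x * y) / (pi * x) * (l * y * (1 + y\<^sup>2 / 2) powr (- l - 1))"
  shows "set_integrable lborel {0<..} f" and "(LINT y:{0<..}|lborel. f y) = vg_kernel x 0 l"
proof -
  define F where "F z y = indicator {0<..} z *\<^sub>R (indicator {0<..} y *\<^sub>R (gamma_density z l / (pi * x) * (sin (x * y) * (z * y * exp (- (z * y\<^sup>2 / 2))))))" for z y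
  have gd: "gamma_density z l = z powr (l - 1) * exp (- z) / Gamma l" if "0 < z" for z
    using that by (simp add: gamma_density_def)
  have Gp: "0 < Gamma l" using l by (rule Gamma_real_pos)
  have gn: "0 \<le> gamma_density z l" if "0 < z" for z using that Gp by (simp add: gd)
  have gi: "set_integrable lborel {0<..} (\<lambda>z. gamma_density z l)"
  proof (rule set_integrable_eq_on)
    show "set_integrable lborel {0<..} (\<lambda>z. 1 / Gamma l * (z powr (l - 1) * exp (- (1 * z))))"
      by (rule set_integrable_mult_right) (rule set_integrable_powr_exp[OF l zero_less_one])
  qed (simp add: gd)
  have gm: "(\<lambda>z. gamma_density z l) \<in> borel_measurable borel" by (simp add: gamma_density_def[abs_def])
  have Fm[measurable]: "case_prod F \<in> borel_measurable (lborel \<Otimes>\<^sub>M lborel)"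
    unfolding F_def using gm by measurable
  have Fy: "has_bochner_integral lborel (F z) (indicator {0<..} z *\<^sub>R (brownian_density x z * gamma_density z l))" for z
  proof (cases "0 < z")
    case True
    have "has_bochner_integral lborel (\<lambda>y. gamma_density z l / (pi * x) * (indicator {0<..} y *\<^sub>R (sin (x * y) * (z * y * exp (- (z * y\<^sup>2 / 2))))))
      (gamma_density z l / (pi * x) * (pi * x * brownian_density x z))"
      by (rule has_bochner_integral_mult_right[OF brownian_density_sine[OF True]])
    moreover have "gamma_density z l / (pi * x) * (indicator {0<..} y *\<^sub>R (sin (x * y) * (z * y * exp (- (z * y\<^sup>2 / 2))))) = F z y" for y
      using True by (simp add: F_def)
    moreover have "gamma_density z l / (pi * x) * (pi * x * brownian_density x z) = indicator {0<..} z *\<^sub>R (brownian_density x z * gamma_density z l)"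
      using True x by simp
    ultimately show ?thesis by (simp only:)
  next
    case False
    then have "F z = (\<lambda>_. 0)" by (auto simp: F_def fun_eq_iff)
    then show ?thesis using False has_bochner_integral_zero[of lborel, where 'b = real] by simp
  qed
  have ab: "(LINT y|lborel. norm (F z y)) \<le> indicator {0<..} z *\<^sub>R (gamma_density z l / (pi * x))" for z
  proof (cases "0 < z")
    case True
    let ?r = "\<lambda>y. indicator {0<..} y *\<^sub>R (gamma_density z l / (pi * x) * z * (y powr (2 * 1 - 1) * exp (- (z / 2 * y powr 2))))"
    have ri: "set_integrable lborel {0<..} (\<lambda>y. gamma_density z l / (pi * x) * z * (y powr (2 * 1 - 1) * exp (- (z / 2 * y powr 2))))"
      by (rule set_integrable_mult_right) (rule LINT_powr_exp_powr(1), use True in auto)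
    have "(LINT y|lborel. norm (F z y)) \<le> integral\<^sup>L lborel ?r"
    proof (rule integral_mono)
      show "integrable lborel (\<lambda>y. norm (F z y))" using Fy[of z] by (auto simp: has_bochner_integral_iff)
      show "integrable lborel ?r" using ri by (simp add: set_integrable_def)
      fix y
      show "norm (F z y) \<le> ?r y"
      proof (cases "0 < y")
        case y: True
        have "norm (F z y) = gamma_density z l / (pi * x) * (\<bar>sin (x * y)\<bar> * (z * y * exp (- (z * y\<^sup>2 / 2))))"
          using True y x gn[OF True] by (simp add: F_def abs_mult)
        also have "\<dots> \<le> gamma_density z l / (pi * x) * (1 * (z * y * exp (- (z * y\<^sup>2 / 2))))"
          using True y x gn[OF True] by (intro mult_left_mono mult_right_mono) auto
        also have "\<dots> = ?r y" using y by simp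
        finally show ?thesis .
      qed (simp add: F_def)
    qed
    also have "integral\<^sup>L lborel ?r = gamma_density z l / (pi * x) * z * (LINT y:{0<..}|lborel. y powr (2 * 1 - 1) * exp (- (z / 2 * y powr 2)))"
      using set_integral_mult_right[of lborel "{0<..}" "gamma_density z l / (pi * x) * z" "\<lambda>y. y powr (2 * 1 - 1) * exp (- (z / 2 * y powr 2))"]
      by (simp only: set_lebesgue_integral_def)
    also have "(LINT y:{0<..}|lborel. y powr (2 * 1 - 1) * exp (- (z / 2 * y powr 2))) = Gamma 1 / (2 * (z / 2) powr 1)"
      by (rule LINT_powr_exp_powr(2)) (use True in auto)
    finally show ?thesis using True by simp
  qed (simp add: F_def)
  have Fi: "integrable (lborel \<Otimes>\<^sub>M lborel) (case_prod F)"
  proof (rule lborel_pair.Fubini_integrable[OF Fm])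
    show "AE z in lborel. integrable lborel (\<lambda>y. case_prod F (z, y))"
      using Fy by (auto simp: has_bochner_integral_iff)
    have bi: "integrable lborel (\<lambda>z. indicator {0<..} z *\<^sub>R (gamma_density z l / (pi * x)))"
      using set_integrable_mult_right[of "1 / (pi * x)", OF gi] by (simp add: set_integrable_def)
    show "integrable lborel (\<lambda>z. LINT y|lborel. norm (case_prod F (z, y)))"
    proof (rule Bochner_Integration.integrable_bound[OF bi])
      show "(\<lambda>z. LINT y|lborel. norm (case_prod F (z, y))) \<in> borel_measurable lborel" by measurable
      have "norm (LINT y|lborel. norm (case_prod F (z, y))) \<le> norm (indicator {0<..} z *\<^sub>R (gamma_density z l / (pi * x)))" for z
      proof -
        have "norm (LINT y|lborel. norm (case_prod F (z, y))) = (LINT y|lborel. norm (F z y))" by simp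
        also have "\<dots> \<le> indicator {0<..} z *\<^sub>R (gamma_density z l / (pi * x))" by (rule ab)
        also have "\<dots> \<le> norm (indicator {0<..} z *\<^sub>R (gamma_density z l / (pi * x)))"
          unfolding real_norm_def by (rule abs_ge_self)
        finally show ?thesis .
      qed
      then show "AE z in lborel. norm (LINT y|lborel. norm (case_prod F (z, y))) \<le> norm (indicator {0<..} z *\<^sub>R (gamma_density z l / (pi * x)))" by simp
    qed
  qed
  have Fz: "(LINT z|lborel. F z y) = indicator {0<..} y *\<^sub>R f y" for y
  proof (cases "0 < y")
    case True
    define cc where "cc = 1 + y\<^sup>2 / 2"
    have cc: "0 < cc" by (simp add: cc_def add_pos_nonneg)
    have l1: "0 < l + 1" using l by simp
    have "(LINT z|lborel. F z y) = (LINT z:{0<..}|lborel. (sin (x * y) / (pi * x) * y / Gamma l) * (z powr (l + 1 - 1) * exp (- (cc * z))))"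
      unfolding set_lebesgue_integral_def
    proof (intro Bochner_Integration.integral_cong refl)
      fix z
      show "F z y = indicator {0<..} z *\<^sub>R ((sin (x * y) / (pi * x) * y / Gamma l) * (z powr (l + 1 - 1) * exp (- (cc * z))))"
      proof (cases "0 < z")
        case z: True
        have "z powr (l + 1 - 1) = z * z powr (l - 1)" using z powr_mult_base[of z "l - 1"] by simp
        moreover have "exp (- (cc * z)) = exp (- z) * exp (- (z * y\<^sup>2 / 2))"
          by (simp add: cc_def exp_add[symmetric] algebra_simps)
        ultimately show ?thesis using True z by (simp add: F_def gd mult_ac)
      qed (simp add: F_def)
    qed
    also have "\<dots> = (sin (x * y) / (pi * x) * y / Gamma l) * (Gamma (l + 1) / cc powr (l + 1))"
      by (simp only: set_integral_mult_right LINT_powr_exp[OF l1 cc])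
    also have "Gamma (l + 1) = l * Gamma l"
      using l by (intro Gamma_plus1) (auto elim!: nonpos_Ints_cases)
    also have "sin (x * y) / (pi * x) * y / Gamma l * (l * Gamma l / cc powr (l + 1)) = f y"
    proof -
      have m: "- l - 1 = - (l + 1)" by simp
      have "cc powr (- l - 1) = 1 / cc powr (l + 1)" unfolding m by (rule powr_minus_divide)
      then show ?thesis using Gp by (simp add: f_def cc_def[symmetric] mult_ac)
    qed
    finally show ?thesis using True by simp
  qed (simp add: F_def)
  show "set_integrable lborel {0<..} f"
    using lborel_pair.integrable_snd[OF Fi] unfolding set_integrable_def Fz .
  have "(LINT y:{0<..}|lborel. f y) = (LINT y|lborel. LINT z|lborel. F z y)"
    unfolding set_lebesgue_integral_def Fz ..
  also have "\<dots> = (LINT z|lborel. LINT y|lborel. F z y)" by (rule lborel_pair.Fubini_integral[OF Fi])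
  also have "\<dots> = (LINT z:{0<..}|lborel. brownian_density x z * gamma_density z l)"
    unfolding set_lebesgue_integral_def
    using Fy by (intro Bochner_Integration.integral_cong refl) (auto simp: has_bochner_integral_iff)
  also have "\<dots> = vg_kernel x 0 l" by (rule vg_kernel_gamma_mean[OF l])
  finally show "(LINT y:{0<..}|lborel. f y) = vg_kernel x 0 l" .
qed

text \<open>At \<open>\<nu> = 1\<close> this is the function \<open>S\<close> for which \<open>W 0\<close> is the variance gamma kernel, with \<open>l = ln (1 + y^2 / 2)\<close> in terms of the Fourier variable \<open>y\<close>; the power \<open>l^\<nu>\<close> passes to the stable clock.\<close>

definition sine_mode :: "real \<Rightarrow> real \<Rightarrow> real \<Rightarrow> real" where
  "sine_mode x \<nu> l = sin (x * sqrt (2 * (exp (l powr \<nu>) - 1))) / (pi * x)"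

text \<open>The bound \<open>ln (1 + pi^2 / (2 x^2)) powr (1 / \<nu>)\<close> is the point at which the argument of the sine reaches \<open>pi\<close>.\<close>

lemma laplace_family_sine_mode:
  assumes x: "0 < x" and \<nu>: "0 < \<nu>"
  shows "laplace_family (sine_mode x \<nu>) (1 / (pi * x)) (ln (1 + pi\<^sup>2 / (2 * x\<^sup>2)) powr (1 / \<nu>))"
proof
  show "sine_mode x \<nu> \<in> borel_measurable borel" by (simp add: sine_mode_def[abs_def])
  show "\<bar>sine_mode x \<nu> l\<bar> \<le> 1 / (pi * x)" for l
    using x by (simp add: sine_mode_def abs_mult divide_right_mono)
  define k where "k = ln (1 + pi\<^sup>2 / (2 * x\<^sup>2))"
  have q: "0 < pi\<^sup>2 / (2 * x\<^sup>2)" using x by simp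
  then have k: "0 < k" by (simp add: k_def)
  show "0 < ln (1 + pi\<^sup>2 / (2 * x\<^sup>2)) powr (1 / \<nu>)" using k by (simp add: k_def)
  fix l :: real assume l: "0 < l" "l < ln (1 + pi\<^sup>2 / (2 * x\<^sup>2)) powr (1 / \<nu>)"
  have "l powr \<nu> < (k powr (1 / \<nu>)) powr \<nu>"
    using l \<nu> by (intro powr_less_mono2) (auto simp: k_def)
  also have "\<dots> = k" using k \<nu> by (simp add: powr_powr)
  finally have "exp (l powr \<nu>) < exp k" by simp
  also have "exp k = 1 + pi\<^sup>2 / (2 * x\<^sup>2)" using q by (simp add: k_def add_pos_pos)
  finally have "2 * (exp (l powr \<nu>) - 1) \<le> (pi / x)\<^sup>2" using x by (simp add: power_divide field_simps)
  then have "sqrt (2 * (exp (l powr \<nu>) - 1)) \<le> pi / x"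
    using x by (intro real_le_lsqrt) auto
  then have "x * sqrt (2 * (exp (l powr \<nu>) - 1)) \<le> pi" using x by (simp add: field_simps)
  then have "0 \<le> sin (x * sqrt (2 * (exp (l powr \<nu>) - 1)))"
    using x by (intro sin_ge_zero) auto
  then show "0 \<le> sine_mode x \<nu> l" using x by (simp add: sine_mode_def)
qed

lemma vg_kernel_sine_mode:
  assumes x: "0 < x" and l: "0 < l"
  shows "vg_kernel x 0 l = laplace_family.W (sine_mode x 1) 0 l"
proof -
  interpret L: laplace_family "sine_mode x 1" "1 / (pi * x)" "ln (1 + pi\<^sup>2 / (2 * x\<^sup>2)) powr (1 / 1)"
    by (rule laplace_family_sine_mode[OF x]) simp
  let ?f = "\<lambda>y. sin (x * y) / (pi * x) * (l * y * (1 + y\<^sup>2 / 2) powr (- l - 1))"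
  let ?g = "\<lambda>k. sqrt (2 * (exp k - 1))" and ?g' = "\<lambda>k. exp k / sqrt (2 * (exp k - 1))"
  have e: "?g' k * ?f (?g k) = L.w 0 l k" if k: "0 < k" for k
  proof -
    have s: "0 < ?g k" "(?g k)\<^sup>2 = 2 * (exp k - 1)" using k by auto
    have p: "(1 + (?g k)\<^sup>2 / 2) powr (- l - 1) = exp (- (l * k)) * exp (- k)"
    proof -
      have c: "1 + 2 * (exp k - 1) / 2 = exp k" by (simp add: diff_divide_distrib)
      show ?thesis unfolding s(2) c by (simp add: powr_def exp_add[symmetric] algebra_simps)
    qed
    have "?g' k * ?f (?g k) = sin (x * ?g k) / (pi * x) * (l * (exp k * exp (- k)) * exp (- (l * k)))"
      unfolding p using s(1) by simp
    also have "\<dots> = L.w 0 l k"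
      using k by (simp add: L.w_def sine_mode_def exp_add[symmetric])
    finally show ?thesis .
  qed
  have "(LINT y:{0<..}|lborel. ?f y) = (LINT k:{0<..}|lborel. ?g' k * ?f (?g k))"
  proof (rule LINT_substitution_halfline)
    fix k :: real assume k: "0 < k"
    then show "(?g has_real_derivative ?g' k) (at k)"
      by (auto intro!: derivative_eq_intros simp: field_simps)
    have "isCont ?f y" for y
    proof -
      have "0 < 1 + y\<^sup>2 / 2" by (simp add: add_pos_nonneg)
      then show ?thesis using x by (intro continuous_intros) auto
    qed
    then show "isCont ?f (?g k)" .
    show "isCont ?g' k" using k by (intro continuous_intros) auto
  next
    show "0 \<le> ?g' k" if "0 \<le> k" for k using that by simp
    have "(?g \<longlongrightarrow> sqrt (2 * (exp 0 - 1))) (at_right 0)" by (intro tendsto_intros)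
    then show "(?g \<longlongrightarrow> 0) (at_right 0)" by simp
    show "filterlim ?g at_top at_top" by real_asymp
    show "set_integrable lborel {0<..} (\<lambda>k. ?g' k * ?f (?g k))"
      by (rule set_integrable_eq_on[OF L.w_integrable[of 0 l]]) (use l e in auto)
    show "set_integrable lborel {0<..} ?f" by (rule vg_kernel_sine_xi(1)[OF x l])
  qed
  also have "\<dots> = L.W 0 l" unfolding L.W_def by (rule set_lebesgue_integral_cong) (use e in auto)
  finally show ?thesis using vg_kernel_sine_xi(2)[OF x l] by simp
qed

lemma vg_kernel_higher_sine_mode:
  assumes x: "0 < x" and l: "0 < l"
  shows "vg_kernel x n l = (- 1) ^ n * laplace_family.W (sine_mode x 1) (real n) l"
proof -
  interpret L: laplace_family "sine_mode x 1" "1 / (pi * x)" "ln (1 + pi\<^sup>2 / (2 * x\<^sup>2)) powr (1 / 1)"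
    by (rule laplace_family_sine_mode[OF x]) simp
  have "(deriv ^^ n) (vg_kernel x 0) = vg_kernel x n"
  proof (induction n)
    case (Suc n)
    have "deriv (vg_kernel x n) = vg_kernel x (Suc n)"
      using x by (auto simp: fun_eq_iff intro!: DERIV_imp_deriv vg_kernel_deriv)
    then show ?case using Suc by simp
  qed simp
  moreover have "(deriv ^^ n) (vg_kernel x 0) l = 1 * ((- 1) ^ n * L.W (0 + real n) l)"
    by (rule L.deriv_funpow_W(1)) (use l vg_kernel_sine_mode[OF x] in auto)
  ultimately show ?thesis by simp
qed

section \<open>Orders above one\<close>

context stable_process
begin

text \<open>Differentiate the Laplace transform of the stable law.\<close>

lemma mean_A_exp:
  assumes t: "0 < t" and k: "0 < k"
  shows "has_bochner_integral M (\<lambda>w. A t w * exp (- (k * A t w))) (\<alpha> * t * k powr (\<alpha> - 1) * exp (- (t * k powr \<alpha>)))"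
proof -
  have ti: "k \<in> {k / 2<..<2 * k}" using k by simp
  have i: "integrable M (\<lambda>w. exp (- y * A t w))" if "y \<in> {k / 2<..<2 * k}" for y
    using that t k by (intro exp_A_integrable) auto
  have d: "((\<lambda>y. exp (- y * A t w)) has_real_derivative - (A t w * exp (- y * A t w))) (at y)" for y w
    by (auto intro!: derivative_eq_intros)
  have b: "\<bar>- (A t w * exp (- y * A t w))\<bar> \<le> 2 / k" if "y \<in> {k / 2<..<2 * k}" "w \<in> space M" for y w
  proof -
    have A0: "0 \<le> A t w" using that t by (intro A_nonneg) auto
    have y: "k / 2 \<le> y" using that by simp
    have "k / 2 * A t w \<le> y * A t w" using y A0 by (rule mult_right_mono)
    also have "y * A t w \<le> exp (y * A t w)" using exp_ge_add_one_self[of "y * A t w"] by linarith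
    finally have "k / 2 * A t w \<le> exp (y * A t w)" .
    then have "A t w * exp (- y * A t w) \<le> 2 / k"
      using k by (simp add: exp_minus field_simps)
    then show ?thesis using A0 by (simp add: abs_mult)
  qed
  have c: "integrable M (\<lambda>w. 2 / k)" by simp
  note I = integrable_derivative_under_integral[OF ti i d b c]
    and D = has_real_derivative_under_integral[OF ti i d b c]
  have "((\<lambda>y. exp (- (y powr \<alpha>) * t)) has_real_derivative - (\<alpha> * t * k powr (\<alpha> - 1) * exp (- (t * k powr \<alpha>)))) (at k)"
    using k by (auto intro!: derivative_eq_intros simp: mult_ac)
  moreover have "((\<lambda>y. exp (- (y powr \<alpha>) * t)) has_real_derivative (LINT w|M. - (A t w * exp (- k * A t w)))) (at k)"
    by (rule has_field_derivative_transform_within_open[OF D, of "{0<..}"]) (use k t A_laplace in auto)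
  ultimately have "(LINT w|M. - (A t w * exp (- k * A t w))) = - (\<alpha> * t * k powr (\<alpha> - 1) * exp (- (t * k powr \<alpha>)))"
    using DERIV_unique by blast
  then show ?thesis using I by (simp add: has_bochner_integral_iff)
qed

text \<open>Averaging \<open>l^n e^(-A l)\<close> over the stable clock \<open>A = A t\<close> gives \<open>l^n e^(-t l^\<alpha>)\<close>; the substitution of \<open>l^(1/\<alpha>)\<close> for \<open>l\<close> turns this into the Laplace family in \<open>t\<close>.\<close>

lemma mean_W:
  assumes x: "0 < x" and t: "0 < t"
  shows "(LINT w|M. laplace_family.W (sine_mode x 1) (real n) (A t w))
      = laplace_family.W (sine_mode x (1 / \<alpha>)) (1 / \<alpha> * real n) t"
proof -
  define \<nu> where "\<nu> = 1 / \<alpha>"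
  have \<nu>: "0 < \<nu>" "\<alpha> * \<nu> = 1" "\<nu> * \<alpha> = 1" using \<alpha> by (auto simp: \<nu>_def)
  interpret L: laplace_family "sine_mode x 1" "1 / (pi * x)" "ln (1 + pi\<^sup>2 / (2 * x\<^sup>2)) powr (1 / 1)"
    by (rule laplace_family_sine_mode[OF x]) simp
  interpret N: laplace_family "sine_mode x \<nu>" "1 / (pi * x)" "ln (1 + pi\<^sup>2 / (2 * x\<^sup>2)) powr (1 / \<nu>)"
    by (rule laplace_family_sine_mode[OF x \<nu>(1)])
  interpret P: pair_sigma_finite lborel M ..
  have [measurable]: "A t \<in> borel_measurable M" using t by (simp add: A_measurable)
  let ?S = "sine_mode x 1"
  define f where "f k = ?S k * ((\<alpha> * t * k powr (real n + \<alpha> - 1) - real n * k powr (real n - 1)) * exp (- (t * k powr \<alpha>)))" for k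
  define F where "F k w = indicator {0<..} k *\<^sub>R L.w (real n) (A t w) k" for k w
  have Fm[measurable]: "case_prod F \<in> borel_measurable (lborel \<Otimes>\<^sub>M M)"
    unfolding F_def L.w_def by measurable
  have ae: "AE w in M. 0 < A t w" by (rule AE_A_pos[OF t])
  have key: "has_bochner_integral M (\<lambda>w. p * (A t w * exp (- (k * A t w))) + q * exp (- k * A t w))
      ((p * (\<alpha> * t * k powr (\<alpha> - 1)) + q) * exp (- (t * k powr \<alpha>)))" if k: "0 < k" for k p q
  proof -
    have "has_bochner_integral M (\<lambda>w. exp (- k * A t w)) (exp (- (k powr \<alpha>) * t))"
      using A_laplace[of t k] exp_A_integrable[of t k] k t by (simp add: has_bochner_integral_iff)
    from has_bochner_integral_add[OF has_bochner_integral_mult_right[OF mean_A_exp[OF t k], of p] has_bochner_integral_mult_right[OF this, of q]]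
    show ?thesis by (simp add: algebra_simps)
  qed
  have pk: "k powr real n * k powr (\<alpha> - 1) = k powr (real n + \<alpha> - 1)" for k
    by (simp add: powr_add[symmetric] algebra_simps)
  have Fw: "has_bochner_integral M (F k) (indicator {0<..} k *\<^sub>R f k)" for k
  proof (cases "0 < k")
    case True
    have "has_bochner_integral M (\<lambda>w. ?S k * (k powr real n * (A t w * exp (- (k * A t w))) + (- real n * k powr (real n - 1)) * exp (- k * A t w)))
      (?S k * ((k powr real n * (\<alpha> * t * k powr (\<alpha> - 1)) + (- real n * k powr (real n - 1))) * exp (- (t * k powr \<alpha>))))"
      by (rule has_bochner_integral_mult_right[OF key[OF True]])
    moreover have "?S k * (k powr real n * (A t w * exp (- (k * A t w))) + (- real n * k powr (real n - 1)) * exp (- k * A t w)) = F k w" for w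
      using True by (simp add: F_def L.w_def algebra_simps)
    moreover have "?S k * ((k powr real n * (\<alpha> * t * k powr (\<alpha> - 1)) + (- real n * k powr (real n - 1))) * exp (- (t * k powr \<alpha>))) = indicator {0<..} k *\<^sub>R f k"
      using True unfolding f_def pk[symmetric] by (simp add: algebra_simps)
    ultimately show ?thesis by (simp only:)
  next
    case False
    then have "F k = (\<lambda>_. 0)" by (auto simp: F_def fun_eq_iff)
    then show ?thesis using False has_bochner_integral_zero[of M, where 'b = real] by simp
  qed
  let ?G = "\<lambda>k. indicator {0<..} k *\<^sub>R (1 / (pi * x) * (\<alpha> * t * (k powr (\<alpha> * (\<nu> * (real n + \<alpha>)) - 1) * exp (- (t * k powr \<alpha>))) + real n * (k powr (\<alpha> * (\<nu> * real n) - 1) * exp (- (t * k powr \<alpha>)))))"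
  have ex: "\<alpha> * (\<nu> * r) = r" for r using \<nu> by (simp add: mult.assoc[symmetric])
  have Gi: "integrable lborel ?G"
  proof -
    have 1: "set_integrable lborel {0<..} (\<lambda>k. \<alpha> * t * (k powr (\<alpha> * (\<nu> * (real n + \<alpha>)) - 1) * exp (- (t * k powr \<alpha>))))"
      by (rule set_integrable_mult_right, rule LINT_powr_exp_powr(1)) (use \<alpha> \<nu> t in auto)
    have 2: "set_integrable lborel {0<..} (\<lambda>k. real n * (k powr (\<alpha> * (\<nu> * real n) - 1) * exp (- (t * k powr \<alpha>))))"
    proof (cases "n = 0")
      case False
      show ?thesis by (rule set_integrable_mult_right, rule LINT_powr_exp_powr(1)) (use \<alpha> \<nu> t False in auto)
    qed (simp add: set_integrable_def)
    show ?thesis using set_integrable_mult_right[of "1 / (pi * x)", OF set_integral_add(1)[OF 1 2]]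
      by (simp only: set_integrable_def)
  qed
  have ab: "(LINT w|M. norm (F k w)) \<le> ?G k" for k
  proof (cases "0 < k")
    case True
    let ?r = "\<lambda>w. 1 / (pi * x) * (k powr real n * (A t w * exp (- (k * A t w))) + (real n * k powr (real n - 1)) * exp (- k * A t w))"
    have r: "has_bochner_integral M ?r (1 / (pi * x) * ((k powr real n * (\<alpha> * t * k powr (\<alpha> - 1)) + (real n * k powr (real n - 1))) * exp (- (t * k powr \<alpha>))))"
      by (rule has_bochner_integral_mult_right[OF key[OF True]])
    have "(LINT w|M. norm (F k w)) \<le> integral\<^sup>L M ?r"
    proof (rule integral_mono)
      show "integrable M (\<lambda>w. norm (F k w))" using Fw[of k] by (auto simp: has_bochner_integral_iff)
      show "integrable M ?r" using r by (simp only: has_bochner_integral_iff)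
      fix w assume "w \<in> space M"
      then have A0: "0 \<le> A t w" using t by (intro A_nonneg) auto
      have "\<bar>A t w * k powr real n - real n * k powr (real n - 1)\<bar> \<le> \<bar>A t w * k powr real n\<bar> + \<bar>real n * k powr (real n - 1)\<bar>"
        by (rule abs_triangle_ineq4)
      also have "\<dots> = A t w * k powr real n + real n * k powr (real n - 1)" using A0 by simp
      finally have "\<bar>?S k\<bar> * (\<bar>A t w * k powr real n - real n * k powr (real n - 1)\<bar> * exp (- (A t w * k)))
         \<le> 1 / (pi * x) * ((A t w * k powr real n + real n * k powr (real n - 1)) * exp (- (A t w * k)))"
        using x by (intro mult_mono L.S_bound mult_right_mono) auto
      moreover have "norm (F k w) = \<bar>?S k\<bar> * (\<bar>A t w * k powr real n - real n * k powr (real n - 1)\<bar> * exp (- (A t w * k)))"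
        using True by (simp add: F_def L.w_def abs_mult)
      moreover have "?r w = 1 / (pi * x) * ((A t w * k powr real n + real n * k powr (real n - 1)) * exp (- (A t w * k)))"
        by (simp add: algebra_simps)
      ultimately show "norm (F k w) \<le> ?r w" by (simp only:)
    qed
    also have "\<dots> = 1 / (pi * x) * ((k powr real n * (\<alpha> * t * k powr (\<alpha> - 1)) + (real n * k powr (real n - 1))) * exp (- (t * k powr \<alpha>)))"
      using r by (simp only: has_bochner_integral_iff)
    also have "\<dots> = ?G k"
      using True unfolding ex pk[symmetric] by (simp add: algebra_simps)
    finally show ?thesis .
  qed (simp add: F_def)
  have Fi: "integrable (lborel \<Otimes>\<^sub>M M) (case_prod F)"
  proof (rule P.Fubini_integrable[OF Fm])
    show "AE k in lborel. integrable M (\<lambda>w. case_prod F (k, w))"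
      using Fw by (auto simp: has_bochner_integral_iff)
    show "integrable lborel (\<lambda>k. LINT w|M. norm (case_prod F (k, w)))"
    proof (rule Bochner_Integration.integrable_bound[OF Gi])
      show "(\<lambda>k. LINT w|M. norm (case_prod F (k, w))) \<in> borel_measurable lborel" by measurable
      have "norm (LINT w|M. norm (case_prod F (k, w))) \<le> norm (?G k)" for k
      proof -
        have "norm (LINT w|M. norm (case_prod F (k, w))) = (LINT w|M. norm (F k w))" by simp
        also have "\<dots> \<le> ?G k" by (rule ab)
        also have "\<dots> \<le> norm (?G k)" unfolding real_norm_def by (rule abs_ge_self)
        finally show ?thesis .
      qed
      then show "AE k in lborel. norm (LINT w|M. norm (case_prod F (k, w))) \<le> norm (?G k)" by simp
    qed
  qed
  have fi: "set_integrable lborel {0<..} f"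
    using P.integrable_fst[OF Fi] Fw unfolding set_integrable_def by (simp add: has_bochner_integral_iff)
  have e: "(\<nu> * l powr (\<nu> - 1)) * f (l powr \<nu>) = N.w (\<nu> * real n) t l" if l: "0 < l" for l
  proof -
    have s: "?S (l powr \<nu>) = sine_mode x \<nu> l" by (simp add: sine_mode_def)
    have p1: "(l powr \<nu>) powr \<alpha> = l" using l \<nu> by (simp add: powr_powr)
    have x1: "\<nu> - 1 + \<nu> * (real n + \<alpha> - 1) = \<nu> * real n" using \<nu> by (simp add: algebra_simps)
    have p2: "l powr (\<nu> - 1) * (l powr \<nu>) powr (real n + \<alpha> - 1) = l powr (\<nu> * real n)"
      unfolding powr_powr powr_add[symmetric] x1 ..
    have x2: "\<nu> - 1 + \<nu> * (real n - 1) = \<nu> * real n - 1" by (simp add: algebra_simps)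
    have p3: "l powr (\<nu> - 1) * (l powr \<nu>) powr (real n - 1) = l powr (\<nu> * real n - 1)"
      unfolding powr_powr powr_add[symmetric] x2 ..
    have "(\<nu> * l powr (\<nu> - 1)) * f (l powr \<nu>)
      = sine_mode x \<nu> l * (((\<alpha> * \<nu>) * t * (l powr (\<nu> - 1) * (l powr \<nu>) powr (real n + \<alpha> - 1)) - \<nu> * real n * (l powr (\<nu> - 1) * (l powr \<nu>) powr (real n - 1))) * exp (- (t * l)))"
      unfolding f_def s p1 by (simp add: algebra_simps)
    also have "\<dots> = N.w (\<nu> * real n) t l"
      unfolding p2 p3 \<nu>(2) by (simp add: N.w_def)
    finally show ?thesis .
  qed
  have "(LINT w|M. L.W (real n) (A t w)) = (LINT w|M. LINT k|lborel. F k w)"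
    unfolding L.W_def F_def set_lebesgue_integral_def ..
  also have "\<dots> = (LINT k|lborel. LINT w|M. F k w)" by (rule P.Fubini_integral[OF Fi])
  also have "\<dots> = (LINT k:{0<..}|lborel. f k)"
    unfolding set_lebesgue_integral_def
    using Fw by (intro Bochner_Integration.integral_cong refl) (auto simp: has_bochner_integral_iff)
  also have "\<dots> = (LINT l:{0<..}|lborel. (\<nu> * l powr (\<nu> - 1)) * f (l powr \<nu>))"
  proof -
    have wi: "set_integrable lborel {0<..} (N.w (\<nu> * real n) t)"
    proof (rule N.w_integrable[OF _ t])
      show "\<nu> * real n = 0 \<or> N.strong (\<nu> * real n)"
        using \<nu> N.strong_pos[of "\<nu> * real n"] by (cases "n = 0") auto
    qed
    show ?thesis
    proof (rule LINT_substitution_halfline)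
      fix l :: real assume l: "0 < l"
      show "((\<lambda>l. l powr \<nu>) has_real_derivative \<nu> * l powr (\<nu> - 1)) (at l)"
        using l by (auto intro!: derivative_eq_intros)
      have c: "isCont f k" if "0 < k" for k
        unfolding f_def sine_mode_def using that x by (intro continuous_intros) auto
      show "isCont f (l powr \<nu>)" using l by (intro c) simp
      show "isCont (\<lambda>l. \<nu> * l powr (\<nu> - 1)) l" using l by (intro continuous_intros) auto
    next
      show "0 \<le> \<nu> * l powr (\<nu> - 1)" for l using \<nu> by simp
      have "((\<lambda>l. l powr \<nu>) \<longlongrightarrow> 0 powr \<nu>) (at_right 0)"
        using \<nu> by (intro tendsto_intros) (auto simp: eventually_at_right_less intro: eventually_at_rightI[of 0 1])
      then show "((\<lambda>l. l powr \<nu>) \<longlongrightarrow> 0) (at_right 0)" by simp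
      show "filterlim (\<lambda>l. l powr \<nu>) at_top at_top" using \<nu>(1) by real_asymp
      show "set_integrable lborel {0<..} (\<lambda>l. \<nu> * l powr (\<nu> - 1) * f (l powr \<nu>))"
        by (rule set_integrable_eq_on[OF wi]) (use e in auto)
    qed (rule fi)
  qed
  also have "\<dots> = N.W (\<nu> * real n) t"
    unfolding N.W_def by (rule set_lebesgue_integral_cong) (use e in auto)
  finally show ?thesis by (simp add: \<nu>_def)
qed

lemma A_small_pos:
  assumes t: "0 < t"
  shows "emeasure M {w \<in> space M. 0 < A t w \<and> A t w \<le> 1 / 2} \<noteq> 0"
proof
  have [measurable]: "A t \<in> borel_measurable M" using t by (simp add: A_measurable)
  assume "emeasure M {w \<in> space M. 0 < A t w \<and> A t w \<le> 1 / 2} = 0"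
  then have "AE w in M. \<not> (0 < A t w \<and> A t w \<le> 1 / 2)"
    by (intro AE_I[of _ _ "{w \<in> space M. 0 < A t w \<and> A t w \<le> 1 / 2}"]) auto
  then have "AE w in M. 1 / 2 < A t w"
    using AE_A_pos[OF t] by eventually_elim auto
  then show False using prob_A_small_pos[OF t, of "1 / 2"] by simp
qed

end

text \<open>The iterated right-sided derivatives of the density and the means of the derivatives of the kernel are the same Laplace integrals, up to the sign \<open>(-1)^n\<close>, the sign in the Taylor series of the backward shift.\<close>

lemma fractional_gamma_above_one:
  fixes M :: "'w measure"
  assumes "prob_space M" "standard_brownian_motion M B" "gamma_subordinator M G"
    and \<nu>: "1 < \<nu>" and st: "stable_subordinator M (1 / \<nu>) A"
    and ind: "independent_processes M B G A"
    and dens: "density_family M (\<lambda>t \<omega>. G (A t \<omega>) \<omega>) f"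
  shows "\<forall>t>0. distributed M lborel (\<lambda>\<omega>. B (G (A t \<omega>) \<omega>) \<omega>)
             (\<lambda>x. ennreal (subordinated_density f x t))"
    and "\<forall>x\<ge>0. \<forall>t>1. subordinated_density_finite f x t \<and>
             (\<nu> \<notin> \<nat> \<longrightarrow> rl_tail_converges \<nu> (\<lambda>s. subordinated_density f x s) t) \<longrightarrow>
             twice_differentiable_at (\<lambda>y. subordinated_density f y t) x \<and>
             rl_shift_exists \<nu> (- 1) (\<lambda>s. subordinated_density f x s) t \<and>
             1 / 2 * deriv (deriv (\<lambda>y. subordinated_density f y t)) x =
               subordinated_density f x t
               - rl_shift \<nu> (- 1) (\<lambda>s. subordinated_density f x s) t"
    and "\<forall>t>1. vanishes_at_infinity (\<lambda>x. subordinated_density f x t)"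
proof -
  interpret stable_process M "1 / \<nu>" A
    using assms by (simp add: stable_process_def stable_process_axioms_def)
  interpret gamma_time_change M B G A f
    using assms A_nonneg by (simp add: gamma_time_change_def gamma_time_change_axioms_def)
  show "\<forall>t>0. distributed M lborel (\<lambda>\<omega>. B (G (A t \<omega>) \<omega>) \<omega>)
             (\<lambda>x. ennreal (subordinated_density f x t))"
    using distributed_BGT by blast
  show "\<forall>t>1. vanishes_at_infinity (\<lambda>x. subordinated_density f x t)"
    using vanishes_at_infinity_density by simp
  show "\<forall>x\<ge>0. \<forall>t>1. subordinated_density_finite f x t \<and>
             (\<nu> \<notin> \<nat> \<longrightarrow> rl_tail_converges \<nu> (\<lambda>s. subordinated_density f x s) t) \<longrightarrow>
             twice_differentiable_at (\<lambda>y. subordinated_density f y t) x \<and>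
             rl_shift_exists \<nu> (- 1) (\<lambda>s. subordinated_density f x s) t \<and>
             1 / 2 * deriv (deriv (\<lambda>y. subordinated_density f y t)) x =
               subordinated_density f x t
               - rl_shift \<nu> (- 1) (\<lambda>s. subordinated_density f x s) t"
  proof (intro allI impI)
    fix x t :: real
    assume x0: "0 \<le> x" and t1: "1 < t"
      and fin: "subordinated_density_finite f x t \<and> (\<nu> \<notin> \<nat> \<longrightarrow> rl_tail_converges \<nu> (\<lambda>s. subordinated_density f x s) t)"
    have t: "0 < t" using t1 by simp
    have "x \<noteq> 0" using not_finite_at_0[OF t A_small_pos[OF t]] fin by auto
    then have x: "x \<noteq> 0" "0 < x" using x0 by auto
    define u where "u s = subordinated_density f x s" for s
    have us: "(\<lambda>s. subordinated_density f x s) = u" by (simp add: u_def fun_eq_iff)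
    interpret N: laplace_family "sine_mode x \<nu>" "1 / (pi * x)" "ln (1 + pi\<^sup>2 / (2 * x\<^sup>2)) powr (1 / \<nu>)"
      by (rule laplace_family_sine_mode) (use x \<nu> in auto)
    have mean: "(LINT w|M. vg_kernel x n (A s w)) = (- 1) ^ n * N.W (\<nu> * real n) s" if s: "0 < s" for s n
    proof -
      have "(LINT w|M. vg_kernel x n (A s w)) = (LINT w|M. (- 1) ^ n * laplace_family.W (sine_mode x 1) (real n) (A s w))"
      proof (rule integral_cong_AE)
        show "(\<lambda>w. vg_kernel x n (A s w)) \<in> borel_measurable M"
          using vg_kernel_series(3)[OF s x(1), of n] by simp
        show ae: "AE w in M. vg_kernel x n (A s w) = (- 1) ^ n * laplace_family.W (sine_mode x 1) (real n) (A s w)"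
          using AE_A_pos[OF s] by eventually_elim (rule vg_kernel_higher_sine_mode[OF x(2)])
        interpret L: laplace_family "sine_mode x 1" "1 / (pi * x)" "ln (1 + pi\<^sup>2 / (2 * x\<^sup>2)) powr (1 / 1)"
          by (rule laplace_family_sine_mode[OF x(2)]) simp
        have [measurable]: "A s \<in> borel_measurable M" using s by (simp add: A_measurable)
        have "L.W (real n) \<in> borel_measurable borel"
          unfolding L.W_def L.w_def set_lebesgue_integral_def by measurable
        then show "(\<lambda>w. (- 1) ^ n * L.W (real n) (A s w)) \<in> borel_measurable M" by measurable
      qed
      also have "\<dots> = (- 1) ^ n * N.W (\<nu> * real n) s"
        using mean_W[OF x(2) s, of n] by simp
      finally show ?thesis .
    qed
    have uW: "u s = N.W 0 s" if "0 < s" for s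
      using subordinated_density_eq(2)[OF that x(1)] mean[OF that, of 0] by (simp add: u_def)
    have tc: "rl_tail_converges \<nu> u t" if "\<nu> \<notin> \<nat>" using fin that by (simp add: us)
    have it: "(rl_right \<nu> ^^ n) u s = N.W (\<nu> * real n) s" "rl_right_exists \<nu> ((rl_right \<nu> ^^ n) u) s"
      if "0 < s" for s n
      using that N.rl_right_iterates[of \<nu> u t s n] \<nu> uW t tc by blast+
    have summand: "(- (- 1)) ^ n / fact n * (rl_right \<nu> ^^ n) u t = (- 1) ^ n / fact n * (LINT w|M. vg_kernel x n (A t w))" for n
      unfolding it(1)[OF t] mean[OF t] by (simp add: power_mult_distrib[symmetric])
    have "(\<lambda>n. (- (- 1)) ^ n / fact n * (rl_right \<nu> ^^ n) u t) sums
        (subordinated_density f x t - 1 / 2 * deriv (deriv (\<lambda>y. subordinated_density f y t)) x)"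
      unfolding summand by (rule vg_kernel_series(2)[OF t x(1)])
    then have sm: "summable (\<lambda>n. (- (- 1)) ^ n / fact n * (rl_right \<nu> ^^ n) u t)"
      and se: "rl_shift \<nu> (- 1) u t = subordinated_density f x t - 1 / 2 * deriv (deriv (\<lambda>y. subordinated_density f y t)) x"
      by (simp_all only: sums_iff rl_shift_def)
    have ex: "rl_right_exists \<nu> ((rl_right \<nu> ^^ n) u) s" if "t \<le> s" for s n
      using that t by (intro it(2)) auto
    have "twice_differentiable_at (\<lambda>y. subordinated_density f y t) x" by (rule vg_kernel_series(1)[OF t x(1)])
    moreover have "rl_shift_exists \<nu> (- 1) u t"
      unfolding rl_shift_exists_def using ex sm by blast
    ultimately show "twice_differentiable_at (\<lambda>y. subordinated_density f y t) x \<and>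
             rl_shift_exists \<nu> (- 1) (\<lambda>s. subordinated_density f x s) t \<and>
             1 / 2 * deriv (deriv (\<lambda>y. subordinated_density f y t)) x =
               subordinated_density f x t
               - rl_shift \<nu> (- 1) (\<lambda>s. subordinated_density f x s) t"
      unfolding us using se by (simp add: u_def[of t])
  qed
qed

theorem theorem8:
  fixes M :: "'w measure" and B G :: "real \<Rightarrow> 'w \<Rightarrow> real"
  assumes "prob_space M"
    and "standard_brownian_motion M B"
    and "gamma_subordinator M G"
  shows
    "(\<forall>(\<nu>::real) A f.
        0 < \<nu> \<and> \<nu> < 1 \<and>
        stable_subordinator M \<nu> A \<and>
        independent_processes M B G (inverse_process A) \<and>
        density_family M (\<lambda>t \<omega>. G (inverse_process A t \<omega>) \<omega>) f \<longrightarrow>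
          (\<forall>t>0. distributed M lborel (\<lambda>\<omega>. B (G (inverse_process A t \<omega>) \<omega>) \<omega>)
             (\<lambda>x. ennreal (subordinated_density f x t))) \<and>
          (\<forall>x\<ge>0. \<forall>t>1. subordinated_density_finite f x t \<longrightarrow>
             twice_differentiable_at (\<lambda>y. subordinated_density f y t) x \<and>
             caputo_shift_exists \<nu> (- 1) (\<lambda>s. subordinated_density f x s) t \<and>
             1 / 2 * deriv (deriv (\<lambda>y. subordinated_density f y t)) x =
               subordinated_density f x t
               - caputo_shift \<nu> (- 1) (\<lambda>s. subordinated_density f x s) t) \<and>
          (\<forall>t>1. vanishes_at_infinity (\<lambda>x. subordinated_density f x t)))
     \<and>
     (\<forall>(\<nu>::real) A f.
        1 < \<nu> \<and>
        stable_subordinator M (1 / \<nu>) A \<and>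
        independent_processes M B G A \<and>
        density_family M (\<lambda>t \<omega>. G (A t \<omega>) \<omega>) f \<longrightarrow>
          (\<forall>t>0. distributed M lborel (\<lambda>\<omega>. B (G (A t \<omega>) \<omega>) \<omega>)
             (\<lambda>x. ennreal (subordinated_density f x t))) \<and>
          (\<forall>x\<ge>0. \<forall>t>1. subordinated_density_finite f x t \<and>
             (\<nu> \<notin> \<nat> \<longrightarrow> rl_tail_converges \<nu> (\<lambda>s. subordinated_density f x s) t) \<longrightarrow>
             twice_differentiable_at (\<lambda>y. subordinated_density f y t) x \<and>
             rl_shift_exists \<nu> (- 1) (\<lambda>s. subordinated_density f x s) t \<and>
             1 / 2 * deriv (deriv (\<lambda>y. subordinated_density f y t)) x =
               subordinated_density f x t
               - rl_shift \<nu> (- 1) (\<lambda>s. subordinated_density f x s) t) \<and>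
          (\<forall>t>1. vanishes_at_infinity (\<lambda>x. subordinated_density f x t)))"
  by (rule conjI; intro allI impI; elim conjE; intro conjI)
     ((rule fractional_gamma_below_one(1)[OF assms]; assumption),
      (rule fractional_gamma_below_one(2)[OF assms]; assumption),
      (rule fractional_gamma_below_one(3)[OF assms]; assumption),
      (rule fractional_gamma_above_one(1)[OF assms]; assumption),
      (rule fractional_gamma_above_one(2)[OF assms]; assumption),
      (rule fractional_gamma_above_one(3)[OF assms]; assumption))

end
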